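(* For every nonnegative integer $s$, the set $$\left\{ \zeta_2(j) \;\middle|\; j \in \mathbb{Z} \cap [s+3,3s+5],\ j \text{ odd} \right\}$$ contains at least one irrational number (i.e. an element of $\mathbb{Q}_2$ not lying in $\mathbb{Q}$). In particular, at least one of the four $2$-adic numbers $\zeta_2(7),\zeta_2(9),\zeta_2(11),\zeta_2(13)$ is irrational.
   Context: Volkenborn integral: for $f:\mathbb{Z}_2\to\mathbb{Q}_2$, $\int_{\mathbb{Z}_2} f(t)\,\mathrm{d}t := \lim_{N\to\infty}\frac{1}{2^N}\sum_{k=0}^{2^N-1} f(k)$ whenever the limit exists $2$-adically. Teichmüller character for $p=2$: for $x\in\mathbb{Z}_2^\times$, $\omega(x)\in\{1,-1\}$ is the unique sign with $x\equiv\omega(x)\pmod{4\mathbb{Z}_2}$; for $x\in\mathbb{Q}_2^\times$, $\omega(x):=2^{v_2(x)}\omega(x/2^{v_2(x)})$ and $\langle x\rangle:=x/\omega(x)$. $2$-adic Hurwitz zeta function: for $x\in\mathbb{Q}_2$ with $|x|_2\geqslant 4$ and an integer $j\geqslant 2$, $\zeta_2(j,x):=\frac{1}{j-1}\int_{\mathbb{Z}_2}\langle t+x\rangle^{1-j}\,\mathrm{d}t$. $2$-adic $L$-function: for a primitive Dirichlet character $\chi$ of conductor $f$, and $M$ any common multiple of $f$ and $4$, $L_2(j,\chi):=\frac{\langle M\rangle^{1-j}}{M}\sum_{0\leqslant a\leqslant M-1,\ 2\nmid a}\chi(a)\,\zeta_2(j,a/M)$ (independent of the choice of $M$). $2$-adic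 zeta values: $\zeta_2(j):=L_2(j,\omega^{1-j})$ for an integer $j\geqslant 2$ (the Kubota–Leopoldt $2$-adic zeta function). For odd $j\geqslant 3$ the character $\omega^{1-j}$ is trivial, so (taking $M=4$) $\zeta_2(j)=\frac14\left(\zeta_2(j,\tfrac14)+\zeta_2(j,\tfrac34)\right)$. *)

theory Defs
  imports Complex_Main "HOL-Computational_Algebra.Primes" "HOL-Number_Theory.Cong"
begin

section \<open>The 2-adic absolute value on the rationals\<close>

definition val2_rat :: "rat \<Rightarrow> int" where
  "val2_rat r = int (multiplicity 2 (fst (quotient_of r))) - int (multiplicity 2 (snd (quotient_of r)))"

definition abs2_rat :: "rat \<Rightarrow> real" where
  "abs2_rat r = (if r = 0 then 0 else 2 powi (- val2_rat r))"

lemma two_powi_inject: "(2::real) powi m = 2 powi n \<longleftrightarrow> m = n"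
  using power_int_strict_increasing[of m n "2::real"] power_int_strict_increasing[of n m "2::real"]
  by (metis less_irrefl linorder_neqE one_less_numeral_iff semiring_norm(76))

lemma rat_frac:
  fixes r :: rat
  obtains p q :: int where "r = of_int p / of_int q" "q \<noteq> 0"
  by (metis Fract_of_int_quotient Rat_cases less_irrefl)

lemma val2_rat_divide:
  fixes a b :: int
  assumes "a \<noteq> 0" "b \<noteq> 0"
  shows "val2_rat (of_int a / of_int b) = int (multiplicity 2 a) - int (multiplicity 2 b)"
proof -
  obtain p q where pq: "quotient_of (of_int a / of_int b) = (p, q)"
    by (cases "quotient_of (of_int a / of_int b)") auto
  have q: "q > 0" using quotient_of_denom_pos[OF pq] .
  have eq: "(of_int a / of_int b :: rat) = of_int p / of_int q"
    using quotient_of_div[OF pq] .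
  have "(of_int (a * q) :: rat) = of_int (p * b)"
    using eq assms q by (simp add: field_simps)
  then have e: "a * q = p * b" by (simp only: of_int_eq_iff)
  have p: "p \<noteq> 0" using e assms q by auto
  have "multiplicity 2 a + multiplicity 2 q = multiplicity 2 p + multiplicity 2 b"
    using e assms p q
    by (metis less_irrefl prime_elem_multiplicity_mult_distrib prime_imp_prime_elem two_is_prime)
  then show ?thesis unfolding val2_rat_def pq by simp
qed

lemma abs2_rat_0 [simp]: "abs2_rat 0 = 0"
  by (simp add: abs2_rat_def)

lemma abs2_rat_eq_0 [simp]: "abs2_rat r = 0 \<longleftrightarrow> r = 0"
  by (simp add: abs2_rat_def)

lemma abs2_rat_nonneg [simp]: "0 \<le> abs2_rat r"
  by (simp add: abs2_rat_def)

lemma abs2_rat_pos: "r \<noteq> 0 \<Longrightarrow> 0 < abs2_rat r"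
  by (simp add: abs2_rat_def)

lemma abs2_rat_mult: "abs2_rat (r * s) = abs2_rat r * abs2_rat s"
proof (cases "r = 0 \<or> s = 0")
  case False
  obtain a b where r: "r = of_int a / of_int b" "b \<noteq> 0" by (rule rat_frac)
  obtain c d where s: "s = of_int c / of_int d" "d \<noteq> 0" by (rule rat_frac)
  have nz: "a \<noteq> 0" "c \<noteq> 0" using False r s by auto
  have "r * s = of_int (a * c) / of_int (b * d)" using r s by simp
  then have "val2_rat (r * s) = int (multiplicity 2 (a * c)) - int (multiplicity 2 (b * d))"
    using val2_rat_divide[of "a * c" "b * d"] nz r s by simp
  also have "\<dots> = val2_rat r + val2_rat s"
    using val2_rat_divide[of a b] val2_rat_divide[of c d] nz r s
    by (simp add: prime_elem_multiplicity_mult_distrib)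
  finally have "val2_rat (r * s) = val2_rat r + val2_rat s" .
  then show ?thesis using False
    by (simp add: abs2_rat_def flip: power_int_add)
qed auto

lemma abs2_rat_1 [simp]: "abs2_rat 1 = 1"
  using abs2_rat_mult[of 1 1] abs2_rat_eq_0[of 1] by simp

lemma abs2_rat_minus [simp]: "abs2_rat (- r) = abs2_rat r"
proof -
  have "abs2_rat (-1) * abs2_rat (-1) = 1"
    using abs2_rat_mult[of "-1" "-1"] by simp
  then have "abs2_rat (-1) = 1"
    using abs2_rat_nonneg[of "-1"] by (metis abs_of_nonneg abs_one real_sqrt_abs2 real_sqrt_one)
  then show ?thesis using abs2_rat_mult[of "-1" r] by simp
qed

lemma abs2_rat_diff_commute: "abs2_rat (r - s) = abs2_rat (s - r)"
  using abs2_rat_minus[of "r - s"] by simp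

lemma abs2_rat_inverse: "abs2_rat (inverse r) = inverse (abs2_rat r)"
proof (cases "r = 0")
  case False
  then show ?thesis using abs2_rat_mult[of r "inverse r"]
    by (metis abs2_rat_1 inverse_unique right_inverse)
qed auto

lemma abs2_rat_add: "abs2_rat (r + s) \<le> max (abs2_rat r) (abs2_rat s)"
proof (cases "r = 0 \<or> s = 0 \<or> r + s = 0")
  case True
  then show ?thesis by (auto simp: le_max_iff_disj)
next
  case False
  obtain a b where r: "r = of_int a / of_int b" "b \<noteq> 0" by (rule rat_frac)
  obtain c d where s: "s = of_int c / of_int d" "d \<noteq> 0" by (rule rat_frac)
  let ?m = "multiplicity (2::int)"
  have nz: "a * d \<noteq> 0" "c * b \<noteq> 0" "b * d \<noteq> 0" using False r s by auto
  have rr: "r = of_int (a * d) / of_int (b * d)" and ss: "s = of_int (c * b) / of_int (b * d)"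
    using r s by simp_all
  have rs: "r + s = of_int (a * d + c * b) / of_int (b * d)"
    using r s by (simp add: field_simps)
  have nz': "a * d + c * b \<noteq> 0" using rs False by (metis div_0 of_int_0)
  have "2 ^ min (?m (a * d)) (?m (c * b)) dvd a * d + c * b"
    by (intro dvd_add multiplicity_dvd') auto
  then have "min (?m (a * d)) (?m (c * b)) \<le> ?m (a * d + c * b)"
    using nz' by (intro multiplicity_geI) auto
  then have "min (val2_rat r) (val2_rat s) \<le> val2_rat (r + s)"
    using val2_rat_divide[OF nz(1,3)] val2_rat_divide[OF nz(2,3)] val2_rat_divide[OF nz' nz(3)]
    unfolding rs[symmetric] rr[symmetric] ss[symmetric] by simp
  then have "val2_rat r \<le> val2_rat (r + s) \<or> val2_rat s \<le> val2_rat (r + s)" by linarith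
  then show ?thesis using False
    by (auto simp: abs2_rat_def le_max_iff_disj intro!: power_int_increasing)
qed

lemma abs2_rat_diff: "abs2_rat (r - s) \<le> max (abs2_rat r) (abs2_rat s)"
  using abs2_rat_add[of r "- s"] by simp

lemma abs2_rat_eqI:
  assumes "abs2_rat (r - s) < abs2_rat s"
  shows "abs2_rat r = abs2_rat s"
  using abs2_rat_add[of "r - s" s] abs2_rat_diff[of r "r - s"] assms by (simp add: max_def split: if_splits)


section \<open>The field of 2-adic numbers\<close>

text \<open>The field of 2-adic numbers is the completion of the rationals with respect to the 2-adic
  absolute value: 2-adic Cauchy sequences of rationals modulo 2-adic null sequences.\<close>

definition null2 :: "(nat \<Rightarrow> rat) \<Rightarrow> bool" where
  "null2 X \<longleftrightarrow> (\<forall>e>0. \<exists>K. \<forall>n\<ge>K. abs2_rat (X n) < e)"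

definition cauchy2 :: "(nat \<Rightarrow> rat) \<Rightarrow> bool" where
  "cauchy2 X \<longleftrightarrow> (\<forall>e>0. \<exists>K. \<forall>m\<ge>K. \<forall>n\<ge>K. abs2_rat (X m - X n) < e)"

lemma null2D:
  assumes "null2 X" "0 < e"
  obtains K where "\<And>n. n \<ge> K \<Longrightarrow> abs2_rat (X n) < e"
  using assms unfolding null2_def by metis

lemma cauchy2D:
  assumes "cauchy2 X" "0 < e"
  obtains K where "\<And>m n. m \<ge> K \<Longrightarrow> n \<ge> K \<Longrightarrow> abs2_rat (X m - X n) < e"
  using assms unfolding cauchy2_def by metis

lemma null2_const [simp]: "null2 (\<lambda>n. c) \<longleftrightarrow> c = 0"
  unfolding null2_def using abs2_rat_pos[of c] by auto

lemma null2_minus: "null2 X \<Longrightarrow> null2 (\<lambda>n. - X n)"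
  by (simp add: null2_def)

lemma null2_add:
  assumes "null2 X" "null2 Y"
  shows "null2 (\<lambda>n. X n + Y n)"
  unfolding null2_def
proof (intro allI impI)
  fix e :: real assume e: "e > 0"
  obtain K where K: "\<And>n. n \<ge> K \<Longrightarrow> abs2_rat (X n) < e" using null2D[OF assms(1) e] by blast
  obtain L where L: "\<And>n. n \<ge> L \<Longrightarrow> abs2_rat (Y n) < e" using null2D[OF assms(2) e] by blast
  show "\<exists>K. \<forall>n\<ge>K. abs2_rat (X n + Y n) < e"
  proof (intro exI[of _ "max K L"] allI impI)
    fix n assume "max K L \<le> n"
    then show "abs2_rat (X n + Y n) < e"
      using K[of n] L[of n] abs2_rat_add[of "X n" "Y n"] by simp
  qed
qed

lemma cauchy2_const [simp]: "cauchy2 (\<lambda>n. c)"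
  by (simp add: cauchy2_def)

lemma cauchy2_add [simp]:
  assumes "cauchy2 X" "cauchy2 Y"
  shows "cauchy2 (\<lambda>n. X n + Y n)"
  unfolding cauchy2_def
proof (intro allI impI)
  fix e :: real assume e: "e > 0"
  obtain K where K: "\<And>m n. m \<ge> K \<Longrightarrow> n \<ge> K \<Longrightarrow> abs2_rat (X m - X n) < e"
    using cauchy2D[OF assms(1) e] by blast
  obtain L where L: "\<And>m n. m \<ge> L \<Longrightarrow> n \<ge> L \<Longrightarrow> abs2_rat (Y m - Y n) < e"
    using cauchy2D[OF assms(2) e] by blast
  show "\<exists>K. \<forall>m\<ge>K. \<forall>n\<ge>K. abs2_rat ((X m + Y m) - (X n + Y n)) < e"
  proof (intro exI[of _ "max K L"] allI impI)
    fix m n assume "max K L \<le> m" "max K L \<le> n"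
    then show "abs2_rat ((X m + Y m) - (X n + Y n)) < e"
      using K[of m n] L[of m n] abs2_rat_add[of "X m - X n" "Y m - Y n"]
      by (simp add: add_diff_add)
  qed
qed

lemma cauchy2_minus [simp]: "cauchy2 X \<Longrightarrow> cauchy2 (\<lambda>n. - X n)"
  unfolding cauchy2_def by (simp add: abs2_rat_diff_commute)

lemma cauchy2_cases:
  assumes "cauchy2 X" "\<not> null2 X"
  obtains c K where "c > 0" "\<And>n. n \<ge> K \<Longrightarrow> abs2_rat (X n) = c"
proof -
  obtain e where e: "e > 0" "\<And>K. \<exists>n\<ge>K. e \<le> abs2_rat (X n)"
    using assms(2) unfolding null2_def by (auto simp: not_less)
  obtain K where K: "\<And>m n. m \<ge> K \<Longrightarrow> n \<ge> K \<Longrightarrow> abs2_rat (X m - X n) < e"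
    using cauchy2D[OF assms(1) e(1)] by blast
  obtain k where k: "k \<ge> K" "e \<le> abs2_rat (X k)" using e(2) by blast
  show thesis
  proof
    show "abs2_rat (X k) > 0" using e(1) k(2) by simp
    fix n assume "n \<ge> K"
    then have "abs2_rat (X n - X k) < abs2_rat (X k)" using K[of n k] k by simp
    then show "abs2_rat (X n) = abs2_rat (X k)" by (rule abs2_rat_eqI)
  qed
qed

lemma cauchy2_bounded:
  assumes "cauchy2 X"
  obtains b K where "b > 0" "\<And>n. n \<ge> K \<Longrightarrow> abs2_rat (X n) \<le> b"
proof (cases "null2 X")
  case True
  then show thesis using that[of 1] null2D[OF True, of 1] by (metis less_imp_le zero_less_one)
next
  case False
  then show thesis using that cauchy2_cases[OF assms False] by (metis order_refl)
qed

lemma null2_mult: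
  assumes "cauchy2 X" "null2 Y"
  shows "null2 (\<lambda>n. X n * Y n)"
  unfolding null2_def
proof (intro allI impI)
  fix e :: real assume e: "e > 0"
  obtain b K where b: "b > 0" "\<And>n. n \<ge> K \<Longrightarrow> abs2_rat (X n) \<le> b"
    using cauchy2_bounded[OF assms(1)] by blast
  obtain L where L: "\<And>n. n \<ge> L \<Longrightarrow> abs2_rat (Y n) < e / b"
    using null2D[OF assms(2), of "e / b"] e b by auto
  show "\<exists>K. \<forall>n\<ge>K. abs2_rat (X n * Y n) < e"
  proof (intro exI[of _ "max K L"] allI impI)
    fix n assume n: "max K L \<le> n"
    have "abs2_rat (X n) * abs2_rat (Y n) \<le> b * abs2_rat (Y n)"
      using b n by (intro mult_right_mono) auto
    also have "\<dots> < b * (e / b)" using b L[of n] n by (intro mult_strict_left_mono) auto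
    finally show "abs2_rat (X n * Y n) < e" using b by (simp add: abs2_rat_mult)
  qed
qed

lemma cauchy2_mult [simp]:
  assumes "cauchy2 X" "cauchy2 Y"
  shows "cauchy2 (\<lambda>n. X n * Y n)"
  unfolding cauchy2_def
proof (intro allI impI)
  fix e :: real assume e: "e > 0"
  obtain a A where a: "a > 0" "\<And>n. n \<ge> A \<Longrightarrow> abs2_rat (X n) \<le> a"
    using cauchy2_bounded[OF assms(1)] by blast
  obtain b B where b: "b > 0" "\<And>n. n \<ge> B \<Longrightarrow> abs2_rat (Y n) \<le> b"
    using cauchy2_bounded[OF assms(2)] by blast
  obtain K where K: "\<And>m n. m \<ge> K \<Longrightarrow> n \<ge> K \<Longrightarrow> abs2_rat (X m - X n) < e / b"
    using cauchy2D[OF assms(1), of "e / b"] e b by auto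
  obtain L where L: "\<And>m n. m \<ge> L \<Longrightarrow> n \<ge> L \<Longrightarrow> abs2_rat (Y m - Y n) < e / a"
    using cauchy2D[OF assms(2), of "e / a"] e a by auto
  show "\<exists>K. \<forall>m\<ge>K. \<forall>n\<ge>K. abs2_rat (X m * Y m - X n * Y n) < e"
  proof (intro exI[of _ "max (max A B) (max K L)"] allI impI)
    fix m n assume *: "max (max A B) (max K L) \<le> m" "max (max A B) (max K L) \<le> n"
    have "abs2_rat (X m * (Y m - Y n)) \<le> a * abs2_rat (Y m - Y n)"
      unfolding abs2_rat_mult using a * by (intro mult_right_mono) auto
    also have "\<dots> < a * (e / a)" using a L[of m n] * by (intro mult_strict_left_mono) auto
    finally have 1: "abs2_rat (X m * (Y m - Y n)) < e" using a by simp
    have "abs2_rat ((X m - X n) * Y n) \<le> abs2_rat (X m - X n) * b"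
      unfolding abs2_rat_mult using b * by (intro mult_left_mono) auto
    also have "\<dots> < (e / b) * b" using b K[of m n] * by (intro mult_strict_right_mono) auto
    finally have 2: "abs2_rat ((X m - X n) * Y n) < e" using b by simp
    have "X m * Y m - X n * Y n = X m * (Y m - Y n) + (X m - X n) * Y n"
      by (simp add: algebra_simps)
    then show "abs2_rat (X m * Y m - X n * Y n) < e"
      using 1 2 abs2_rat_add[of "X m * (Y m - Y n)" "(X m - X n) * Y n"] by simp
  qed
qed

lemma cauchy2_inverse:
  assumes "cauchy2 X" "\<not> null2 X"
  shows "cauchy2 (\<lambda>n. inverse (X n))"
  unfolding cauchy2_def
proof (intro allI impI)
  fix e :: real assume e: "e > 0"
  obtain c K where c: "c > 0" "\<And>n. n \<ge> K \<Longrightarrow> abs2_rat (X n) = c"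
    using cauchy2_cases[OF assms] by blast
  obtain L where L: "\<And>m n. m \<ge> L \<Longrightarrow> n \<ge> L \<Longrightarrow> abs2_rat (X m - X n) < e * c * c"
    using cauchy2D[OF assms(1), of "e * c * c"] e c by auto
  show "\<exists>K. \<forall>m\<ge>K. \<forall>n\<ge>K. abs2_rat (inverse (X m) - inverse (X n)) < e"
  proof (intro exI[of _ "max K L"] allI impI)
    fix m n assume *: "max K L \<le> m" "max K L \<le> n"
    have m: "abs2_rat (X m) = c" and n: "abs2_rat (X n) = c" using c * by auto
    then have "X m \<noteq> 0" "X n \<noteq> 0" using c(1) by auto
    then have "inverse (X m) - inverse (X n) = - (inverse (X m) * (X m - X n) * inverse (X n))"
      by (rule inverse_diff_inverse)
    then have "abs2_rat (inverse (X m) - inverse (X n)) = abs2_rat (X m - X n) / (c * c)"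
      by (simp only: abs2_rat_minus abs2_rat_mult abs2_rat_inverse m n) (simp add: field_simps)
    also have "\<dots> < e" using L[of m n] * c(1) by (simp add: field_simps)
    finally show "abs2_rat (inverse (X m) - inverse (X n)) < e" .
  qed
qed

definition q2rel :: "(nat \<Rightarrow> rat) \<Rightarrow> (nat \<Rightarrow> rat) \<Rightarrow> bool" where
  "q2rel X Y \<longleftrightarrow> cauchy2 X \<and> cauchy2 Y \<and> null2 (\<lambda>n. X n - Y n)"

lemma q2rel_refl: "cauchy2 X \<Longrightarrow> q2rel X X"
  by (simp add: q2rel_def)

lemma part_equivp_q2rel: "part_equivp q2rel"
proof (rule part_equivpI)
  show "\<exists>X. q2rel X X" using q2rel_refl[OF cauchy2_const] by blast
  show "symp q2rel"
  proof (rule sympI)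
    fix X Y assume "q2rel X Y"
    then show "q2rel Y X" using null2_minus[of "\<lambda>n. X n - Y n"] by (simp add: q2rel_def)
  qed
  show "transp q2rel"
  proof (rule transpI)
    fix X Y Z assume "q2rel X Y" "q2rel Y Z"
    then show "q2rel X Z"
      using null2_add[of "\<lambda>n. X n - Y n" "\<lambda>n. Y n - Z n"] by (auto simp: q2rel_def)
  qed
qed

quotient_type q2 = "nat \<Rightarrow> rat" / partial: q2rel
  morphisms rep_q2 Q2
  by (rule part_equivp_q2rel)

lemma Q2_cases [cases type: q2]:
  obtains X where "x = Q2 X" "cauchy2 X"
  by (induct x) (auto simp: q2rel_def)

lemma Q2_eq_iff: "cauchy2 X \<Longrightarrow> cauchy2 Y \<Longrightarrow> Q2 X = Q2 Y \<longleftrightarrow> null2 (\<lambda>n. X n - Y n)"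
  using Quotient3_rel[OF Quotient3_q2] q2rel_refl by (metis q2rel_def)

lemma null2_cong:
  assumes "null2 (\<lambda>n. X n - Y n)"
  shows "null2 X \<longleftrightarrow> null2 Y"
  using null2_add[OF assms, of Y] null2_add[OF null2_minus[OF assms], of X] by auto

instantiation q2 :: field
begin

lift_definition zero_q2 :: q2 is "\<lambda>n. 0" by (simp add: q2rel_refl)

lift_definition one_q2 :: q2 is "\<lambda>n. 1" by (simp add: q2rel_refl)

lift_definition plus_q2 :: "q2 \<Rightarrow> q2 \<Rightarrow> q2" is "\<lambda>X Y n. X n + Y n"
  unfolding q2rel_def add_diff_add by (simp add: null2_add)

lift_definition uminus_q2 :: "q2 \<Rightarrow> q2" is "\<lambda>X n. - X n"
  unfolding q2rel_def minus_diff_minus by (simp add: null2_minus del: minus_diff_eq)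

lift_definition times_q2 :: "q2 \<Rightarrow> q2 \<Rightarrow> q2" is "\<lambda>X Y n. X n * Y n"
proof -
  fix X X' Y Y' assume X: "q2rel X X'" and Y: "q2rel Y Y'"
  have "null2 (\<lambda>n. X n * (Y n - Y' n) + Y' n * (X n - X' n))"
    using X Y by (intro null2_add null2_mult) (auto simp: q2rel_def)
  then show "q2rel (\<lambda>n. X n * Y n) (\<lambda>n. X' n * Y' n)"
    using X Y by (auto simp: q2rel_def algebra_simps)
qed

lift_definition inverse_q2 :: "q2 \<Rightarrow> q2"
  is "\<lambda>X. if null2 X then (\<lambda>n. 0) else (\<lambda>n. inverse (X n))"
proof -
  fix X Y assume XY: "q2rel X Y"
  show "q2rel (if null2 X then (\<lambda>n. 0) else (\<lambda>n. inverse (X n)))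
              (if null2 Y then (\<lambda>n. 0) else (\<lambda>n. inverse (Y n)))"
  proof (cases "null2 X")
    case True
    then show ?thesis using null2_cong[of X Y] XY by (auto simp: q2rel_def)
  next
    case False
    then have Y: "\<not> null2 Y" using null2_cong[of X Y] XY by (auto simp: q2rel_def)
    have X': "cauchy2 X" and Y': "cauchy2 Y" using XY by (auto simp: q2rel_def)
    obtain c K where c: "c > 0" "\<And>n. n \<ge> K \<Longrightarrow> abs2_rat (X n) = c"
      using cauchy2_cases[OF X' False] by blast
    obtain d L where d: "d > 0" "\<And>n. n \<ge> L \<Longrightarrow> abs2_rat (Y n) = d"
      using cauchy2_cases[OF Y' Y] by blast
    have "null2 (\<lambda>n. inverse (X n) * (inverse (Y n) * (X n - Y n)))"
      using XY False Y by (intro null2_mult cauchy2_inverse) (auto simp: q2rel_def)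
    then have N: "null2 (\<lambda>n. - (inverse (X n) * (inverse (Y n) * (X n - Y n))))"
      by (rule null2_minus)
    have eq: "- (inverse (X n) * (inverse (Y n) * (X n - Y n))) = inverse (X n) - inverse (Y n)"
      if "n \<ge> max K L" for n
    proof -
      have "X n \<noteq> 0" "Y n \<noteq> 0" using c(1) c(2)[of n] d(1) d(2)[of n] that by auto
      then show ?thesis by (simp add: field_simps)
    qed
    have "null2 (\<lambda>n. inverse (X n) - inverse (Y n))"
      unfolding null2_def
    proof (intro allI impI)
      fix e :: real assume "e > 0"
      then obtain M where M: "\<And>n. n \<ge> M \<Longrightarrow>
          abs2_rat (- (inverse (X n) * (inverse (Y n) * (X n - Y n)))) < e"
        using null2D[OF N] by blast
      show "\<exists>K. \<forall>n\<ge>K. abs2_rat (inverse (X n) - inverse (Y n)) < e"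
        using M eq by (intro exI[of _ "max (max K L) M"]) (metis max.bounded_iff)
    qed
    then show ?thesis using False Y X' Y' by (simp add: q2rel_def cauchy2_inverse)
  qed
qed

definition minus_q2 :: "q2 \<Rightarrow> q2 \<Rightarrow> q2" where "x - y = x + - (y::q2)"

definition divide_q2 :: "q2 \<Rightarrow> q2 \<Rightarrow> q2" where "x div y = x * inverse (y::q2)"

instance
proof
  fix a b c :: q2
  show "a + b + c = a + (b + c)" "a + b = b + a" "0 + a = a" "- a + a = 0"
       "a * b * c = a * (b * c)" "a * b = b * a" "1 * a = a" "(a + b) * c = a * c + b * c"
    by (transfer, simp add: q2rel_def algebra_simps)+
  show "a - b = a + - b" by (rule minus_q2_def)
  show "a div b = a * inverse b" by (rule divide_q2_def)
  show "(0::q2) \<noteq> 1" by transfer (simp add: q2rel_def)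
  show "inverse (0::q2) = 0" by transfer (simp add: q2rel_def)
  show "inverse a * a = 1" if "a \<noteq> 0"
    using that
  proof transfer
    fix X assume X: "q2rel X X" and nz: "\<not> q2rel X (\<lambda>n. 0)"
    then have X': "cauchy2 X" "\<not> null2 X" by (auto simp: q2rel_def)
    then obtain c K where c: "c > 0" "\<And>n. n \<ge> K \<Longrightarrow> abs2_rat (X n) = c"
      using cauchy2_cases by blast
    have "inverse (X n) * X n - 1 = 0" if "n \<ge> K" for n
    proof -
      have "X n \<noteq> 0" using c(1) c(2)[OF that] by auto
      then show ?thesis by simp
    qed
    then have "null2 (\<lambda>n. inverse (X n) * X n - 1)"
      unfolding null2_def by (metis abs2_rat_0)
    then show "q2rel (\<lambda>n. (if null2 X then (\<lambda>n. 0) else (\<lambda>n. inverse (X n))) n * X n) (\<lambda>n. 1)"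
      using X' by (simp add: q2rel_def cauchy2_inverse)
  qed
qed

end

lemma Q2_zero: "0 = Q2 (\<lambda>n. 0)" and Q2_one: "1 = Q2 (\<lambda>n. 1)"
  by (fact zero_q2.abs_eq one_q2.abs_eq)+

lemma Q2_diff: "cauchy2 X \<Longrightarrow> cauchy2 Y \<Longrightarrow> Q2 X - Q2 Y = Q2 (\<lambda>n. X n - Y n)"
  by (simp add: minus_q2_def plus_q2.abs_eq uminus_q2.abs_eq q2rel_refl)

lemma of_nat_Q2: "of_nat k = Q2 (\<lambda>n. of_nat k)"
  by (induct k) (simp_all add: Q2_zero Q2_one plus_q2.abs_eq q2rel_refl)

instance q2 :: field_char_0
proof
  show "inj (of_nat :: nat \<Rightarrow> q2)"
    by (rule injI) (simp add: of_nat_Q2 Q2_eq_iff)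
qed

lemma of_int_Q2: "of_int k = Q2 (\<lambda>n. of_int k)"
  by (cases k rule: int_cases2) (simp_all add: of_nat_Q2 uminus_q2.abs_eq q2rel_refl)

lemma of_rat_Q2: "of_rat r = Q2 (\<lambda>n. r)"
proof -
  obtain p q where r: "r = of_int p / of_int q" "q \<noteq> 0" by (rule rat_frac)
  have "of_rat r * of_int q = (of_int p :: q2)" using r by (simp add: of_rat_divide)
  moreover have "Q2 (\<lambda>n. r) * of_int q = of_int p"
    using r by (simp add: of_int_Q2 times_q2.abs_eq q2rel_refl)
  ultimately show ?thesis using r(2) by (metis mult_right_cancel of_int_eq_0_iff)
qed

lift_definition abs2 :: "q2 \<Rightarrow> real" is "\<lambda>X. lim (\<lambda>n. abs2_rat (X n))"
proof -
  fix X Y assume XY: "q2rel X Y"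
  have "(\<lambda>n. abs2_rat (X n) - abs2_rat (Y n)) \<longlonglongrightarrow> 0"
  proof (rule LIMSEQ_I)
    fix e :: real assume "e > 0"
    then obtain K where K: "\<And>n. n \<ge> K \<Longrightarrow> abs2_rat (X n - Y n) < e"
      using XY null2D unfolding q2rel_def by metis
    have "\<bar>abs2_rat (X n) - abs2_rat (Y n)\<bar> \<le> abs2_rat (X n - Y n)" for n
    proof -
      have "abs2_rat (X n) \<le> max (abs2_rat (X n - Y n)) (abs2_rat (Y n))"
        using abs2_rat_add[of "X n - Y n" "Y n"] by simp
      moreover have "abs2_rat (Y n) \<le> max (abs2_rat (X n)) (abs2_rat (X n - Y n))"
        using abs2_rat_diff[of "X n" "X n - Y n"] by simp
      ultimately show ?thesis
        using abs2_rat_nonneg[of "X n"] abs2_rat_nonneg[of "Y n"] abs2_rat_nonneg[of "X n - Y n"]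
        by linarith
    qed
    then show "\<exists>K. \<forall>n\<ge>K. norm (abs2_rat (X n) - abs2_rat (Y n) - 0) < e"
      using K by (metis diff_zero le_less_trans real_norm_def)
  qed
  then have "(\<lambda>n. abs2_rat (X n)) \<longlonglongrightarrow> l \<longleftrightarrow> (\<lambda>n. abs2_rat (Y n)) \<longlonglongrightarrow> l" for l
    using tendsto_diff[of "\<lambda>n. abs2_rat (X n)" l sequentially "\<lambda>n. abs2_rat (X n) - abs2_rat (Y n)" 0]
      tendsto_add[of "\<lambda>n. abs2_rat (Y n)" l sequentially "\<lambda>n. abs2_rat (X n) - abs2_rat (Y n)" 0]
    by auto
  then show "lim (\<lambda>n. abs2_rat (X n)) = lim (\<lambda>n. abs2_rat (Y n))"
    unfolding lim_def by simp
qed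

lemma abs2_Q2_cases:
  assumes "cauchy2 X"
  shows "null2 X \<and> abs2 (Q2 X) = 0 \<or>
    abs2 (Q2 X) > 0 \<and> (\<exists>K. \<forall>n\<ge>K. abs2_rat (X n) = abs2 (Q2 X))"
proof -
  have N: "abs2 (Q2 X) = lim (\<lambda>n. abs2_rat (X n))"
    using assms by (simp add: abs2.abs_eq q2rel_refl)
  show ?thesis
  proof (cases "null2 X")
    case True
    then have "(\<lambda>n. abs2_rat (X n)) \<longlonglongrightarrow> 0"
      by (intro LIMSEQ_I) (simp add: null2_def)
    then show ?thesis using True N by (simp add: limI)
  next
    case False
    then obtain c K where c: "c > 0" "\<And>n. n \<ge> K \<Longrightarrow> abs2_rat (X n) = c"
      using cauchy2_cases[OF assms] by blast
    then have "(\<lambda>n. abs2_rat (X n)) \<longlonglongrightarrow> c"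
      by (intro tendsto_eventually) (auto simp: eventually_sequentially)
    then show ?thesis using c N by (auto simp: limI)
  qed
qed

lemma abs2_Q2_tendsto:
  assumes "cauchy2 X"
  shows "(\<lambda>n. abs2_rat (X n)) \<longlonglongrightarrow> abs2 (Q2 X)"
  using abs2_Q2_cases[OF assms]
proof
  assume "null2 X \<and> abs2 (Q2 X) = 0"
  then show ?thesis by (intro LIMSEQ_I) (simp add: null2_def)
next
  assume "abs2 (Q2 X) > 0 \<and> (\<exists>K. \<forall>n\<ge>K. abs2_rat (X n) = abs2 (Q2 X))"
  then show ?thesis by (intro tendsto_eventually) (auto simp: eventually_sequentially)
qed

lemma abs2_nonneg [simp]: "0 \<le> abs2 (x :: q2)"
  by (cases x) (use abs2_Q2_cases in fastforce)

lemma abs2_eq_0 [simp]: "abs2 (x :: q2) = 0 \<longleftrightarrow> x = 0"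
proof (cases x)
  case (1 X)
  have "abs2 x = 0 \<longleftrightarrow> null2 X"
    using abs2_Q2_cases[OF 1(2)] 1(1) null2D[of X "abs2 x"]
    by (metis less_irrefl linorder_le_cases)
  also have "\<dots> \<longleftrightarrow> x = 0" using 1 by (simp add: Q2_zero Q2_eq_iff)
  finally show ?thesis .
qed

lemma abs2_0 [simp]: "abs2 0 = 0"
  by (simp only: abs2_eq_0)

lemma abs2_mult: "abs2 (x * y :: q2) = abs2 x * abs2 y"
proof (cases x; cases y)
  fix X Y assume *: "x = Q2 X" "cauchy2 X" "y = Q2 Y" "cauchy2 Y"
  then have "x * y = Q2 (\<lambda>n. X n * Y n)" by (simp add: times_q2.abs_eq q2rel_refl)
  then have "(\<lambda>n. abs2_rat (X n) * abs2_rat (Y n)) \<longlonglongrightarrow> abs2 (x * y)"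
    using abs2_Q2_tendsto[of "\<lambda>n. X n * Y n"] * by (simp add: abs2_rat_mult)
  moreover have "(\<lambda>n. abs2_rat (X n) * abs2_rat (Y n)) \<longlonglongrightarrow> abs2 x * abs2 y"
    using * by (intro tendsto_mult) (simp_all add: abs2_Q2_tendsto)
  ultimately show ?thesis by (rule LIMSEQ_unique)
qed

lemma abs2_minus [simp]: "abs2 (- x :: q2) = abs2 x"
  by (cases x) (simp add: uminus_q2.abs_eq abs2.abs_eq q2rel_refl)

lemma abs2_add: "abs2 (x + y :: q2) \<le> max (abs2 x) (abs2 y)"
proof (cases x; cases y)
  fix X Y assume *: "x = Q2 X" "cauchy2 X" "y = Q2 Y" "cauchy2 Y"
  then have eq: "x + y = Q2 (\<lambda>n. X n + Y n)" by (simp add: plus_q2.abs_eq q2rel_refl)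
  show ?thesis
  proof (rule LIMSEQ_le)
    show "(\<lambda>n. abs2_rat (X n + Y n)) \<longlonglongrightarrow> abs2 (x + y)"
      unfolding eq using * by (intro abs2_Q2_tendsto) simp
    show "(\<lambda>n. max (abs2_rat (X n)) (abs2_rat (Y n))) \<longlonglongrightarrow> max (abs2 x) (abs2 y)"
      using * by (intro tendsto_max) (simp_all add: abs2_Q2_tendsto)
    show "\<exists>N. \<forall>n\<ge>N. abs2_rat (X n + Y n) \<le> max (abs2_rat (X n)) (abs2_rat (Y n))"
      using abs2_rat_add by blast
  qed
qed

lemma abs2_of_rat: "abs2 (of_rat r :: q2) = abs2_rat r"
  using LIMSEQ_unique[OF abs2_Q2_tendsto[of "\<lambda>n. r"] tendsto_const] by (simp add: of_rat_Q2)

lemma abs2_powi: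
  assumes "(x :: q2) \<noteq> 0"
  obtains v :: int where "abs2 x = 2 powi (- v)"
proof (cases x)
  case (1 X)
  then obtain n where n: "abs2_rat (X n) = abs2 x" "abs2 x > 0"
    using abs2_Q2_cases[OF 1(2)] assms abs2_eq_0[of x] by auto
  then show thesis using that[of "val2_rat (X n)"] by (auto simp: abs2_rat_def split: if_splits)
qed

instantiation q2 :: metric_space
begin

definition dist_q2 :: "q2 \<Rightarrow> q2 \<Rightarrow> real" where "dist x y = abs2 (x - y)"

definition uniformity_q2 :: "(q2 \<times> q2) filter" where
  "uniformity_q2 = (INF e\<in>{0 <..}. principal {(x, y). dist x y < e})"

definition open_q2 :: "q2 set \<Rightarrow> bool" where
  "open_q2 U \<longleftrightarrow> (\<forall>x\<in>U. eventually (\<lambda>(x', y). x' = x \<longrightarrow> y \<in> U) uniformity)"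

instance
proof
  fix x y z :: q2
  show "(uniformity :: (q2 \<times> q2) filter) = (INF e\<in>{0 <..}. principal {(x, y). dist x y < e})"
    by (rule uniformity_q2_def)
  show "open U \<longleftrightarrow> (\<forall>x\<in>U. eventually (\<lambda>(x', y). x' = x \<longrightarrow> y \<in> U) uniformity)" for U :: "q2 set"
    by (rule open_q2_def)
  show "dist x y = 0 \<longleftrightarrow> x = y" by (simp add: dist_q2_def)
  have "abs2 (x - y) \<le> max (abs2 (x - z)) (abs2 (- (y - z)))"
    using abs2_add[of "x - z" "- (y - z)"] by simp
  also have "\<dots> \<le> abs2 (x - z) + abs2 (y - z)"
    unfolding abs2_minus using abs2_nonneg[of "x - z"] abs2_nonneg[of "y - z"] by linarith
  finally show "dist x y \<le> dist x z + dist y z" by (simp add: dist_q2_def)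
qed

end

lemma of_rat_dense_q2:
  assumes "e > 0"
  obtains r where "dist (x :: q2) (of_rat r) < e"
proof (cases x)
  case (1 X)
  obtain K where K: "\<And>m n. m \<ge> K \<Longrightarrow> n \<ge> K \<Longrightarrow> abs2_rat (X m - X n) < e / 2"
    using cauchy2D[OF 1(2), of "e / 2"] assms by auto
  have c: "cauchy2 (\<lambda>n. X n - X K)" using cauchy2_add[OF 1(2) cauchy2_const[of "- X K"]] by simp
  have "x - of_rat (X K) = Q2 (\<lambda>n. X n - X K)" using 1 by (simp add: of_rat_Q2 Q2_diff)
  then have "(\<lambda>n. abs2_rat (X n - X K)) \<longlonglongrightarrow> dist x (of_rat (X K))"
    using abs2_Q2_tendsto[OF c] by (simp add: dist_q2_def)
  then have "dist x (of_rat (X K)) \<le> e / 2"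
    using K by (intro LIMSEQ_le_const2) (auto intro!: exI[of _ K] less_imp_le)
  then show thesis using that[of "X K"] assms by simp
qed

lemma of_rat_tendsto_Q2:
  assumes "cauchy2 X"
  shows "(\<lambda>n. of_rat (X n)) \<longlonglongrightarrow> Q2 X"
proof (rule metric_LIMSEQ_I)
  fix e :: real assume e: "e > 0"
  obtain K where K: "\<And>m n. m \<ge> K \<Longrightarrow> n \<ge> K \<Longrightarrow> abs2_rat (X m - X n) < e / 2"
    using cauchy2D[OF assms, of "e / 2"] e by auto
  have "dist (of_rat (X m)) (Q2 X) < e" if m: "m \<ge> K" for m
  proof -
    have c: "cauchy2 (\<lambda>n. X m - X n)"
      using cauchy2_add[OF cauchy2_const[of "X m"] cauchy2_minus[OF assms]] by simp
    have "of_rat (X m) - Q2 X = Q2 (\<lambda>n. X m - X n)" using assms by (simp add: of_rat_Q2 Q2_diff)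
    then have "(\<lambda>n. abs2_rat (X m - X n)) \<longlonglongrightarrow> dist (of_rat (X m)) (Q2 X)"
      using abs2_Q2_tendsto[OF c] by (simp add: dist_q2_def)
    then have "dist (of_rat (X m)) (Q2 X) \<le> e / 2"
      using K m by (intro LIMSEQ_le_const2) (auto intro!: exI[of _ K] less_imp_le)
    then show ?thesis using e by simp
  qed
  then show "\<exists>K. \<forall>m\<ge>K. dist (of_rat (X m)) (Q2 X) < e" by blast
qed

instance q2 :: complete_space
proof
  fix x :: "nat \<Rightarrow> q2" assume x: "Cauchy x"
  have "\<exists>r. dist (x n) (of_rat r) < inverse (real (Suc n))" for n
    using of_rat_dense_q2[of "inverse (real (Suc n))" "x n"] by auto
  then obtain r where r: "\<And>n. dist (x n) (of_rat (r n)) < inverse (real (Suc n))" by metis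
  have d0: "(\<lambda>n. dist (x n) (of_rat (r n))) \<longlonglongrightarrow> 0"
    by (rule tendsto_sandwich[OF _ _ tendsto_const LIMSEQ_inverse_real_of_nat])
       (auto intro!: always_eventually less_imp_le r simp del: of_nat_Suc)
  have "cauchy2 r"
    unfolding cauchy2_def
  proof (intro allI impI)
    fix e :: real assume e: "e > 0"
    obtain K where K: "\<And>m n. m \<ge> K \<Longrightarrow> n \<ge> K \<Longrightarrow> dist (x m) (x n) < e / 3"
      using x e unfolding Cauchy_def by (metis zero_less_divide_iff zero_less_numeral)
    obtain L where L: "\<And>n. n \<ge> L \<Longrightarrow> dist (x n) (of_rat (r n)) < e / 3"
      using LIMSEQ_D[OF d0, of "e / 3"] e by auto
    show "\<exists>K. \<forall>m\<ge>K. \<forall>n\<ge>K. abs2_rat (r m - r n) < e"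
    proof (intro exI[of _ "max K L"] allI impI)
      fix m n assume *: "max K L \<le> m" "max K L \<le> n"
      have "abs2_rat (r m - r n) = dist (of_rat (r m) :: q2) (of_rat (r n))"
        by (simp add: dist_q2_def abs2_of_rat flip: of_rat_diff)
      also have "\<dots> \<le> dist (x m) (of_rat (r m)) + (dist (x m) (x n) + dist (x n) (of_rat (r n)))"
        using dist_triangle[of "of_rat (r m)" "of_rat (r n)" "x m"]
          dist_triangle[of "x m" "of_rat (r n)" "x n"] by (simp add: dist_commute)
      also have "\<dots> < e" using K[of m n] L[of m] L[of n] * by simp
      finally show "abs2_rat (r m - r n) < e" .
    qed
  qed
  then have "(\<lambda>n. of_rat (r n)) \<longlonglongrightarrow> Q2 r" by (rule of_rat_tendsto_Q2)
  then have "(\<lambda>n. dist (of_rat (r n)) (Q2 r)) \<longlonglongrightarrow> 0" by (simp flip: tendsto_dist_iff)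
  then have "(\<lambda>n. dist (x n) (of_rat (r n)) + dist (of_rat (r n)) (Q2 r)) \<longlonglongrightarrow> 0 + 0"
    by (rule tendsto_add[OF d0])
  then have s0: "(\<lambda>n. dist (x n) (of_rat (r n)) + dist (of_rat (r n)) (Q2 r)) \<longlonglongrightarrow> 0"
    by simp
  have le: "\<forall>n. dist (x n) (Q2 r) \<le> dist (x n) (of_rat (r n)) + dist (of_rat (r n)) (Q2 r)"
    by (intro allI dist_triangle)
  have ge: "\<forall>n. 0 \<le> dist (x n) (Q2 r)" by simp
  have "(\<lambda>n. dist (x n) (Q2 r)) \<longlonglongrightarrow> 0"
    by (rule tendsto_sandwich[OF always_eventually[OF ge] always_eventually[OF le] tendsto_const s0])
  then have "x \<longlonglongrightarrow> Q2 r" by (rule tendsto_dist_iff[THEN iffD2])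
  then show "convergent x" by (auto simp: convergent_def)
qed

definition Z2 :: "q2 set" where
  "Z2 = {x. abs2 x \<le> 1}"

definition val2 :: "q2 \<Rightarrow> int" where
  "val2 x = (THE v. abs2 x = 2 powi (- v))"

lemma abs2_val2:
  assumes "x \<noteq> 0"
  shows "abs2 x = 2 powi (- val2 x)"
proof -
  obtain v where v: "abs2 x = 2 powi (- v)" using abs2_powi[OF assms] .
  then have "w = v" if "abs2 x = 2 powi (- w)" for w :: int
    using that by (simp add: two_powi_inject)
  then show ?thesis unfolding val2_def using v by (metis (mono_tags, lifting) theI)
qed


section \<open>2-adic zeta values\<close>

text \<open>An integrand is a function on all of \<^typ>\<open>q2\<close>, of which only the values on
  \<^const>\<open>Z2\<close> matter. The value is unspecified if the limit does not exist.\<close>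

definition volkenborn :: "(q2 \<Rightarrow> q2) \<Rightarrow> q2" where
  "volkenborn f = lim (\<lambda>N::nat. (\<Sum>k<2^N. f (of_nat k)) / 2^N)"

definition omega_unit :: "q2 \<Rightarrow> q2" where
  "omega_unit x = (THE e. e \<in> {1, -1} \<and> (\<exists>z\<in>Z2. x - e = 4 * z))"

lemma abs2_2: "abs2 2 = 1 / 2"
  using abs2_of_rat[of 2] val2_rat_divide[of 2 1]
  by (simp add: abs2_rat_def power_int_minus)

lemma Z2_4: "(\<exists>z\<in>Z2. x = 4 * z) \<longleftrightarrow> abs2 x \<le> 1 / 4"
proof -
  have 4: "abs2 4 = 1 / 4" using abs2_mult[of 2 2] by (simp add: abs2_2)
  show ?thesis
  proof
    assume "abs2 x \<le> 1 / 4"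
    moreover have "abs2 x = 1 / 4 * abs2 (x / 4)" using abs2_mult[of 4 "x / 4"] by (simp add: 4)
    ultimately show "\<exists>z\<in>Z2. x = 4 * z" by (intro bexI[of _ "x / 4"]) (auto simp: Z2_def)
  qed (auto simp: Z2_def abs2_mult 4)
qed

lemma omega_unit_unique:
  assumes "abs2 x = 1"
  shows "\<exists>!e. e \<in> {1, -1} \<and> (\<exists>z\<in>Z2. x - e = 4 * z)"
proof -
  obtain r where r: "abs2 (x - of_rat r) < 1 / 4"
    using of_rat_dense_q2[of "1 / 4" x] by (auto simp: dist_q2_def)
  obtain a b where ab: "quotient_of r = (a, b)" by fastforce
  have rab: "r = of_int a / of_int b" and b: "b > 0" and cop: "coprime a b"
    using quotient_of_div[OF ab] quotient_of_denom_pos[OF ab] quotient_of_coprime[OF ab] by auto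
  have rx: "of_rat r = - (x - of_rat r) + x" by simp
  have le: "abs2 (of_rat r) \<le> 1"
    using abs2_add[of "- (x - of_rat r)" x] r assms by (simp only: abs2_minus rx[symmetric])
  have ge: "1 \<le> abs2 (of_rat r)"
    using abs2_add[of "x - of_rat r" "of_rat r"] r assms by simp
  have r1: "abs2_rat r = 1" using le ge by (simp add: abs2_of_rat)
  then have a: "a \<noteq> 0" using rab by auto
  have v: "val2_rat r = 0"
  proof -
    have "(2::real) powi (- val2_rat r) = 2 powi 0"
      using r1 by (cases "r = 0") (simp_all add: abs2_rat_def)
    then show ?thesis by (simp only: two_powi_inject)
  qed
  then have "multiplicity 2 a = multiplicity 2 b"
    using val2_rat_divide[of a b] a b rab by simp
  then have "even a \<longleftrightarrow> even b"
    using a b prime_multiplicity_gt_zero_iff[of "2::int" a] prime_multiplicity_gt_zero_iff[of "2::int" b]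
    by simp
  then have odd: "odd a" "odd b" using coprime_common_divisor[OF cop, of 2] by auto
  have b1: "abs2_rat (of_int b) = 1"
    using val2_rat_divide[of b 1] b odd(2) by (simp add: abs2_rat_def not_dvd_imp_multiplicity_0)
  have small: "abs2_rat (of_int k) \<le> 1 / 4" if "4 dvd k" for k :: int
  proof (cases "k = 0")
    case False
    have "2 \<le> multiplicity 2 k" using that False by (intro multiplicity_geI) auto
    then have "val2_rat (of_int k) \<ge> 2" using val2_rat_divide[of k 1] False by simp
    then have "(2::real) powi (- val2_rat (of_int k)) \<le> 2 powi (- 2)"
      by (intro power_int_increasing) auto
    also have "(2::real) powi (- 2) = 1 / 4" by (simp add: power_int_minus)
    finally show ?thesis using False by (simp only: abs2_rat_def) simp
  qed simp
  have sgn: "abs2 (x - of_int e) \<le> 1 / 4" if "4 dvd a - e * b" for e :: int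
  proof -
    have "r - of_int e = of_int (a - e * b) * inverse (of_int b)"
      using rab b by (simp add: field_simps)
    then have "abs2_rat (r - of_int e) \<le> 1 / 4"
      using small[OF that] by (simp only: abs2_rat_mult abs2_rat_inverse b1) simp
    then have "abs2 (of_rat r - of_int e) \<le> 1 / 4"
      using abs2_of_rat[of "r - of_int e"] by (simp add: of_rat_diff)
    then show ?thesis using abs2_add[of "x - of_rat r" "of_rat r - of_int e"] r by simp
  qed
  have "4 dvd a - 1 * b \<or> 4 dvd a - (- 1) * b" using odd by presburger
  then have "abs2 (x - 1) \<le> 1 / 4 \<or> abs2 (x - - 1) \<le> 1 / 4"
    using sgn[of 1] sgn[of "-1"] by (simp only: of_int_1 of_int_minus) blast
  then have ex: "(\<exists>z\<in>Z2. x - 1 = 4 * z) \<or> (\<exists>z\<in>Z2. x - - 1 = 4 * z)"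
    by (simp only: Z2_4)
  have "\<not> (abs2 (x - 1) \<le> 1 / 4 \<and> abs2 (x - - 1) \<le> 1 / 4)"
    using abs2_add[of "- (x - 1)" "x - - 1"]
    by (simp only: abs2_minus) (auto simp: abs2_2 max_def split: if_splits)
  then have "\<not> ((\<exists>z\<in>Z2. x - 1 = 4 * z) \<and> (\<exists>z\<in>Z2. x - - 1 = 4 * z))"
    by (simp only: Z2_4 not_False_eq_True)
  with ex have ne: "(\<exists>z\<in>Z2. x - 1 = 4 * z) \<noteq> (\<exists>z\<in>Z2. x - - 1 = 4 * z)" by argo
  have "\<exists>!e. e \<in> {1, -1 :: q2} \<and> P e" if "P 1 \<noteq> P (-1)" for P
    using that by (cases "P 1") auto
  from this[of "\<lambda>e. \<exists>z\<in>Z2. x - e = 4 * z", OF ne] show ?thesis .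
qed

definition omega :: "q2 \<Rightarrow> q2" where
  "omega x = 2 powi val2 x * omega_unit (x / 2 powi val2 x)"

definition angle :: "q2 \<Rightarrow> q2" where
  "angle x = x / omega x"

text \<open>The defining integral is only meaningful for \<open>abs2 x \<ge> 4\<close> and \<open>j \<ge> 2\<close>.\<close>

definition hurwitz_zeta2 :: "int \<Rightarrow> q2 \<Rightarrow> q2" where
  "hurwitz_zeta2 j x = volkenborn (\<lambda>t. angle (t + x) powi (1 - j)) / of_int (j - 1)"

text \<open>A Dirichlet character is given by its values on all of \<^typ>\<open>nat\<close>, being 0 exactly at the
  arguments not coprime to the modulus. Its conductor is then the least modulus \<open>f\<close> such that the
  character is trivial on the arguments congruent to 1 modulo \<open>f\<close> at which it does not vanish.\<close>

definition conductor :: "(nat \<Rightarrow> q2) \<Rightarrow> nat" where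
  "conductor \<chi> = (LEAST f. f > 0 \<and> (\<forall>a. [a = 1] (mod f) \<and> \<chi> a \<noteq> 0 \<longrightarrow> \<chi> a = 1))"

definition L2_at :: "nat \<Rightarrow> int \<Rightarrow> (nat \<Rightarrow> q2) \<Rightarrow> q2" where
  "L2_at M j \<chi> = angle (of_nat M) powi (1 - j) / of_nat M *
     (\<Sum>a | a < M \<and> odd a. \<chi> a * hurwitz_zeta2 j (of_nat a / of_nat M))"

text \<open>For primitive \<open>\<chi>\<close>, the value \<^term>\<open>L2_at M j \<chi>\<close> is the same for every common multiple
  \<open>M\<close> of 4 and the conductor; the least one is taken.\<close>

definition L2 :: "int \<Rightarrow> (nat \<Rightarrow> q2) \<Rightarrow> q2" where
  "L2 j \<chi> = L2_at (lcm 4 (conductor \<chi>)) j \<chi>"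

text \<open>The primitive Dirichlet character attached to the \<open>k\<close>-th power of the Teichmueller character:
  for even \<open>k\<close> the trivial character, which is 1 also at even arguments, for odd \<open>k\<close> the
  nontrivial character modulo 4.\<close>

definition omega_char :: "int \<Rightarrow> nat \<Rightarrow> q2" where
  "omega_char k a = (if odd a then omega (of_nat a) powi k else if even k then 1 else 0)"

definition zeta2 :: "int \<Rightarrow> q2" where
  "zeta2 j = L2 j (omega_char (1 - j))"

lemma zeta2_odd:
  assumes "odd j"
  shows "zeta2 j = (hurwitz_zeta2 j (1 / 4) + hurwitz_zeta2 j (3 / 4)) / 4"
proof -
  have omega_powi: "omega x powi (1 - j) = 1" if "abs2 x = 1" for x
  proof -
    have "x \<noteq> 0" using that abs2_eq_0[of x] by auto
    have "(2::real) powi (- val2 x) = 2 powi 0"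
      using abs2_val2[OF \<open>x \<noteq> 0\<close>] that by simp
    then have "val2 x = 0" by (simp only: two_powi_inject)
    then have "omega x \<in> {1, -1}"
      using theI'[OF omega_unit_unique[OF that]] by (simp add: omega_def omega_unit_def)
    then show ?thesis using assms by (auto simp: power_int_minus_one_minus power_int_minus_left)
  qed
  have odd1: "abs2 (of_nat a) = 1" if "odd a" for a
    using abs2_of_rat[of "of_nat a"] val2_rat_divide[of "int a" 1] that
    by (auto simp: abs2_rat_def not_dvd_imp_multiplicity_0 elim: oddE)
  have char: "omega_char (1 - j) a = 1" for a
    using omega_powi[OF odd1] assms by (simp add: omega_char_def)
  have "conductor (omega_char (1 - j)) = 1"
    unfolding conductor_def by (rule Least_equality) (auto simp: char)
  then have L: "zeta2 j = L2_at 4 j (omega_char (1 - j))" by (simp add: zeta2_def L2_def)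
  have a4: "abs2 4 = 2 powi (- 2)" using abs2_mult[of 2 2] by (simp add: abs2_2 power_int_minus)
  have "(2::real) powi (- val2 4) = 2 powi (- 2)"
    using abs2_val2[of 4] a4 by simp
  then have "val2 4 = 2" by (simp only: two_powi_inject)
  moreover have "omega_unit 1 = 1"
  proof -
    have "abs2 1 = 1" using odd1[of 1] by simp
    moreover have "0 \<in> Z2" by (simp add: Z2_def)
    then have "\<exists>z\<in>Z2. 1 - 1 = 4 * z" by (rule bexI[rotated]) simp
    ultimately show ?thesis
      unfolding omega_unit_def by (intro the1_equality[OF omega_unit_unique] conjI) simp_all
  qed
  ultimately have "angle 4 = 1" by (simp add: angle_def omega_def)
  moreover have "{a::nat. a < 4 \<and> odd a} = {1, 3}"
  proof -
    have "a = 1 \<or> a = 3 \<longleftrightarrow> a < 4 \<and> odd a" for a :: nat by presburger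
    then show ?thesis by blast
  qed
  ultimately show ?thesis by (simp add: L L2_at_def char)
qed

end

theory Submission
  imports Defs "HOL-Computational_Algebra.Computational_Algebra" "HOL-Analysis.Harmonic_Numbers"
begin

text \<open>Fix \<open>s\<close>, put \<open>m = s + 2\<close> and let \<open>N\<close> be a power of 2. The linear forms are Volkenborn integrals of the
  \<open>s\<close>-th Taylor coefficient at \<open>y = 4 t + 1\<close> of the rational function \<open>f\<close> that is \<open>y ^ (s mod 2)\<close> times the
  \<open>m\<close>-th power of the product of \<open>(y - (4 j + 1)) (y + (4 j + 1))\<close> over \<open>\<bar>j\<bar> < N\<close>, divided by the
  \<open>2 m\<close>-th power of the product of \<open>y - 4 k\<close> over \<open>\<bar>k\<bar> \<le> N\<close>.
  By partial fractions such an integral is a rational combination of 1 and the integrals of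
  \<open>(4 t + 1) ^ (- q)\<close>; the parity of \<open>f\<close> removes the odd \<open>q\<close>, and the vanishing sum of residues removes the
  simple poles, so only the zeta values at odd \<open>j\<close> with \<open>s + 3 \<le> j \<le> 3 s + 5\<close> remain. The numerator makes the
  integral 2-adically small, of size about \<open>2 ^ (- 8 m N)\<close>, and this size can be computed exactly, so that the
  integral does not vanish. At odd primes the denominators are controlled by \<open>lcm(1, \<dots>, 2 N)\<close>, by the
  primes in \<open>(2 N, 4 N]\<close> and by a central binomial coefficient, while the coefficients have polynomial
  archimedean size. If all the zeta values were rational, the product formula would give
  \<open>12 ln 2 \<le> (\<psi>(4 N) + 2 \<psi>(2 N)) / N + o(1)\<close>. A Chebyshev bound for \<open>\<psi>(x) + 2 \<psi>(x / 2)\<close> with a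
  constant below \<open>3 ln 2\<close> contradicts this.\<close>

section \<open>Prime factorisations and Chebyshev estimates\<close>

text \<open>By the prime number theorem (\<psi>(4 N) + 2 \<psi>(2 N)) / N tends to 8, while 12 ln 2
  is about 8.318. The room is small: Chebyshev's own constant 1.1056 gives only 8.85, which is why a
  longer combination of factorials is used. It is also why the primes in (2 N, 4 N] are kept apart:
  they enter through an m-th power only, whereas clearing all denominators with lcm(1, ..., 4 N)
  would cost about 12. The exponent m = s + 2 serves two purposes. The rational part of a form is
  built from Taylor coefficients of order s + 1 at points 4 \<nu> + 1, and their denominators stay
  small only because f vanishes beyond that order at 4 j + 1. And 2-adically the dominant term is
  the s-th Taylor coefficient of t ^ (s + 2) times a unit-like polynomial, so that its mean is
  governed by the nonzero Bernoulli number B_2 = 1/6. All integrals are handled through their finite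
  averages over 2 ^ M points, which are rational numbers.\<close>

lemma multiplicity_eq_card:
  fixes p n :: nat
  assumes p: "prime p" and n: "n > 0" and H: "n < p ^ Suc H"
  shows "multiplicity p n = card {h \<in> {1..H}. p ^ h dvd n}"
proof -
  have nu: "\<not> is_unit p" using p by auto
  have "h \<le> multiplicity p n \<longleftrightarrow> p ^ h dvd n" for h
    using power_dvd_iff_le_multiplicity[of n p h] nu n by auto
  moreover have "h \<le> H" if "p ^ h dvd n" for h
  proof (rule ccontr)
    assume "\<not> h \<le> H"
    then have "p ^ Suc H \<le> p ^ h" using prime_gt_0_nat[OF p] by (intro power_increasing) auto
    also have "\<dots> \<le> n" using that n by (auto intro: dvd_imp_le)
    finally show False using H by simp
  qed
  ultimately have "{h \<in> {1..H}. p ^ h dvd n} = {1..multiplicity p n}" by auto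
  then show ?thesis by simp
qed

text \<open>Both sides count the pairs \<open>(i, h)\<close> with \<open>p ^ h dvd a i\<close>;
  \<open>H\<close> only has to be large enough to see all of them.\<close>

lemma multiplicity_prod_eq_sum_card:
  fixes p :: nat and a :: "'a \<Rightarrow> nat"
  assumes p: "prime p" and A: "finite A" and a: "\<And>i. i \<in> A \<Longrightarrow> 0 < a i \<and> a i < p ^ Suc H"
  shows "multiplicity p (\<Prod>i\<in>A. a i) = (\<Sum>h=1..H. card {i \<in> A. p ^ h dvd a i})"
proof -
  have "multiplicity p (\<Prod>i\<in>A. a i) = (\<Sum>i\<in>A. multiplicity p (a i))"
    using p a A by (subst prime_elem_multiplicity_prod_distrib) (auto simp: image_iff)
  also have "\<dots> = (\<Sum>i\<in>A. \<Sum>h=1..H. if p ^ h dvd a i then 1 else 0)"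
  proof (rule sum.cong)
    fix i assume "i \<in> A"
    then have "multiplicity p (a i) = card {h \<in> {1..H}. p ^ h dvd a i}"
      using a p by (intro multiplicity_eq_card) auto
    also have "\<dots> = (\<Sum>h=1..H. if p ^ h dvd a i then 1 else 0)"
      by (simp flip: sum.inter_filter)
    finally show "multiplicity p (a i) = \<dots>" .
  qed simp
  also have "\<dots> = (\<Sum>h=1..H. \<Sum>i\<in>A. if p ^ h dvd a i then 1 else 0)"
    by (rule sum.swap)
  also have "\<dots> = (\<Sum>h=1..H. card {i \<in> A. p ^ h dvd a i})"
    using A by (simp flip: sum.inter_filter)
  finally show ?thesis .
qed

section \<open>Least common multiples and factorials\<close>

definition lcmn :: "nat \<Rightarrow> nat" where "lcmn n = Lcm {1..n}"

lemma lcmn_pos: "lcmn n > 0"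
  unfolding lcmn_def by (intro gr0I) (auto simp: Lcm_0_iff)

lemma lcmn_0 [simp]: "lcmn 0 = 1"
  by (simp add: lcmn_def)

lemma dvd_lcmn: "1 \<le> k \<Longrightarrow> k \<le> n \<Longrightarrow> k dvd lcmn n"
  unfolding lcmn_def by (intro dvd_Lcm) auto

lemma lcmn_dvd_mono: "m \<le> n \<Longrightarrow> lcmn m dvd lcmn n"
  unfolding lcmn_def by (intro Lcm_subset) auto

lemma prime_power_dvd_lcmn_iff:
  assumes p: "prime p"
  shows "p ^ h dvd lcmn n \<longleftrightarrow> h = 0 \<or> p ^ h \<le> n"
proof
  assume "h = 0 \<or> p ^ h \<le> n"
  then show "p ^ h dvd lcmn n" using p prime_gt_0_nat by (auto intro: dvd_lcmn simp: Suc_le_eq)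
next
  assume d: "p ^ h dvd lcmn n"
  show "h = 0 \<or> p ^ h \<le> n"
  proof (rule ccontr)
    assume c: "\<not> (h = 0 \<or> p ^ h \<le> n)"
    then obtain g where h: "h = Suc g" by (cases h) auto
    have "\<exists>M. \<not> p ^ h dvd M \<and> M > 0 \<and> (\<forall>k\<in>{1..n}. k dvd M)"
    proof -
      \<comment> \<open>A common multiple of 1, ..., \<open>n\<close> not divisible by
        \<open>p ^ h\<close>: every \<open>k \<le> n\<close> has a \<open>p\<close>-part below
        \<open>p ^ h\<close>, so the single factor \<open>p ^ g\<close> with
        \<open>g = h - 1\<close> serves all of them, and the remaining product is prime to
        \<open>p\<close>.\<close>
      define M where "M = p ^ g * (\<Prod>k=1..n. k div p ^ multiplicity p k)"
      have odd: "\<not> p dvd (\<Prod>k=1..n. k div p ^ multiplicity p k)"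
      proof
        assume "p dvd (\<Prod>k=1..n. k div p ^ multiplicity p k)"
        then obtain k where "k \<in> {1..n}" "p dvd k div p ^ multiplicity p k"
          using p by (subst (asm) prime_dvd_prod_iff) blast+
        then show False using multiplicity_decompose[of k p] p not_prime_unit by force
      qed
      have 1: "\<not> p ^ h dvd M"
      proof
        assume "p ^ h dvd M"
        then have "p ^ g * p dvd p ^ g * (\<Prod>k=1..n. k div p ^ multiplicity p k)"
          by (simp add: M_def h mult.commute)
        then show False using odd p by (auto simp: prime_gt_0_nat)
      qed
      then have 2: "M > 0" by (metis dvd_0_right gr0I)
      have 3: "k dvd M" if k: "k \<in> {1..n}" for k
      proof -
        have "p ^ multiplicity p k dvd k" by (rule multiplicity_dvd)
        then have "p ^ multiplicity p k \<le> n" using k by (auto dest!: dvd_imp_le)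
        then have "p ^ multiplicity p k < p ^ h" using c by auto
        then have "multiplicity p k < h" using p prime_gt_1_nat power_less_imp_less_exp by blast
        then have a: "p ^ multiplicity p k dvd p ^ g" using h by (intro le_imp_power_dvd) auto
        have b: "k div p ^ multiplicity p k dvd (\<Prod>k=1..n. k div p ^ multiplicity p k)"
          using k by (intro dvd_prodI) auto
        have "k = p ^ multiplicity p k * (k div p ^ multiplicity p k)"
          by (simp add: multiplicity_dvd)
        then show ?thesis unfolding M_def using a b by (metis mult_dvd_mono)
      qed
      show ?thesis using 1 2 3 by blast
    qed
    then obtain M where M: "\<not> p ^ h dvd M" "M > 0" "\<forall>k\<in>{1..n}. k dvd M" by blast
    have "lcmn n dvd M" unfolding lcmn_def using M by (intro Lcm_least) auto
    then show False using d M dvd_trans by blast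
  qed
qed

lemma multiplicity_lcmn:
  assumes p: "prime p" and H: "n < p ^ Suc H"
  shows "multiplicity p (lcmn n) = card {h \<in> {1..H}. p ^ h \<le> n}"
proof -
  have nu: "\<not> is_unit p" using p by auto
  have iff: "h \<le> multiplicity p (lcmn n) \<longleftrightarrow> h = 0 \<or> p ^ h \<le> n" for h
    using power_dvd_iff_le_multiplicity[of "lcmn n" p h] nu lcmn_pos[of n]
      prime_power_dvd_lcmn_iff[OF p] by auto
  moreover have "h \<le> H" if "p ^ h \<le> n" for h
  proof (rule ccontr)
    assume "\<not> h \<le> H"
    then have "p ^ Suc H \<le> p ^ h" using prime_gt_0_nat[OF p] by (intro power_increasing) auto
    then show False using H that by simp
  qed
  ultimately have "{h \<in> {1..H}. p ^ h \<le> n} = {1..multiplicity p (lcmn n)}" by (auto simp: Suc_le_eq)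
  then show ?thesis by simp
qed

text \<open>Each prime \<open>p\<close> occurs on both sides as often as there are pairs
  \<open>(h, i)\<close> with \<open>h \<ge> 1\<close> and \<open>p ^ h * i \<le> n\<close>: grouped
  by \<open>h\<close> this is Legendre's formula, grouped by \<open>i\<close> it gives the exponents
  in the least common multiples.\<close>

lemma fact_eq_prod_lcmn: "fact n = (\<Prod>i=1..n. lcmn (n div i))"
proof (rule multiplicity_eq_nat)
  fix p :: nat assume p: "prime p"
  define H where "H = n"
  have H: "n < p ^ Suc H" using p prime_ge_2_nat[OF p]
    by (metis H_def Suc_lessD less_exp order_less_le_trans power_mono zero_le)
  have le: "m < p ^ Suc H" if "m \<le> n" for m using H that by simp
  have "multiplicity p (fact n :: nat) = multiplicity p (\<Prod>i=1..n. i)"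
    by (simp add: fact_prod)
  also have "\<dots> = (\<Sum>h=1..H. card {i \<in> {1..n}. p ^ h dvd i})"
    using le by (intro multiplicity_prod_eq_sum_card[OF p]) auto
  also have "\<dots> = (\<Sum>h=1..H. card {i \<in> {1..n}. p ^ h \<le> n div i})"
  proof (rule sum.cong)
    fix h
    have p0: "p ^ h > 0" using p prime_gt_0_nat by auto
    have "{i \<in> {1..n}. p ^ h dvd i} = (\<lambda>j. p ^ h * j) ` {1..n div p ^ h}" (is "?L = ?R")
    proof (intro equalityI subsetI)
      fix i assume i: "i \<in> ?L"
      then obtain j where j: "i = p ^ h * j" by (auto simp: dvd_def)
      then have "j \<le> n div p ^ h" using i p0 by (simp add: less_eq_div_iff_mult_less_eq mult.commute)
      moreover have "1 \<le> j" using i j by (cases j) auto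
      ultimately show "i \<in> ?R" using j by (intro image_eqI[of _ _ j]) auto
    next
      fix i assume "i \<in> ?R"
      then obtain j where "j \<in> {1..n div p ^ h}" "i = p ^ h * j" by blast
      then have j: "i = p ^ h * j" "1 \<le> j" "j \<le> n div p ^ h" by simp_all
      then have "i \<le> n" using p0 by (simp add: less_eq_div_iff_mult_less_eq mult.commute)
      then show "i \<in> ?L" using j p0 by (simp add: Suc_le_eq)
    qed
    then have "card {i \<in> {1..n}. p ^ h dvd i} = card ((\<lambda>j. p ^ h * j) ` {1..n div p ^ h})" by simp
    also have "\<dots> = n div p ^ h" using p0 by (subst card_image) (auto simp: inj_on_def)
    finally have a: "card {i \<in> {1..n}. p ^ h dvd i} = n div p ^ h" .
    have "p ^ h \<le> n div i \<longleftrightarrow> i \<le> n div p ^ h" if "i \<ge> 1" for i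
      using that p0 by (simp add: less_eq_div_iff_mult_less_eq mult.commute)
    moreover have "i \<le> n" if "i \<le> n div p ^ h" for i
      using that div_le_dividend[of n "p ^ h"] by linarith
    ultimately have "{i \<in> {1..n}. p ^ h \<le> n div i} = {1..n div p ^ h}" by auto
    then show "card {i \<in> {1..n}. p ^ h dvd i} = card {i \<in> {1..n}. p ^ h \<le> n div i}" using a by simp
  qed simp
  also have "\<dots> = (\<Sum>h=1..H. \<Sum>i=1..n. if p ^ h \<le> n div i then 1 else 0)"
    by (simp flip: sum.inter_filter)
  also have "\<dots> = (\<Sum>i=1..n. \<Sum>h=1..H. if p ^ h \<le> n div i then 1 else 0)"
    by (rule sum.swap)
  also have "\<dots> = (\<Sum>i=1..n. card {h \<in> {1..H}. p ^ h \<le> n div i})"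
    by (simp flip: sum.inter_filter)
  also have "\<dots> = (\<Sum>i=1..n. multiplicity p (lcmn (n div i)))"
    by (intro sum.cong refl multiplicity_lcmn[OF p, symmetric] le) simp
  also have "\<dots> = multiplicity p (\<Prod>i=1..n. lcmn (n div i))"
    by (rule prime_elem_multiplicity_prod_distrib[symmetric])
       (use p lcmn_pos[THEN less_imp_neq] in \<open>auto simp: image_iff\<close>)
  finally show "multiplicity p (fact n :: nat) = multiplicity p (\<Prod>i=1..n. lcmn (n div i))" .
qed (use lcmn_pos in \<open>auto intro!: prod_pos\<close>)

section \<open>The Chebyshev function and combinations of factorials\<close>

definition psi :: "nat \<Rightarrow> real" where "psi n = ln (lcmn n)"

lemma psi_0 [simp]: "psi 0 = 0"
  by (simp add: psi_def)

lemma psi_mono: "m \<le> n \<Longrightarrow> psi m \<le> psi n"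
  unfolding psi_def using lcmn_pos[of m] lcmn_pos[of n] lcmn_dvd_mono[of m n]
  by (auto intro!: ln_mono dest: dvd_imp_le)

lemma psi_nonneg: "psi n \<ge> 0"
  using psi_mono[of 0 n] by simp

lemma ln_fact_eq_sum_psi: "ln (fact n) = (\<Sum>i=1..n. psi (n div i))"
proof -
  have "ln (fact n) = ln (real (\<Prod>i=1..n. lcmn (n div i)))"
    by (simp only: fact_eq_prod_lcmn[symmetric] of_nat_fact)
  also have "\<dots> = ln (\<Prod>i=1..n. real (lcmn (n div i)))" by simp
  also have "\<dots> = (\<Sum>i=1..n. psi (n div i))"
    unfolding psi_def using lcmn_pos by (subst ln_prod) auto
  finally show ?thesis .
qed

text \<open>Abel summation: \<open>m div k\<close> increases by 1 exactly at the multiples of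
  \<open>k\<close>. For \<open>g m = psi (x div m)\<close> it writes
  \<open>ln (fact (x div k))\<close> in terms of increments of \<psi> that do not depend on
  \<open>k\<close>, so that different \<open>k\<close> can be combined with weights.\<close>

lemma sum_div_by_parts:
  fixes g :: "nat \<Rightarrow> real"
  assumes k: "k > 0"
  shows "(\<Sum>m=1..n. real (m div k) * (g m - g (Suc m))) =
    (\<Sum>i=1..n div k. g (k * i)) - real (n div k) * g (Suc n)"
proof (induction n)
  case (Suc n)
  have *: "(\<Sum>m=1..Suc n. real (m div k) * (g m - g (Suc m))) =
      (\<Sum>i=1..n div k. g (k * i)) - real (n div k) * g (Suc n) +
      real (Suc n div k) * (g (Suc n) - g (Suc (Suc n)))"
    using Suc by simp
  show ?case
  proof (cases "k dvd Suc n")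
    case True
    then have e: "Suc n div k = Suc (n div k)" by (simp add: div_Suc mod_eq_0_iff_dvd)
    have "k * Suc (n div k) = Suc n" using True e by (metis dvd_mult_div_cancel)
    then have "(\<Sum>i=1..Suc n div k. g (k * i)) = (\<Sum>i=1..n div k. g (k * i)) + g (Suc n)"
      unfolding e by simp
    then show ?thesis unfolding * e by (simp add: algebra_simps)
  next
    case False
    then have "Suc n div k = n div k" by (simp add: div_Suc mod_eq_0_iff_dvd)
    then show ?thesis unfolding * by (simp add: algebra_simps)
  qed
qed simp

lemma ln_fact_div_eq:
  assumes k: "k > 0"
  shows "ln (fact (x div k)) = (\<Sum>m=1..x. real (m div k) * (psi (x div m) - psi (x div Suc m)))"
proof -
  have "(\<Sum>m=1..x. real (m div k) * (psi (x div m) - psi (x div Suc m))) =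
      (\<Sum>i=1..x div k. psi (x div (k * i)))"
    by (subst sum_div_by_parts[OF k, of "\<lambda>m. psi (x div m)"]) simp
  then show ?thesis by (simp add: ln_fact_eq_sum_psi div_mult2_eq)
qed

lemma sum_psi_diff:
  assumes "1 \<le> a" "a \<le> Suc x"
  shows "(\<Sum>m=a..x. psi (x div m) - psi (x div Suc m)) = psi (x div a)"
  using sum_Suc_diff[of a x "\<lambda>m. psi (x div m)"] assms
  by (simp add: sum_subtractf algebra_simps)

text \<open>By Legendre's formula the right-hand side is the sum over \<open>m\<close> of \<open>F m\<close> times the increment of \<open>\<psi>\<close> between
  \<open>x / (m + 1)\<close> and \<open>x / m\<close>.\<close>

lemma chebyshev_combination:
  fixes \<nu> :: "nat \<Rightarrow> real" and F :: "nat \<Rightarrow> real"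
  assumes K: "finite K" "0 \<notin> K"
    and F: "\<And>m. F m = (\<Sum>k\<in>K. \<nu> k * real (m div k))"
    and g: "0 \<le> g1" "g1 \<le> g2" "0 \<le> B"
    and F1: "g1 \<le> F 1" and F2: "\<And>m. 2 \<le> m \<Longrightarrow> m < Y \<Longrightarrow> g2 \<le> F m"
    and FB: "\<And>m. Y \<le> m \<Longrightarrow> - B \<le> F m" and Y: "2 \<le> Y"
  shows "g1 * psi x + (g2 - g1) * psi (x div 2) - (g2 + B) * psi (x div Y)
    \<le> (\<Sum>k\<in>K. \<nu> k * ln (fact (x div k)))"
proof -
  define \<delta> where "\<delta> m = psi (x div m) - psi (x div Suc m)" for m
  have \<delta>: "\<delta> m \<ge> 0" if "m \<ge> 1" for m
    using that unfolding \<delta>_def by (simp add: psi_mono div_le_mono2)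
  have tel: "(\<Sum>m=1..x. if a \<le> m then \<delta> m else 0) = psi (x div a)" if "a \<ge> 1" for a
  proof (cases "a \<le> Suc x")
    case True
    have "(\<Sum>m=1..x. if a \<le> m then \<delta> m else 0) = sum \<delta> {m \<in> {1..x}. a \<le> m}"
      by (rule sum.inter_filter[symmetric]) simp
    also have "{m \<in> {1..x}. a \<le> m} = {a..x}" using that by auto
    finally show ?thesis using sum_psi_diff[OF that True] by (simp add: \<delta>_def)
  next
    case False
    then have "(\<Sum>m=1..x. if a \<le> m then \<delta> m else 0) = 0" by (intro sum.neutral) auto
    then show ?thesis using False by simp
  qed
  have "(\<Sum>k\<in>K. \<nu> k * ln (fact (x div k))) = (\<Sum>k\<in>K. \<nu> k * (\<Sum>m=1..x. real (m div k) * \<delta> m))"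
  proof (rule sum.cong)
    fix k assume "k \<in> K"
    then have "k > 0" using K by (metis gr0I)
    then show "\<nu> k * ln (fact (x div k)) = \<nu> k * (\<Sum>m=1..x. real (m div k) * \<delta> m)"
      unfolding \<delta>_def by (subst ln_fact_div_eq) auto
  qed simp
  also have "\<dots> = (\<Sum>m=1..x. F m * \<delta> m)"
    unfolding F by (simp add: sum_distrib_left sum_distrib_right mult.assoc) (rule sum.swap)
  finally have eq: "(\<Sum>k\<in>K. \<nu> k * ln (fact (x div k))) = (\<Sum>m=1..x. F m * \<delta> m)" .
  have "g1 * psi x + (g2 - g1) * psi (x div 2) - (g2 + B) * psi (x div Y)
    = (\<Sum>m=1..x. g1 * (if 1 \<le> m then \<delta> m else 0) + (g2 - g1) * (if 2 \<le> m then \<delta> m else 0)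
        - (g2 + B) * (if Y \<le> m then \<delta> m else 0))"
    using Y tel[of 1] tel[of 2] tel[of Y] by (simp only: sum.distrib sum_subtractf sum_distrib_left[symmetric]) simp
  also have "\<dots> \<le> (\<Sum>m=1..x. F m * \<delta> m)"
  proof (rule sum_mono)
    fix m assume m: "m \<in> {1..x}"
    have "(if m < Y then (if m = 1 then g1 else g2) else - B) * \<delta> m \<le> F m * \<delta> m"
      using \<delta>[of m] m F1 F2[of m] FB[of m] by (intro mult_right_mono) auto
    moreover have "g1 * (if 1 \<le> m then \<delta> m else 0) + (g2 - g1) * (if 2 \<le> m then \<delta> m else 0)
        - (g2 + B) * (if Y \<le> m then \<delta> m else 0) = (if m < Y then (if m = 1 then g1 else g2) else - B) * \<delta> m"
      using m Y by (auto simp: algebra_simps)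
    ultimately show "g1 * (if 1 \<le> m then \<delta> m else 0) + (g2 - g1) * (if 2 \<le> m then \<delta> m else 0)
        - (g2 + B) * (if Y \<le> m then \<delta> m else 0) \<le> F m * \<delta> m" by simp
  qed
  finally show ?thesis using eq by simp
qed

text \<open>Stirling's formula up to O(ln n), by induction from 1 / (n + 1) \<le> ln (n + 1) - ln n
  \<le> 1 / n.\<close>

lemma ln_fact_bounds:
  assumes "n \<ge> 1"
  shows "real n * ln n - n \<le> ln (fact n)" "ln (fact n) \<le> real n * ln n - n + ln n + 1"
proof -
  have "real n * ln n - n \<le> ln (fact n) \<and> ln (fact n) \<le> real n * ln n - n + ln n + 1"
    using assms
  proof (induction n rule: dec_induct)
    case (step n)
    have n: "real n > 0" using step by simp
    have eq: "ln (fact (Suc n) :: real) = ln (real n + 1) + ln (fact n)"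
    proof -
      have "fact (Suc n) = (real n + 1) * fact n" by simp
      then show ?thesis using n by (simp only: ln_mult_pos[of "real n + 1" "fact n"] fact_gt_zero)
    qed
    have "ln (1 + 1 / real n) \<le> 1 / real n" using n by (intro ln_add_one_self_le_self) auto
    moreover have l: "ln (real n + 1) = ln n + ln (1 + 1 / real n)"
    proof -
      have "real n + 1 = real n * (1 + 1 / real n)" using n by (simp add: field_simps)
      then show ?thesis using n by (metis ln_mult_pos add_pos_pos zero_less_divide_1_iff zero_less_one)
    qed
    ultimately have u: "real n * ln (real n + 1) \<le> real n * ln n + 1"
      using n by (simp add: field_simps)
    have "ln (1 / (1 + 1 / real n)) \<le> 1 / (1 + 1 / real n) - 1"
      using n by (intro ln_le_minus_one) (auto simp: add_pos_pos)
    then have "1 - 1 / (1 + 1 / real n) \<le> ln (1 + 1 / real n)"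
    proof -
      have "1 + 1 / real n > 0" using n by (simp add: add_pos_pos)
      then have "ln (1 / (1 + 1 / real n)) = - ln (1 + 1 / real n)" by (subst ln_div) auto
      with \<open>ln (1 / (1 + 1 / real n)) \<le> _\<close> show ?thesis by linarith
    qed
    moreover have "1 - 1 / (1 + 1 / real n) = 1 / (real n + 1)" using n by (simp add: field_simps)
    ultimately have "1 / (real n + 1) \<le> ln (real n + 1) - ln n" using l by simp
    then have v: "1 + (real n + 1) * ln n \<le> (real n + 1) * ln (real n + 1)"
      using n by (simp add: field_simps)
    show ?case using step u v eq by (simp add: algebra_simps)
  qed simp
  then show "real n * ln n - n \<le> ln (fact n)" "ln (fact n) \<le> real n * ln n - n + ln n + 1" by auto
qed

lemma ln_fact_div_approx:
  assumes k: "k > 0" and x: "x \<ge> k"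
  shows "\<bar>ln (fact (x div k)) - real x / k * (ln x - ln k - 1)\<bar> \<le> 2 * ln x + 2"
proof -
  define n where "n = x div k"
  define y where "y = real x / k"
  have n: "n \<ge> 1" using k x unfolding n_def by (simp add: Suc_le_eq div_greater_zero_iff)
  have y1: "real n \<le> y" unfolding n_def y_def by (rule of_nat_div_le_of_nat)
  have "x < k * (n + 1)" unfolding n_def using k
    by (metis Suc_eq_plus1 dividend_less_times_div mult.commute mult_Suc_right)
  then have "real x < real k * (real n + 1)" by (metis of_nat_1 of_nat_add of_nat_less_iff of_nat_mult)
  then have y2: "y < real n + 1" using k unfolding y_def by (simp add: field_simps)
  have y0: "y \<ge> 1" using n y1 by linarith
  have yx: "y \<le> x" unfolding y_def using k x by (simp add: field_simps)
  have lyx: "ln y \<le> ln x" using y0 yx by simp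
  have lny: "ln n \<le> ln y" using n y1 by simp
  have ly: "ln y = ln x - ln k" unfolding y_def using k x by (simp add: ln_div)
  have "y * ln y - real n * ln n \<ge> 0" using lny y1 n y0 by (simp add: mult_mono)
  have "ln (y / n) \<le> y / n - 1" using n y0 by (intro ln_le_minus_one) auto
  then have "ln y - ln n \<le> (y - n) / n" using n y0 by (simp add: ln_div field_simps)
  also have "\<dots> \<le> 1 / n" using y2 n by (intro divide_right_mono) auto
  finally have "real n * (ln y - ln n) \<le> 1" using n by (simp add: field_simps)
  moreover have "(y - n) * ln y \<le> ln y" "0 \<le> (y - n) * ln y"
    using y2 y1 y0 by (auto intro!: mult_left_le_one_le)
  moreover have "y * ln y - n * ln n = real n * (ln y - ln n) + (y - n) * ln y" by (simp add: algebra_simps)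
  moreover have "real n * (ln y - ln n) \<ge> 0" using lny by simp
  ultimately have "0 \<le> y * ln y - n * ln n" "y * ln y - n * ln n \<le> 1 + ln y" by linarith+
  then have "\<bar>ln (fact n) - y * (ln y - 1)\<bar> \<le> 2 * ln x + 2"
  proof -
    have "ln (real n) \<ge> 0" "ln (real x) \<ge> 0" using n x k by auto
    then show ?thesis
      using ln_fact_bounds[OF n] y1 y2 lyx lny \<open>0 \<le> y * ln y - n * ln n\<close> \<open>y * ln y - n * ln n \<le> 1 + ln y\<close>
      unfolding abs_le_iff right_diff_distrib by linarith
  qed
  then show ?thesis unfolding ly unfolding n_def y_def .
qed

text \<open>As the sum of \<open>\<nu> k / k\<close> is 0, the terms x ln x of Stirling's formula
  cancel and minus the sum of \<open>\<nu> k * ln k / k\<close> is left as the slope. The term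
  \<psi>(x / Y), due to the range where the combination may be negative, is paid for with a cruder
  linear bound on \<psi>, which adds only \<open>(g2 + B) * c / Y\<close> to the slope.\<close>

lemma chebyshev_bound:
  fixes \<nu> :: "nat \<Rightarrow> real" and x Y :: nat
  assumes K: "finite K" "0 \<notin> K" and zero: "(\<Sum>k\<in>K. \<nu> k / k) = 0"
    and g: "0 \<le> g1" "g1 \<le> g2" "0 \<le> B" and Y: "2 \<le> Y"
    and F1: "g1 \<le> (\<Sum>k\<in>K. \<nu> k * real (1 div k))"
    and F2: "\<And>m. 2 \<le> m \<Longrightarrow> m < Y \<Longrightarrow> g2 \<le> (\<Sum>k\<in>K. \<nu> k * real (m div k))"
    and FB: "\<And>m. Y \<le> m \<Longrightarrow> - B \<le> (\<Sum>k\<in>K. \<nu> k * real (m div k))"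
    and c: "\<And>x. psi x \<le> c * x + C * (ln x + 1)" "0 \<le> c" "0 \<le> C" and x: "\<And>k. k \<in> K \<Longrightarrow> k \<le> x" "Y \<le> x"
  shows "g1 * psi x + (g2 - g1) * psi (x div 2) \<le>
    (- (\<Sum>k\<in>K. \<nu> k * ln k / k) + (g2 + B) * c / Y) * x + ((g2 + B) * C + (\<Sum>k\<in>K. 2 * \<bar>\<nu> k\<bar>)) * (ln x + 1)"
proof -
  have x0: "x > 0" using x Y by simp
  have "(\<Sum>k\<in>K. \<nu> k * ln (fact (x div k))) \<le>
      (\<Sum>k\<in>K. \<nu> k * (real x / k * (ln x - ln k - 1)) + \<bar>\<nu> k\<bar> * (2 * ln x + 2))"
  proof (rule sum_mono)
    fix k assume k: "k \<in> K"
    then have "k > 0" using K by (metis gr0I)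
    from ln_fact_div_approx[OF this x(1)[OF k]]
    have "\<bar>\<nu> k\<bar> * \<bar>ln (fact (x div k)) - real x / k * (ln x - ln k - 1)\<bar> \<le> \<bar>\<nu> k\<bar> * (2 * ln x + 2)"
      by (intro mult_left_mono) auto
    then have "\<nu> k * (ln (fact (x div k)) - real x / k * (ln x - ln k - 1)) \<le> \<bar>\<nu> k\<bar> * (2 * ln x + 2)"
      unfolding abs_mult[symmetric] by linarith
    then show "\<nu> k * ln (fact (x div k)) \<le> \<nu> k * (real x / k * (ln x - ln k - 1)) + \<bar>\<nu> k\<bar> * (2 * ln x + 2)"
      by (simp add: algebra_simps)
  qed
  also have "\<dots> = - (\<Sum>k\<in>K. \<nu> k * ln k / k) * x + (\<Sum>k\<in>K. \<nu> k / k) * (x * (ln x - 1))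
      + (\<Sum>k\<in>K. 2 * \<bar>\<nu> k\<bar>) * (ln x + 1)"
    by (simp add: sum_distrib_right sum_distrib_left sum.distrib sum_negf sum_subtractf algebra_simps diff_divide_distrib add_divide_distrib)
  finally have up: "(\<Sum>k\<in>K. \<nu> k * ln (fact (x div k))) \<le>
      - (\<Sum>k\<in>K. \<nu> k * ln k / k) * x + (\<Sum>k\<in>K. 2 * \<bar>\<nu> k\<bar>) * (ln x + 1)" using zero by simp
  have "psi (x div Y) \<le> c * real (x div Y) + C * (ln (real (x div Y)) + 1)" by (rule c)
  also have "\<dots> \<le> c * x / Y + C * (ln x + 1)"
  proof -
    have "real (x div Y) \<le> real x / Y" by (rule of_nat_div_le_of_nat)
    then have "c * real (x div Y) \<le> c * (real x / Y)" using c by (intro mult_left_mono) auto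
    moreover have "ln (real (x div Y)) \<le> ln x"
      using x Y by (intro ln_mono) (auto simp: div_greater_zero_iff div_le_dividend)
    ultimately show ?thesis using c by (intro add_mono mult_left_mono) auto
  qed
  finally have "(g2 + B) * psi (x div Y) \<le> (g2 + B) * (c * x / Y + C * (ln x + 1))"
    using g by (intro mult_left_mono) auto
  moreover have "g1 * psi x + (g2 - g1) * psi (x div 2) - (g2 + B) * psi (x div Y)
    \<le> (\<Sum>k\<in>K. \<nu> k * ln (fact (x div k)))"
    by (rule chebyshev_combination[OF K refl g F1 F2 FB Y])
  ultimately show ?thesis using up by (simp add: algebra_simps)
qed

section \<open>Numerical bounds for \<psi>\<close>

lemma ln_prime_bounds:
  "ln (2::real) \<in> {693147/1000000..693148/1000000}"
  "ln (3::real) \<in> {1098610/1000000..1098614/1000000}"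
  "ln (5::real) \<in> {1609434/1000000..1609441/1000000}"
  "ln (7::real) \<in> {1945906/1000000..1945914/1000000}"
  "ln (11::real) \<in> {2397890/1000000..2397900/1000000}"
  "ln (13::real) \<in> {2564940/1000000..2564956/1000000}"
proof -
  have 2: "ln (2::real) \<in> {6931471/10000000..6931472/10000000}"
    using ln_approx_bounds[of 2 9] by (simp add: eval_nat_numeral)
  have 32: "ln (3/2::real) \<in> {4054650/10000000..4054652/10000000}"
    using ln_approx_bounds[of "3/2" 5] by (simp add: eval_nat_numeral)
  have 54: "ln (5/4::real) \<in> {2231435/10000000..2231436/10000000}"
    using ln_approx_bounds[of "5/4" 4] by (simp add: eval_nat_numeral)
  have 76: "ln (7/6::real) \<in> {1541506/10000000..1541507/10000000}"
    using ln_approx_bounds[of "7/6" 3] by (simp add: eval_nat_numeral)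
  have 1110: "ln (11/10::real) \<in> {953101/10000000..953102/10000000}"
    using ln_approx_bounds[of "11/10" 3] by (simp add: eval_nat_numeral)
  have 1312: "ln (13/12::real) \<in> {800427/10000000..800428/10000000}"
    using ln_approx_bounds[of "13/12" 3] by (simp add: eval_nat_numeral)
  \<comment> \<open>Each prime is reached from smaller ones through a ratio close to 1, where few
    terms of the series suffice.\<close>
  have e: "ln (3::real) = ln (3/2) + ln 2" "ln (5::real) = ln (5/4) + 2 * ln 2"
    "ln (7::real) = ln (7/6) + ln 3 + ln 2" "ln (11::real) = ln (11/10) + ln 5 + ln 2"
    "ln (13::real) = ln (13/12) + ln 3 + 2 * ln 2"
    using ln_realpow[of 2 2] ln_mult_pos[of "3::real" 4] by (simp_all add: ln_div flip: ln_mult_pos)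
  show "ln (2::real) \<in> {693147/1000000..693148/1000000}"
  "ln (3::real) \<in> {1098610/1000000..1098614/1000000}"
  "ln (5::real) \<in> {1609434/1000000..1609441/1000000}"
  "ln (7::real) \<in> {1945906/1000000..1945914/1000000}"
  "ln (11::real) \<in> {2397890/1000000..2397900/1000000}"
  "ln (13::real) \<in> {2564940/1000000..2564956/1000000}"
    using 2 32 54 76 1110 1312 e by auto
qed

text \<open>The weights 1 and -2 at 1 and 2 bound \<psi>(n) - \<psi>(n / 2) by the logarithm of a
  central binomial coefficient, up to a factor \<open>n\<close> for odd \<open>n\<close>; halving
  then gives a geometric series. The constant 2 instead of 2 ln 2 leaves room for that
  factor.\<close>

lemma psi_le_2: "psi n \<le> 2 * n"
proof (induction n rule: less_induct)
  case (less n)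
  show ?case
  proof (cases "n = 0")
    case False
    define h where "h = n div 2"
    have IH: "psi h \<le> 2 * h" using less[of h] False by (simp add: h_def)
    define \<nu> :: "nat \<Rightarrow> real" where "\<nu> k = (if k = 1 then 1 else - 2)" for k
    have F: "(\<Sum>k\<in>{1,2}. \<nu> k * real (m div k)) = real (m mod 2)" for m
    proof -
      have "real m = real (m div 2 * 2 + m mod 2)" by (simp only: div_mult_mod_eq)
      then have "real m - 2 * real (m div 2) = real (m mod 2)" by (simp only: of_nat_add of_nat_mult of_nat_numeral)
      then show ?thesis unfolding \<nu>_def by simp
    qed
    have "1 * psi n + (1 - 1) * psi (n div 2) - (1 + 0) * psi (n div 2) \<le>
        (\<Sum>k\<in>{1,2}. \<nu> k * ln (fact (n div k)))"
      by (rule chebyshev_combination[where F="\<lambda>m. \<Sum>k\<in>{1,2}. \<nu> k * real (m div k)"]) (simp_all only: F, auto)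
    then have c: "psi n \<le> psi h + ln (fact n) - 2 * ln (fact h)"
      by (simp add: \<nu>_def h_def)
    have l2: "ln (2::real) \<le> 7 / 10" using ln_prime_bounds(1) by simp
    have b: "ln (fact (2 * h) :: real) \<le> 2 * ln (fact h) + 7 / 5 * h"
    proof -
      have "fact (2 * h) = (fact h)\<^sup>2 * real ((2 * h) choose h)"
        using binomial_fact[of h "2 * h", where 'a=real] by (simp add: power2_eq_square)
      also have "\<dots> \<le> (fact h)\<^sup>2 * 2 ^ (2 * h)"
      proof (rule mult_left_mono)
        have "real (2 * h choose h) \<le> real (2 ^ (2 * h))"
          using binomial_le_pow2[of "2 * h" h] by (simp only: of_nat_le_iff)
        then show "real (2 * h choose h) \<le> 2 ^ (2 * h)" by simp
      qed simp
      finally have "ln (fact (2 * h) :: real) \<le> ln ((fact h)\<^sup>2 * 2 ^ (2 * h) :: real)" by simp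
      also have "\<dots> = 2 * ln (fact h) + 2 * h * ln 2" by (simp add: ln_mult_pos ln_realpow)
      finally show ?thesis using l2 mult_left_mono[OF l2, of "2 * real h"] by simp
    qed
    show ?thesis
    proof (cases "even n")
      case True
      then have "n = 2 * h" by (simp add: h_def)
      then show ?thesis using b c IH by simp
    next
      case odd: False
      then have n: "n = 2 * h + 1" by (simp add: h_def)
      have "ln (fact n :: real) = ln (fact (2 * h)) + ln (2 * real h + 1)"
        unfolding n by (simp add: ln_mult_pos algebra_simps flip: ln_mult_pos)
      moreover have "ln (2 * real h + 1) \<le> (2 * real h + 1) / 4 - 1 + 2 * ln 2"
      proof -
        have "ln ((2 * real h + 1) / 4) \<le> (2 * real h + 1) / 4 - 1" by (intro ln_le_minus_one) auto
        then show ?thesis using ln_realpow[of 2 2] by (simp add: ln_div)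
      qed
      then have "ln (2 * real h + 1) \<le> real h / 2 + 13 / 20" using l2 by (simp add: field_simps)
      moreover have "real n = 2 * real h + 1" using n by simp
      ultimately show ?thesis using b c IH l2 of_nat_0_le_iff[of h, where 'a=real] unfolding of_nat_mult of_nat_numeral by linarith
    qed
  qed simp
qed

lemma nat_div_bounds:
  assumes "k > 0"
  shows "real m / k - (real k - 1) / k \<le> real (m div k)" "real (m div k) \<le> real m / k"
proof -
  show "real (m div k) \<le> real m / k" by (rule of_nat_div_le_of_nat)
  have "m \<le> k * (m div k) + (k - 1)"
    using assms mod_less_divisor[of k m] mult_div_mod_eq[of k m] by linarith
  then have "real m \<le> real (k * (m div k) + (k - 1))" by (simp only: of_nat_le_iff)
  then have "real m \<le> real k * real (m div k) + (real k - 1)" using assms by (simp add: of_nat_diff)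
  then show "real m / k - (real k - 1) / k \<le> real (m div k)" using assms by (simp add: field_simps)
qed

text \<open>Chebyshev's combination with weights 1 at 1 and 30 and -1 at 2, 3 and 5. Its coefficient
  function has period 30, is nonnegative, and is at least 1 for 1 \<le> m < 6, so \<psi>(x) -
  \<psi>(x / 6) is at most 0.9213 x up to logarithms. Thus a bound with constant \<open>c\<close>
  improves to one with 0.9213 + c / 6.\<close>

lemma psi_chebyshev_30:
  assumes c: "\<And>x. psi x \<le> c * x + C * (ln x + 1)" "0 \<le> c" "0 \<le> C" and x: "30 \<le> x"
  shows "psi x \<le> (9213 / 10000 + c / 6) * x + (C + 12) * (ln x + 1)"
proof -
  define \<nu> :: "nat \<Rightarrow> real" where "\<nu> k = (if k = 1 \<or> k = 30 then 1 else - 1)" for k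
  define K :: "nat set" where "K = {1, 2, 3, 5, 30}"
  have F: "(\<Sum>k\<in>K. \<nu> k * real (m div k)) =
      real_of_int (int m + int (m div 30) - int (m div 2) - int (m div 3) - int (m div 5))" for m
    by (simp add: \<nu>_def K_def)
  have F0: "0 \<le> int m + int (m div 30) - int (m div 2) - int (m div 3) - int (m div 5)" for m
  proof -
    define q r where "q = m div 30" and "r = m mod 30"
    have m: "m = 30 * q + r" and r: "r \<in> set [0..<30]" by (auto simp: q_def r_def)
    have d: "(30 * q + r) div 30 = q + r div 30" "(30 * q + r) div 2 = 15 * q + r div 2"
      "(30 * q + r) div 3 = 10 * q + r div 3" "(30 * q + r) div 5 = 6 * q + r div 5"
      using div_mult_self4[of 30 q r] div_mult_self4[of 2 "15 * q" r] div_mult_self4[of 3 "10 * q" r]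
        div_mult_self4[of 5 "6 * q" r] by simp_all
    have "list_all (\<lambda>r. r div 2 + r div 3 + r div 5 \<le> r + r div 30) [0..<30]"
      by (simp add: upt_rec)
    then have "r div 2 + r div 3 + r div 5 \<le> r + r div 30" using r unfolding list_all_iff by blast
    then show ?thesis unfolding m d by linarith
  qed
  have F1: "1 \<le> int m + int (m div 30) - int (m div 2) - int (m div 3) - int (m div 5)" if "1 \<le> m" "m < 6" for m
  proof -
    have "m \<in> {1, 2, 3, 4, 5}" using that by auto
    then show ?thesis by auto
  qed
  have "1 * psi x + (1 - 1) * psi (x div 2) \<le>
    (- (\<Sum>k\<in>K. \<nu> k * ln k / k) + (1 + 0) * c / real (6::nat)) * x + ((1 + 0) * C + (\<Sum>k\<in>K. 2 * \<bar>\<nu> k\<bar>)) * (ln x + 1)"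
  proof (rule chebyshev_bound)
    show "(\<Sum>k\<in>K. \<nu> k / real k) = 0" by (simp add: K_def \<nu>_def)
    show "1 \<le> (\<Sum>k\<in>K. \<nu> k * real (1 div k))" using F1[of 1] unfolding F by simp
    show "1 \<le> (\<Sum>k\<in>K. \<nu> k * real (m div k))" if "2 \<le> m" "m < 6" for m
      using F1[of m] that unfolding F by linarith
    show "- 0 \<le> (\<Sum>k\<in>K. \<nu> k * real (m div k))" for m
      using F0[of m] unfolding F by linarith
  qed (use c x in \<open>auto simp: K_def\<close>)
  moreover have "- (\<Sum>k\<in>K. \<nu> k * ln k / k) \<le> 9213 / 10000"
  proof -
    have "ln (30::real) = ln 2 + ln 3 + ln 5" by (simp flip: ln_mult_pos)
    moreover have "- (\<Sum>k\<in>K. \<nu> k * ln k / k) = ln 2 / 2 + ln 3 / 3 + ln 5 / 5 - ln 30 / 30"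
      by (simp add: K_def \<nu>_def)
    ultimately show ?thesis using ln_prime_bounds unfolding atLeastAtMost_iff by linarith
  qed
  then have "(- (\<Sum>k\<in>K. \<nu> k * ln k / k) + (1 + 0) * c / real (6::nat)) * x \<le> (9213 / 10000 + c / 6) * x"
    by (intro mult_right_mono) auto
  moreover have "ln (real x) + 1 \<ge> 0" using x by simp
  then have "((1 + 0) * C + (\<Sum>k\<in>K. 2 * \<bar>\<nu> k\<bar>)) * (ln x + 1) \<le> (C + 12) * (ln x + 1)"
    by (intro mult_right_mono) (auto simp: K_def \<nu>_def)
  ultimately show ?thesis by simp
qed

text \<open>Two rounds of the improvement, starting from the constant 2: 0.9213 + 2 / 6 < 1.25464
  and 0.9213 + 1.25464 / 6 < 1.131. For \<open>x < 30\<close> the logarithmic term absorbs 2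
  x.\<close>

lemma psi_le_1131: "psi x \<le> 1131 / 1000 * x + 84 * (ln x + 1)"
proof -
  have a: "psi x \<le> 125464 / 100000 * x + 72 * (ln x + 1)" for x
  proof (cases "30 \<le> x")
    case True
    have "psi x \<le> (9213 / 10000 + 2 / 6) * x + (60 + 12) * (ln x + 1)"
    proof (rule psi_chebyshev_30[OF _ _ _ True])
      show "psi x \<le> 2 * x + 60 * (ln x + 1)" for x
      proof (cases "x = 0")
        case False
        then show ?thesis using psi_le_2[of x] by (simp add: add_increasing2)
      qed simp
    qed auto
    then show ?thesis by simp
  next
    case False
    then show ?thesis using psi_le_2[of x] by (cases "x = 0") (auto simp: add_increasing2 intro: order_trans[of _ "60::real"])
  qed
  show ?thesis
  proof (cases "30 \<le> x")
    case True
    have "psi x \<le> (9213 / 10000 + 125464 / 100000 / 6) * x + (72 + 12) * (ln x + 1)"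
      by (rule psi_chebyshev_30[OF a _ _ True]) auto
    then show ?thesis by simp
  next
    case False
    show ?thesis
    proof (cases "x = 0")
      case x: False
      then have "ln (real x) \<ge> 0" by simp
      then show ?thesis using psi_le_2[of x] False by simp
    qed simp
  qed
qed

text \<open>These weights were found by a numerical search. Together with the weight \<open>- 1800 * (853 / 450450)\<close>
  at 1800, which makes the sum of \<open>\<nu> k / k\<close> vanish, they give a combination that dominates
  \<open>\<psi>(x) + 2 \<psi>(x / 2)\<close>.\<close>

definition cheb_coeffs :: "(nat \<times> int) list" where
  "cheb_coeffs = [(1, 1), (2, 1), (3, - 1), (4, - 2), (5, - 1), (6, - 1), (7, - 1), (10, - 1), (11, - 1), (12, 2), (13, - 1), (14, - 1), (15, 1), (18, - 1), (20, 1), (21, 1), (22, - 1), (24, - 1), (28, 1), (40, - 1), (44, 1), (50, 1), (60, - 2), (66, 1), (84, - 2), (105, - 1), (120, 1), (140, - 2), (420, 2), (600, - 3)]"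

definition cheb_sum :: "nat \<Rightarrow> int" where
  "cheb_sum m = (\<Sum>(k, v)\<leftarrow>cheb_coeffs. v * int (m div k))"

lemma sum_map_of_list:
  fixes g :: "nat \<Rightarrow> real"
  assumes "distinct (map fst L)"
  shows "(\<Sum>k\<in>set (map fst L). of_int (the (map_of L k)) * g k) = (\<Sum>(k, v)\<leftarrow>L. of_int v * g k)"
  using assms
proof (induction L)
  case (Cons kv L)
  obtain k v where kv: "kv = (k, v)" by (cases kv)
  have "k \<notin> set (map fst L)" using Cons.prems kv by simp
  then have "(\<Sum>j\<in>set (map fst L). of_int (the (map_of (kv # L) j)) * g j) =
      (\<Sum>j\<in>set (map fst L). of_int (the (map_of L j)) * g j)"
    by (intro sum.cong) (auto simp: kv)
  then show ?case using Cons kv \<open>k \<notin> set (map fst L)\<close> by simp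
qed simp

lemma cheb_sum_1: "cheb_sum 1 = 1"
  by (simp add: cheb_sum_def cheb_coeffs_def)

lemma cheb_sum_ge_0: "list_all (\<lambda>m. 3 \<le> cheb_sum m) [2..<200]"
  unfolding cheb_sum_def cheb_coeffs_def by (simp add: upt_rec)

lemma cheb_sum_ge_1: "list_all (\<lambda>m. 3 \<le> cheb_sum m) [200..<400]"
  unfolding cheb_sum_def cheb_coeffs_def by (simp add: upt_rec)

lemma cheb_sum_ge_2: "list_all (\<lambda>m. 3 \<le> cheb_sum m) [400..<600]"
  unfolding cheb_sum_def cheb_coeffs_def by (simp add: upt_rec)

lemma cheb_sum_ge_3: "list_all (\<lambda>m. 3 \<le> cheb_sum m) [600..<800]"
  unfolding cheb_sum_def cheb_coeffs_def by (simp add: upt_rec)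

lemma cheb_sum_ge_4: "list_all (\<lambda>m. 3 \<le> cheb_sum m) [800..<1000]"
  unfolding cheb_sum_def cheb_coeffs_def by (simp add: upt_rec)

lemma cheb_sum_ge_5: "list_all (\<lambda>m. 3 \<le> cheb_sum m) [1000..<1200]"
  unfolding cheb_sum_def cheb_coeffs_def by (simp add: upt_rec)

lemma cheb_sum_ge_6: "list_all (\<lambda>m. 3 \<le> cheb_sum m) [1200..<1400]"
  unfolding cheb_sum_def cheb_coeffs_def by (simp add: upt_rec)

lemma cheb_sum_ge_7: "list_all (\<lambda>m. 3 \<le> cheb_sum m) [1400..<1600]"
  unfolding cheb_sum_def cheb_coeffs_def by (simp add: upt_rec)

lemma cheb_sum_ge_8: "list_all (\<lambda>m. 3 \<le> cheb_sum m) [1600..<1800]"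
  unfolding cheb_sum_def cheb_coeffs_def by (simp add: upt_rec)

lemma cheb_sum_ge:
  assumes "2 \<le> m" "m < 1800"
  shows "3 \<le> cheb_sum m"
proof -
  consider "m \<in> {2..<200}" | "m \<in> {200..<400}" | "m \<in> {400..<600}" | "m \<in> {600..<800}" | "m \<in> {800..<1000}" | "m \<in> {1000..<1200}" | "m \<in> {1200..<1400}" | "m \<in> {1400..<1600}" | "m \<in> {1600..<1800}"
    using assms unfolding atLeastLessThan_iff by linarith
  then show ?thesis
    using cheb_sum_ge_0 cheb_sum_ge_1 cheb_sum_ge_2 cheb_sum_ge_3 cheb_sum_ge_4 cheb_sum_ge_5 cheb_sum_ge_6 cheb_sum_ge_7 cheb_sum_ge_8
    by cases (simp_all only: list_all_iff set_upt)
qed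

lemma ln_13_smooth: "ln (2 ^ a * 3 ^ b * 5 ^ c * 7 ^ d * 11 ^ e * 13 ^ f :: real) =
    a * ln 2 + b * ln 3 + c * ln 5 + d * ln 7 + e * ln 11 + f * ln 13" for a b c d e f :: nat
  by (simp add: ln_mult_pos ln_realpow)

text \<open>The slope has to stay below 3 ln 2 = 2.07944...: the weights give 2.0694, and the range
  m \<ge> 1800 adds 15.1 * 1.131 / 1800 < 0.0095. The weight at 1800 is not an integer, but it has
  no influence on the values at m < 1800, which are those of the integer function
  \<open>cheb_sum\<close>.\<close>

lemma psi_bound: "\<exists>C. \<forall>x\<ge>1800. psi x + 2 * psi (x div 2) \<le> 20792 / 10000 * x + C * (ln x + 1)"
proof -
  define K where "K = set (map fst cheb_coeffs)"
  define \<nu> :: "nat \<Rightarrow> real" where "\<nu> k = (if k \<in> K then of_int (the (map_of cheb_coeffs k)) else - 1800 * (853 / 450450))" for k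
  have dist: "distinct (map fst cheb_coeffs)" by (simp add: cheb_coeffs_def)
  have K: "finite K" "1800 \<notin> K" by (simp_all add: K_def cheb_coeffs_def)
  have sum: "(\<Sum>k\<in>insert 1800 K. \<nu> k * g k) =
      (\<Sum>(k, v)\<leftarrow>cheb_coeffs. of_int v * g k) - 1800 * (853 / 450450) * g 1800" for g
  proof -
    have "(\<Sum>k\<in>K. \<nu> k * g k) = (\<Sum>k\<in>K. of_int (the (map_of cheb_coeffs k)) * g k)"
      by (intro sum.cong) (auto simp: \<nu>_def)
    then show ?thesis using K sum_map_of_list[OF dist, of g] by (simp add: \<nu>_def K_def)
  qed
  have F: "(\<Sum>k\<in>insert 1800 K. \<nu> k * real (m div k)) =
      of_int (cheb_sum m) - 1800 * (853 / 450450) * real (m div 1800)" for m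
    unfolding sum[of "\<lambda>k. real (m div k)"] by (simp add: cheb_sum_def cheb_coeffs_def)
  have zero: "(\<Sum>k\<in>insert 1800 K. \<nu> k / k) = 0"
    using sum[of "\<lambda>k. 1 / k"] by (simp add: cheb_coeffs_def)
  have "(\<Sum>k\<in>insert 1800 K. \<nu> k * ln k / k) = (- (615091 / 900900)) * ln 2 + (- (35953 / 85800)) * ln 3 + (- (40751 / 180180)) * ln 5 + (- (73 / 420)) * ln 7 + (- (13 / 132)) * ln 11 + (- (1 / 13)) * ln 13"
    using sum[of "\<lambda>k. ln k / k"]
      ln_13_smooth[of 1 0 0 0 0 0] ln_13_smooth[of 0 1 0 0 0 0] ln_13_smooth[of 2 0 0 0 0 0] ln_13_smooth[of 0 0 1 0 0 0] ln_13_smooth[of 1 1 0 0 0 0] ln_13_smooth[of 0 0 0 1 0 0] ln_13_smooth[of 1 0 1 0 0 0] ln_13_smooth[of 0 0 0 0 1 0] ln_13_smooth[of 2 1 0 0 0 0] ln_13_smooth[of 0 0 0 0 0 1] ln_13_smooth[of 1 0 0 1 0 0] ln_13_smooth[of 0 1 1 0 0 0] ln_13_smooth[of 1 2 0 0 0 0] ln_13_smooth[of 2 0 1 0 0 0] ln_13_smooth[of 0 1 0 1 0 0] ln_13_smooth[of 1 0 0 0 1 0] ln_13_smooth[of 3 1 0 0 0 0] ln_13_smooth[of 2 0 0 1 0 0] ln_13_smooth[of 3 0 1 0 0 0] ln_13_smooth[of 2 0 0 0 1 0] ln_13_smooth[of 1 0 2 0 0 0] ln_13_smooth[of 2 1 1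 0 0 0] ln_13_smooth[of 1 1 0 0 1 0] ln_13_smooth[of 2 1 0 1 0 0] ln_13_smooth[of 0 1 1 1 0 0] ln_13_smooth[of 3 1 1 0 0 0] ln_13_smooth[of 2 0 1 1 0 0] ln_13_smooth[of 2 1 1 1 0 0] ln_13_smooth[of 3 1 2 0 0 0] ln_13_smooth[of 3 2 2 0 0 0]
    by (simp add: cheb_coeffs_def add_divide_distrib)
  then have val: "- (\<Sum>k\<in>insert 1800 K. \<nu> k * ln k / k) \<le> 20694 / 10000"
    using ln_prime_bounds unfolding atLeastAtMost_iff by linarith
  \<comment> \<open>The terms linear in \<open>m\<close> cancel, because the sum of
    \<open>\<nu> k / k\<close> is 0. What remains are the rounding losses (k - 1) / k of the
    positive weights, in total about 12.06.\<close>
  have FB: "- (121 / 10) \<le> (\<Sum>k\<in>insert 1800 K. \<nu> k * real (m div k))" for m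
  proof -
    have "real_of_int (cheb_sum m) = real m + real (m div 2) - real (m div 3) - 2 * real (m div 4) - real (m div 5) - real (m div 6) - real (m div 7) - real (m div 10) - real (m div 11) + 2 * real (m div 12) - real (m div 13) - real (m div 14) + real (m div 15) - real (m div 18) + real (m div 20) + real (m div 21) - real (m div 22) - real (m div 24) + real (m div 28) - real (m div 40) + real (m div 44) + real (m div 50) - 2 * real (m div 60) + real (m div 66) - 2 * real (m div 84) - real (m div 105) + real (m div 120) - 2 * real (m div 140) + 2 * real (m div 420) - 3 * real (m div 600)"
      by (simp add: cheb_sum_def cheb_coeffs_def)
    then show ?thesis
      using nat_div_bounds(1)[of 2 m, simplified] nat_div_bounds(2)[of 3 m, simplified] nat_div_bounds(2)[of 4 m, simplified] nat_div_bounds(2)[of 5 m, simplified] nat_div_bounds(2)[of 6 m, simplified] nat_div_bounds(2)[of 7 m, simplified] nat_div_bounds(2)[of 10 m, simplified] nat_div_bounds(2)[of 11 m, simplified] nat_div_bounds(1)[of 12 m, simplified] nat_div_bounds(2)[of 13 m, simplified] nat_div_bounds(2)[of 14 m, simplified] nat_div_bounds(1)[of 15 m, simplified] nat_div_bounds(2)[of 18 m, simplified] nat_div_bounds(1)[of 20 m, simplified] nat_div_bounds(1)[of 21 m, simplified] nat_div_bounds(2)[of 22 m, simplified] nat_div_bounds(2)[of 24 m, simplified] nat_div_bounds(1)[of 28 m, simplified] nat_div_bounds(2)[of 40 m, simplified] nat_div_bounds(1)[of 44 m, simplified] nat_div_bounds(1)[of 50 m, simplified] nat_div_bounds(2)[of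 60 m, simplified] nat_div_bounds(1)[of 66 m, simplified] nat_div_bounds(2)[of 84 m, simplified] nat_div_bounds(2)[of 105 m, simplified] nat_div_bounds(1)[of 120 m, simplified] nat_div_bounds(2)[of 140 m, simplified] nat_div_bounds(1)[of 420 m, simplified] nat_div_bounds(2)[of 600 m, simplified] nat_div_bounds(2)[of 1800 m, simplified]
      unfolding F by linarith
  qed
  show ?thesis
  proof (intro exI allI impI)
    fix x :: nat assume x: "1800 \<le> x"
    have "1 * psi x + (3 - 1) * psi (x div 2) \<le>
      (- (\<Sum>k\<in>insert 1800 K. \<nu> k * ln k / k) + (3 + 121 / 10) * (1131 / 1000) / real (1800::nat)) * x
        + ((3 + 121 / 10) * 84 + (\<Sum>k\<in>insert 1800 K. 2 * \<bar>\<nu> k\<bar>)) * (ln x + 1)"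
    proof (rule chebyshev_bound)
      show "1 \<le> (\<Sum>k\<in>insert 1800 K. \<nu> k * real (1 div k))" unfolding F by (simp add: cheb_sum_1[simplified])
      show "3 \<le> (\<Sum>k\<in>insert 1800 K. \<nu> k * real (m div k))" if "2 \<le> m" "m < 1800" for m
        unfolding F using cheb_sum_ge[OF that] that by simp
      show "finite (insert 1800 K)" using K by simp
      have le: "list_all (\<lambda>k. 0 < k \<and> k \<le> 1800) (map fst cheb_coeffs)" by (simp add: cheb_coeffs_def)
      then show "0 \<notin> insert 1800 K" by (auto simp: K_def list_all_iff)
      show "k \<le> x" if "k \<in> insert 1800 K" for k
        using le that x by (auto simp: K_def list_all_iff)
      show "psi y \<le> 1131 / 1000 * y + 84 * (ln y + 1)" for y by (rule psi_le_1131)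
    qed (use zero FB x in simp_all)
    moreover have "(- (\<Sum>k\<in>insert 1800 K. \<nu> k * ln k / k) + (3 + 121 / 10) * (1131 / 1000) / real (1800::nat)) * x \<le> 20792 / 10000 * real x"
      using val by (intro mult_right_mono) auto
    ultimately show "psi x + 2 * psi (x div 2) \<le> 20792 / 10000 * x
        + ((3 + 121 / 10) * 84 + (\<Sum>k\<in>insert 1800 K. 2 * \<bar>\<nu> k\<bar>)) * (ln x + 1)" by simp
  qed
qed

section \<open>Local integrality and formal power series\<close>

definition Zloc :: "nat \<Rightarrow> rat set" where
  "Zloc p = {r. \<exists>a b :: int. \<not> int p dvd b \<and> r = of_int a / of_int b}"

context
  fixes p :: nat
  assumes p: "prime p"
begin

lemma Zloc_of_int [simp]: "of_int a \<in> Zloc p"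
proof -
  have "\<not> int p dvd 1" using p by auto
  moreover have "(of_int a :: rat) = of_int a / of_int 1" by simp
  ultimately show ?thesis unfolding Zloc_def by blast
qed

lemma Zloc_of_nat [simp]: "of_nat a \<in> Zloc p"
  using Zloc_of_int[of "int a"] by simp

lemma Zloc_0 [simp]: "0 \<in> Zloc p" and Zloc_1 [simp]: "1 \<in> Zloc p"
  and Zloc_numeral [simp]: "numeral k \<in> Zloc p"
  using Zloc_of_int[of 0] Zloc_of_int[of 1] Zloc_of_int[of "numeral k"] by auto

lemma Zloc_add [intro]:
  assumes "x \<in> Zloc p" "y \<in> Zloc p" shows "x + y \<in> Zloc p"
proof -
  obtain a b c d where *: "\<not> int p dvd b" "x = of_int a / of_int b" "\<not> int p dvd d" "y = of_int c / of_int d"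
    using assms unfolding Zloc_def by blast
  then have "b \<noteq> 0" "d \<noteq> 0" by auto
  then have "x + y = of_int (a * d + c * b) / of_int (b * d)" using * by (simp add: field_simps)
  moreover have "\<not> int p dvd b * d" using * p by (simp add: prime_dvd_mult_iff)
  ultimately show ?thesis unfolding Zloc_def by blast
qed

lemma Zloc_mult [intro]:
  assumes "x \<in> Zloc p" "y \<in> Zloc p" shows "x * y \<in> Zloc p"
proof -
  obtain a b c d where *: "\<not> int p dvd b" "x = of_int a / of_int b" "\<not> int p dvd d" "y = of_int c / of_int d"
    using assms unfolding Zloc_def by blast
  then have "x * y = of_int (a * c) / of_int (b * d)" by simp
  moreover have "\<not> int p dvd b * d" using * p by (simp add: prime_dvd_mult_iff)
  ultimately show ?thesis unfolding Zloc_def by blast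
qed

lemma Zloc_minus [intro]: "x \<in> Zloc p \<Longrightarrow> - x \<in> Zloc p"
  using Zloc_mult[of "-1" x] Zloc_of_int[of "-1"] by simp

lemma Zloc_diff [intro]: "x \<in> Zloc p \<Longrightarrow> y \<in> Zloc p \<Longrightarrow> x - y \<in> Zloc p"
  using Zloc_add[of x "- y"] by auto

lemma Zloc_power [intro]: "x \<in> Zloc p \<Longrightarrow> x ^ n \<in> Zloc p"
  by (induction n) auto

lemma Zloc_sum [intro]: "(\<And>i. i \<in> A \<Longrightarrow> f i \<in> Zloc p) \<Longrightarrow> sum f A \<in> Zloc p"
  by (induction A rule: infinite_finite_induct) auto

lemma Zloc_divide_unit:
  assumes "x \<in> Zloc p" "\<not> int p dvd b"
  shows "x / of_int b \<in> Zloc p"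
proof -
  have "1 / of_int b = (of_int 1 / of_int b :: rat)" by simp
  then have "1 / of_int b \<in> Zloc p" unfolding Zloc_def mem_Collect_eq using assms(2) by (intro exI conjI)
  from Zloc_mult[OF assms(1) this] show ?thesis by simp
qed

lemma Zloc_frac:
  assumes "a \<noteq> 0" "b \<noteq> 0" "multiplicity (int p) b \<le> multiplicity (int p) a"
  shows "of_int a / of_int b \<in> Zloc p"
proof -
  have pp: "prime_elem (int p)" and nu: "\<not> is_unit (int p)" using p by auto
  obtain a' where a': "a = int p ^ multiplicity (int p) a * a'"
    using multiplicity_dvd[of "int p" a] by (rule dvdE)
  obtain b' where b': "b = int p ^ multiplicity (int p) b * b'" "\<not> int p dvd b'"
    using multiplicity_decompose'[of b "int p"] assms nu by blast
  have p0: "of_int (int p) \<noteq> (0::rat)" using p by (auto simp: prime_gt_0_nat)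
  obtain c where c: "multiplicity (int p) a = multiplicity (int p) b + c" using assms(3) le_Suc_ex by blast
  have "of_int a / of_int b = (of_int (int p) ^ c * of_int a' / of_int b' :: rat)"
    by (subst a', subst b'(1)) (use p0 in \<open>simp add: c power_add\<close>)
  moreover have "of_int (int p) ^ c * of_int a' \<in> Zloc p" by (intro Zloc_mult Zloc_power Zloc_of_int)
  ultimately show ?thesis using b' Zloc_divide_unit by metis
qed

end

lemma Ints_if_Zloc:
  assumes "\<And>p. prime p \<Longrightarrow> r \<in> Zloc p"
  shows "r \<in> \<int>"
proof -
  obtain a b where ab: "quotient_of r = (a, b)" by fastforce
  have b: "b > 0" "coprime a b" and r: "r = of_int a / of_int b"
    using quotient_of_denom_pos[OF ab] quotient_of_coprime[OF ab] quotient_of_div[OF ab] by auto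
  have "b = 1"
  proof (rule ccontr)
    assume "b \<noteq> 1"
    then have "\<not> is_unit b" using b by auto
    then obtain q where q: "prime q" "q dvd b" using b prime_divisor_exists[of b] by force
    have q0: "q > 0" using q(1) by (rule prime_gt_0_int)
    have "prime (nat q)" using q(1) prime_int_nat_transfer[THEN iffD1, of q] by blast
    from assms[OF this] obtain c d where cd: "\<not> int (nat q) dvd d" "r = of_int c / of_int d"
      unfolding Zloc_def by blast
    then have cd': "\<not> q dvd d" using q0 by simp
    then have "d \<noteq> 0" by (metis dvd_0_right)
    then have "(of_int (a * d) :: rat) = of_int (c * b)" using r cd(2) b by (simp add: field_simps)
    then have "a * d = c * b" by (simp only: of_int_eq_iff)
    then have "q dvd a * d" using q by simp
    then have "q dvd a" using q cd' by (simp add: prime_dvd_mult_iff)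
    then show False using q b coprime_common_divisor[of a b q] not_prime_unit by blast
  qed
  then show ?thesis using r by simp
qed

text \<open>Denominators that grow geometrically with the order. The property passes to products, so
  the denominators of high Taylor coefficients can be read off from the linear factors.\<close>

definition fps_denom :: "nat \<Rightarrow> nat \<Rightarrow> rat fps \<Rightarrow> bool" where
  "fps_denom p d G \<longleftrightarrow> (\<forall>l. of_nat d ^ l * fps_nth G l \<in> Zloc p)"

context
  fixes p :: nat
  assumes p: "prime p"
begin

lemma fps_denom_mult:
  assumes "fps_denom p d F" "fps_denom p d G"
  shows "fps_denom p d (F * G)"
  unfolding fps_denom_def
proof
  fix l
  have "of_nat d ^ l * fps_nth (F * G) l =
      (\<Sum>i=0..l. (of_nat d ^ i * fps_nth F i) * (of_nat d ^ (l - i) * fps_nth G (l - i)))"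
  proof -
    have "(of_nat d :: rat) ^ l = of_nat d ^ i * of_nat d ^ (l - i)" if "i \<le> l" for i
      using that by (simp flip: power_add)
    then show ?thesis by (simp add: fps_mult_nth sum_distrib_left mult_ac)
  qed
  also have "\<dots> \<in> Zloc p" using assms unfolding fps_denom_def
    by (intro Zloc_sum[OF p], intro Zloc_mult[OF p, of "_ ^ _ * _" "_ ^ _ * _"]) blast+
  finally show "of_nat d ^ l * fps_nth (F * G) l \<in> Zloc p" .
qed

lemma fps_denom_const: "c \<in> Zloc p \<Longrightarrow> fps_denom p d (fps_const c)"
  unfolding fps_denom_def using Zloc_0[OF p] by simp

lemma fps_denom_1: "fps_denom p d 1"
  using fps_denom_const[of 1 d] p by (simp add: Zloc_1)

lemma fps_denom_power: "fps_denom p d F \<Longrightarrow> fps_denom p d (F ^ n)"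
  by (induction n) (auto intro: fps_denom_mult fps_denom_1)

lemma fps_denom_prod: "(\<And>i. i \<in> A \<Longrightarrow> fps_denom p d (F i)) \<Longrightarrow> fps_denom p d (\<Prod>i\<in>A. F i)"
  by (induction A rule: infinite_finite_induct) (auto intro: fps_denom_mult fps_denom_1)

end

section \<open>Taylor expansions and partial fractions\<close>

definition lin :: "rat \<Rightarrow> rat fps" where "lin b = fps_const b + fps_X"

lemma lin_nth_0 [simp]: "fps_nth (lin b) 0 = b"
  by (simp add: lin_def)

lemma lin_0: "lin 0 = fps_X"
  by (simp add: lin_def)

definition taylor :: "rat \<Rightarrow> rat poly \<Rightarrow> rat fps" where
  "taylor c P = fps_of_poly (pcompose P [:c, 1:])"

lemma taylor_mult: "taylor c (P * Q) = taylor c P * taylor c Q"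
  and taylor_diff: "taylor c (P - Q) = taylor c P - taylor c Q"
  and taylor_sum: "taylor c (sum f A) = (\<Sum>i\<in>A. taylor c (f i))"
  and taylor_prod: "taylor c (prod f A) = (\<Prod>i\<in>A. taylor c (f i))"
  and taylor_smult: "taylor c (smult a P) = fps_const a * taylor c P"
  and taylor_1 [simp]: "taylor c 1 = 1"
  by (simp_all add: taylor_def pcompose_mult pcompose_diff pcompose_sum pcompose_prod pcompose_smult
      fps_of_poly_mult fps_of_poly_diff fps_of_poly_sum fps_of_poly_prod fps_of_poly_smult pcompose_1)

lemma taylor_power: "taylor c (P ^ n) = taylor c P ^ n"
  by (induction n) (simp_all add: taylor_mult)

lemma taylor_linear: "taylor c [:- k, 1:] = lin (c - k)"
  by (simp add: taylor_def lin_def pcompose_pCons fps_of_poly_linear add.commute)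

lemma linear_power_dvd_if_taylor:
  assumes "taylor c P = fps_X ^ n * W"
  shows "[:- c, 1:] ^ n dvd P"
proof -
  define R where "R = pcompose P [:c, 1:]"
  have "coeff R l = 0" if "l < n" for l
    using arg_cong[OF assms, of "\<lambda>F. fps_nth F l"] that
    by (simp add: taylor_def R_def fps_X_power_mult_nth)
  then have "monom 1 n dvd R" by (simp add: monom_1_dvd_iff')
  then obtain R' where "R = [:0, 1:] ^ n * R'" by (auto simp: monom_altdef dvd_def)
  then have "pcompose R [:- c, 1:] = pcompose ([:0, 1:] ^ n) [:- c, 1:] * pcompose R' [:- c, 1:]"
    by (simp only: pcompose_mult)
  moreover have "pcompose ([:0, 1:] ^ n) [:- c, 1:] = [:- c, 1:] ^ n"
    by (induction n) (simp_all add: pcompose_mult pcompose_1 pcompose_pCons)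
  moreover have "pcompose R [:- c, 1:] = P"
    unfolding R_def by (simp add: pcompose_assoc[symmetric] pcompose_pCons)
  ultimately show ?thesis by simp
qed

lemma fps_prod_nth_0: "fps_nth (prod f A) 0 = (\<Prod>i\<in>A. fps_nth (f i) 0)"
  by (induction A rule: infinite_finite_induct) simp_all

lemma prod_linear_powers_dvd:
  fixes P :: "rat poly"
  assumes "finite S" "\<And>k. k \<in> S \<Longrightarrow> [:- k, 1:] ^ n dvd P"
  shows "(\<Prod>k\<in>S. [:- k, 1:] ^ n) dvd P"
proof (cases "P = 0")
  case False
  show ?thesis using assms
  proof (induction S rule: finite_induct)
    case (insert k S)
    define D where "D = (\<Prod>k\<in>S. [:- k, 1:] ^ n)"
    obtain W where W: "P = D * W" using insert unfolding D_def dvd_def by auto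
    have "poly D k \<noteq> 0" using insert.hyps by (auto simp: D_def poly_prod)
    then have "order k D = 0" by (rule order_0I)
    then have "order k W = order k P" using False W by (simp add: order_mult)
    also have "n \<le> \<dots>" using insert False by (simp add: order_divides)
    finally have "[:- k, 1:] ^ n dvd W" by (simp add: order_divides)
    then show ?case using insert.hyps W by (simp add: D_def mult.commute mult_dvd_mono)
  qed simp
qed simp

locale pfd =
  fixes S :: "rat set" and n :: nat and P :: "rat poly"
  assumes finite_S: "finite S" and degree_P: "degree P < n * card S"
begin

definition rest :: "rat \<Rightarrow> rat poly" where
  "rest k = (\<Prod>j\<in>S - {k}. [:- j, 1:] ^ n)"

definition Glau :: "rat \<Rightarrow> rat fps" where
  "Glau k = taylor k P * inverse (taylor k (rest k))"

definition A :: "rat \<Rightarrow> nat \<Rightarrow> rat" where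
  "A k i = fps_nth (Glau k) (n - i)"

lemma taylor_rest: "taylor c (rest k) = (\<Prod>j\<in>S - {k}. lin (c - j) ^ n)"
  by (simp add: rest_def taylor_prod taylor_power taylor_linear)

lemma taylor_rest_nth_0: "fps_nth (taylor k (rest k)) 0 \<noteq> 0"
  using finite_S by (auto simp: taylor_rest fps_prod_nth_0 fps_nth_power_0)

text \<open>At a pole \<open>k\<close> the terms belonging to \<open>k\<close> reproduce the
  expansion of \<open>P\<close> up to order \<open>n\<close>, and all other terms contain the factor
  \<open>[:- k, 1:] ^ n\<close>. So the difference of the two sides is divisible by the product of
  these powers over all of \<open>S\<close>, whose degree \<open>n * card S\<close> is too large
  unless the difference is 0.\<close>

lemma decomposition: "P = (\<Sum>k\<in>S. \<Sum>i=1..n. smult (A k i) ([:- k, 1:] ^ (n - i) * rest k))"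
proof -
  define R where "R = (\<Sum>k\<in>S. \<Sum>i=1..n. smult (A k i) ([:- k, 1:] ^ (n - i) * rest k))"
  have dvd: "[:- k, 1:] ^ n dvd P - R" if k: "k \<in> S" for k
  proof -
    define H where "H = taylor k (rest k)"
    have P: "taylor k P = Glau k * H"
      unfolding Glau_def H_def using taylor_rest_nth_0[of k]
      by (simp add: mult.assoc inverse_mult_eq_1)
    have 1: "\<exists>W. taylor k (\<Sum>i=1..n. smult (A j i) ([:- j, 1:] ^ (n - i) * rest j)) = fps_X ^ n * W"
      if j: "j \<in> S - {k}" for j
    proof -
      have "rest j = [:- k, 1:] ^ n * (\<Prod>j\<in>S - {j} - {k}. [:- j, 1:] ^ n)"
        unfolding rest_def using finite_S k j by (subst prod.remove[of _ k]) auto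
      then have "taylor k (rest j) = fps_X ^ n * taylor k (\<Prod>j\<in>S - {j} - {k}. [:- j, 1:] ^ n)"
        by (simp only: taylor_mult taylor_power taylor_linear) (simp add: lin_0)
      moreover have "taylor k (\<Sum>i=1..n. smult (A j i) ([:- j, 1:] ^ (n - i) * rest j)) =
          (\<Sum>i=1..n. fps_const (A j i) * taylor k ([:- j, 1:] ^ (n - i))) * taylor k (rest j)"
        by (simp only: taylor_sum taylor_smult taylor_mult sum_distrib_right mult.assoc)
      ultimately have "taylor k (\<Sum>i=1..n. smult (A j i) ([:- j, 1:] ^ (n - i) * rest j)) = fps_X ^ n *
          ((\<Sum>i=1..n. fps_const (A j i) * taylor k ([:- j, 1:] ^ (n - i))) *
            taylor k (\<Prod>j\<in>S - {j} - {k}. [:- j, 1:] ^ n))"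
        by (simp only: mult.left_commute)
      then show ?thesis ..
    qed
    then obtain W where W: "\<And>j. j \<in> S - {k} \<Longrightarrow>
        taylor k (\<Sum>i=1..n. smult (A j i) ([:- j, 1:] ^ (n - i) * rest j)) = fps_X ^ n * W j"
      using bchoice[of "S - {k}" "\<lambda>j W. taylor k (\<Sum>i=1..n. smult (A j i) ([:- j, 1:] ^ (n - i) * rest j)) = fps_X ^ n * W"]
      by blast
    define tr where "tr = (\<Sum>i=1..n. fps_const (A k i) * fps_X ^ (n - i))"
    have 2: "taylor k (\<Sum>i=1..n. smult (A k i) ([:- k, 1:] ^ (n - i) * rest k)) = tr * H"
      by (simp only: taylor_sum taylor_smult taylor_mult taylor_power taylor_linear lin_0 tr_def H_def
          sum_distrib_right mult.assoc diff_self)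
    have tr: "fps_nth tr l = (if l < n then fps_nth (Glau k) l else 0)" for l
    proof -
      have "fps_nth tr l = (\<Sum>i=1..n. if l = n - i then A k i else 0)"
        unfolding tr_def by (auto simp: fps_sum_nth fps_X_power_iff intro!: sum.cong)
      also have "\<dots> = (\<Sum>i=1..n. if i = n - l \<and> l < n then A k i else 0)"
        by (intro sum.cong) auto
      also have "\<dots> = (if l < n then A k (n - l) else 0)" by (auto simp: sum.delta)
      finally show ?thesis by (simp add: A_def)
    qed
    have 3: "Glau k - tr = fps_X ^ n * fps_shift n (Glau k)"
      by (rule fps_ext) (auto simp: tr fps_X_power_mult_nth)
    have "taylor k R = (\<Sum>j\<in>S. taylor k (\<Sum>i=1..n. smult (A j i) ([:- j, 1:] ^ (n - i) * rest j)))"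
      by (simp add: R_def taylor_sum)
    also have "\<dots> = tr * H + (\<Sum>j\<in>S - {k}. fps_X ^ n * W j)"
      using finite_S k W 2 by (subst sum.remove[of _ k]) auto
    finally have "taylor k (P - R) = (Glau k - tr) * H - (\<Sum>j\<in>S - {k}. fps_X ^ n * W j)"
      by (simp add: taylor_diff P algebra_simps)
    also have "\<dots> = fps_X ^ n * (fps_shift n (Glau k) * H - (\<Sum>j\<in>S - {k}. W j))"
      unfolding 3 by (simp add: sum_distrib_left algebra_simps)
    finally show ?thesis by (rule linear_power_dvd_if_taylor)
  qed
  have "P - R = 0"
  proof (rule ccontr)
    assume nz: "P - R \<noteq> 0"
    have "(\<Prod>k\<in>S. [:- k, 1:] ^ n) dvd P - R" using finite_S dvd by (rule prod_linear_powers_dvd)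
    then have "degree (\<Prod>k\<in>S. [:- k, 1:] ^ n) \<le> degree (P - R)" using nz by (rule dvd_imp_degree_le)
    moreover have "degree (\<Prod>k\<in>S. [:- k, 1:] ^ n) = n * card S"
      by (subst degree_prod_eq_sum_degree) (auto simp: degree_linear_power)
    moreover have "degree R < n * card S"
    proof -
      have pos: "n * card S > 0" by (rule le_less_trans[OF le0 degree_P])
      have "degree (smult (A k i) ([:- k, 1:] ^ (n - i) * rest k)) < n * card S"
        if "k \<in> S" "i \<in> {1..n}" for k i
      proof -
        have "degree (rest k) \<le> (\<Sum>j\<in>S - {k}. n)"
          unfolding rest_def by (rule order_trans[OF degree_prod_sum_le]) (use finite_S in \<open>auto simp: degree_linear_power o_def\<close>)
        also have "\<dots> = n * (card S - 1)" using that finite_S by simp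
        finally have "degree ([:- k, 1:] ^ (n - i) * rest k) \<le> (n - i) + n * (card S - 1)"
          by (intro order_trans[OF degree_mult_le] add_mono) (auto simp: degree_linear_power)
        also have "\<dots> < n + n * (card S - 1)" using that by simp
        also have "\<dots> = n * card S" using that finite_S by (cases "card S") (auto simp: card_gt_0_iff)
        finally show ?thesis by (meson degree_smult_le le_less_trans)
      qed
      then show ?thesis unfolding R_def using pos
        by (intro degree_sum_less) auto
    qed
    ultimately show False using degree_P degree_diff_less[of P "n * card S" R] by simp
  qed
  then show ?thesis by (simp add: R_def)
qed

lemma fps_decomposition:
  assumes "c \<notin> S"
  shows "taylor c P * inverse (\<Prod>j\<in>S. lin (c - j) ^ n) =
    (\<Sum>k\<in>S. \<Sum>i=1..n. fps_const (A k i) * inverse (lin (c - k)) ^ i)"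
proof -
  have nz: "fps_nth (lin (c - j)) 0 \<noteq> 0" if "j \<in> S" for j using that assms by auto
  have inv: "lin (c - j) * inverse (lin (c - j)) = 1" if "j \<in> S" for j
    using inverse_mult_eq_1[OF nz[OF that]] by (simp add: mult.commute)
  have pinv: "(\<Prod>j\<in>B. lin (c - j) ^ n) * (\<Prod>j\<in>B. inverse (lin (c - j)) ^ n) = 1" if "B \<subseteq> S" for B
    using inv that by (auto simp flip: prod.distrib power_mult_distrib intro!: prod.neutral)
  have "inverse (\<Prod>j\<in>S. lin (c - j) ^ n) = (\<Prod>j\<in>S. inverse (lin (c - j)) ^ n)"
    by (rule fps_inverse_unique) (rule pinv, simp)
  moreover have "taylor c P * (\<Prod>j\<in>S. inverse (lin (c - j)) ^ n) =
      (\<Sum>k\<in>S. \<Sum>i=1..n. fps_const (A k i) * inverse (lin (c - k)) ^ i)"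
  proof -
    have "taylor c P * (\<Prod>j\<in>S. inverse (lin (c - j)) ^ n) =
      (\<Sum>k\<in>S. \<Sum>i=1..n. fps_const (A k i) * (lin (c - k) ^ (n - i) * (\<Prod>j\<in>S - {k}. lin (c - j) ^ n)) *
        (\<Prod>j\<in>S. inverse (lin (c - j)) ^ n))"
      by (subst decomposition) (simp add: taylor_sum taylor_smult taylor_mult taylor_power taylor_linear
          taylor_rest sum_distrib_right)
    also have "\<dots> = (\<Sum>k\<in>S. \<Sum>i=1..n. fps_const (A k i) * inverse (lin (c - k)) ^ i)"
    proof (intro sum.cong refl)
      fix k i assume k: "k \<in> S" and i: "i \<in> {1..n}"
      have "(\<Prod>j\<in>S. inverse (lin (c - j)) ^ n) = inverse (lin (c - k)) ^ n * (\<Prod>j\<in>S - {k}. inverse (lin (c - j)) ^ n)"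
        using finite_S k by (rule prod.remove)
      moreover have "inverse (lin (c - k)) ^ n = inverse (lin (c - k)) ^ (n - i) * inverse (lin (c - k)) ^ i"
        using i by (simp flip: power_add)
      ultimately have "fps_const (A k i) * (lin (c - k) ^ (n - i) * (\<Prod>j\<in>S - {k}. lin (c - j) ^ n)) *
        (\<Prod>j\<in>S. inverse (lin (c - j)) ^ n) = fps_const (A k i) * inverse (lin (c - k)) ^ i *
        ((lin (c - k) * inverse (lin (c - k))) ^ (n - i) *
          ((\<Prod>j\<in>S - {k}. lin (c - j) ^ n) * (\<Prod>j\<in>S - {k}. inverse (lin (c - j)) ^ n)))"
        by (simp add: power_mult_distrib mult_ac)
      then show "fps_const (A k i) * (lin (c - k) ^ (n - i) * (\<Prod>j\<in>S - {k}. lin (c - j) ^ n)) *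
        (\<Prod>j\<in>S. inverse (lin (c - j)) ^ n) = fps_const (A k i) * inverse (lin (c - k)) ^ i"
        using inv[OF k] pinv[of "S - {k}"] by simp
    qed
    finally show ?thesis .
  qed
  ultimately show ?thesis by simp
qed

text \<open>Comparison of the coefficients in degree \<open>n * card S - 1\<close>: only the terms
  of the simple poles reach that degree, and there they are monic. In other words, a function that
  decays faster than 1 / y has residues with sum 0.\<close>

lemma sum_residues:
  assumes "degree P + 1 < n * card S"
  shows "(\<Sum>k\<in>S. A k 1) = 0"
proof -
  have "n * card S \<noteq> 0" using degree_P by linarith
  then have n: "n \<ge> 1" and S: "card S \<ge> 1" by (simp_all add: Suc_le_eq)
  define d where "d = n * card S - 1"
  have c: "coeff ([:- k, 1:] ^ (n - i) * rest k) d = (if i = 1 then 1 else 0)"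
    if k: "k \<in> S" and i: "i \<in> {1..n}" for k i
  proof -
    define R where "R = [:- k, 1:] ^ (n - i) * rest k"
    have "lead_coeff (rest k) = 1" unfolding rest_def by (simp add: lead_coeff_prod lead_coeff_power)
    then have lc: "lead_coeff R = 1" unfolding R_def by (simp add: lead_coeff_mult lead_coeff_power)
    have "degree (rest k) = n * (card S - 1)"
      unfolding rest_def using k finite_S by (subst degree_prod_eq_sum_degree) (auto simp: degree_linear_power)
    moreover have "rest k \<noteq> 0" using \<open>lead_coeff (rest k) = 1\<close> by auto
    ultimately have "degree R = (n - i) + n * (card S - 1)"
      unfolding R_def by (subst degree_mult_eq) (auto simp: degree_linear_power)
    also have "\<dots> = n * card S - i" using i S by (cases "card S") auto
    finally have deg: "degree R = n * card S - i" .
    have iS: "i \<le> n * card S" 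

    proof -
      have "n \<le> n * card S" using S by simp
      then show ?thesis using i le_trans by (meson atLeastAtMost_iff)
    qed
    show ?thesis
    proof (cases "i = 1")
      case True
      then show ?thesis using lc deg by (simp add: R_def d_def)
    next
      case False
      then have "degree R < d" using i iS unfolding d_def deg atLeastAtMost_iff by linarith
      then show ?thesis using False by (simp add: R_def coeff_eq_0)
    qed
  qed
  have "0 = coeff P d" using assms by (simp add: d_def coeff_eq_0)
  also have "\<dots> = (\<Sum>k\<in>S. \<Sum>i=1..n. A k i * coeff ([:- k, 1:] ^ (n - i) * rest k) d)"
    by (subst decomposition) (simp add: coeff_sum)
  also have "\<dots> = (\<Sum>k\<in>S. \<Sum>i=1..n. if i = 1 then A k 1 else 0)"
    by (intro sum.cong refl) (auto simp: c)
  also have "\<dots> = (\<Sum>k\<in>S. A k 1)" using n by simp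
  finally show ?thesis by simp
qed

end

text \<open>The coefficient of X ^ e in (b + X) ^ (- i). For \<open>i = 0\<close> the truncated
  subtraction yields 1 at \<open>e = 0\<close> and 0 at \<open>e > 0\<close>, as it should.\<close>

definition lin_inverse_coeff :: "rat \<Rightarrow> nat \<Rightarrow> nat \<Rightarrow> rat" where
  "lin_inverse_coeff b i e = (- 1) ^ e * of_nat ((i + e - 1) choose e) / b ^ (i + e)"

lemma lin_inverse_power_nth:
  assumes b: "b \<noteq> 0"
  shows "fps_nth (inverse (lin b) ^ i) e = lin_inverse_coeff b i e"
proof -
  have "inverse (lin b) ^ i = Abs_fps (lin_inverse_coeff b i)"
  proof (induction i)
    case 0
    have "lin_inverse_coeff b 0 e = (if e = 0 then 1 else 0)" for e
      by (auto simp: lin_inverse_coeff_def binomial_eq_0)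
    then show ?case by (auto simp: fps_eq_iff)
  next
    case (Suc i)
    have "lin b * Abs_fps (lin_inverse_coeff b (Suc i)) = Abs_fps (lin_inverse_coeff b i)"
    proof (rule fps_ext)
      fix e
      show "fps_nth (lin b * Abs_fps (lin_inverse_coeff b (Suc i))) e = fps_nth (Abs_fps (lin_inverse_coeff b i)) e"
      proof (cases e)
        case 0
        then show ?thesis using b by (simp add: lin_def distrib_right lin_inverse_coeff_def)
      next
        case (Suc e')
        have "(i + Suc e') choose Suc e' = ((i + e') choose e') + ((i + e') choose Suc e')" by simp
        then show ?thesis using b Suc
          by (simp add: lin_def distrib_right lin_inverse_coeff_def field_simps)
      qed
    qed
    then have "inverse (lin b) * (lin b * Abs_fps (lin_inverse_coeff b (Suc i))) = inverse (lin b) ^ Suc i"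
      using Suc by simp
    then show ?case using b by (simp add: mult.assoc[symmetric] inverse_mult_eq_1)
  qed
  then show ?thesis by simp
qed

section \<open>Coefficients of products over progressions of step 2\<close>

lemma prod_lin_nth:
  assumes "finite A"
  shows "fps_nth (\<Prod>i\<in>A. lin (c i)) l = (\<Sum>B | B \<subseteq> A \<and> card B = l. \<Prod>i\<in>A - B. c i)"
proof -
  have "(\<Prod>i\<in>A. lin (c i)) = (\<Prod>i\<in>A. fps_X + fps_const (c i))" by (simp add: lin_def add.commute)
  also have "\<dots> = (\<Sum>B\<in>Pow A. (\<Prod>i\<in>B. fps_X) * (\<Prod>i\<in>A - B. fps_const (c i)))"
    by (rule prod_add[OF assms])
  also have "\<dots> = (\<Sum>B\<in>Pow A. fps_X ^ card B * fps_const (\<Prod>i\<in>A - B. c i))"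
  proof (intro sum.cong refl)
    have "(\<Prod>i\<in>D. fps_const (c i)) = fps_const (\<Prod>i\<in>D. c i)" for D
      by (induction D rule: infinite_finite_induct) simp_all
    then show "(\<Prod>i\<in>B. fps_X) * (\<Prod>i\<in>A - B. fps_const (c i)) = fps_X ^ card B * fps_const (\<Prod>i\<in>A - B. c i)" for B
      by simp
  qed
  finally have "fps_nth (\<Prod>i\<in>A. lin (c i)) l = (\<Sum>B\<in>Pow A. if l = card B then \<Prod>i\<in>A - B. c i else 0)"
    by (auto simp: fps_sum_nth fps_X_power_iff intro!: sum.cong)
  also have "\<dots> = (\<Sum>B | B \<in> Pow A \<and> l = card B. \<Prod>i\<in>A - B. c i)"
    using assms by (simp only: sum.inter_filter[symmetric] finite_Pow_iff)
  also have "{B. B \<in> Pow A \<and> l = card B} = {B. B \<subseteq> A \<and> card B = l}" by auto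
  finally show ?thesis .
qed

text \<open>Modulo the odd number \<open>q\<close> the step 2 has the inverse (q + 1) / 2, so any
  \<open>q\<close> consecutive terms of the progression contain a multiple of
  \<open>q\<close>.\<close>

lemma card_dvd_progression_ge:
  fixes a :: int and q T :: nat
  assumes q: "odd q"
  shows "T div q \<le> card {i \<in> {..<T}. int q dvd a + 2 * int i}"
proof -
  have q0: "q > 0" using q by (auto intro: gr0I)
  define i0 where "i0 = nat ((- a * ((int q + 1) div 2)) mod int q)"
  have i0: "int i0 = (- a * ((int q + 1) div 2)) mod int q" using q0 by (simp add: i0_def)
  have i0q: "i0 < q" using q0 by (simp add: i0_def nat_less_iff)
  have "odd (int q)" using q by simp
  then have "2 * ((int q + 1) div 2) = int q + 1" by presburger
  then have "a + 2 * (- a * ((int q + 1) div 2)) = - a * int q"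
    by (simp add: algebra_simps)
  then have "int q dvd a + 2 * (- a * ((int q + 1) div 2))" by simp
  moreover have "[a + 2 * int i0 = a + 2 * (- a * ((int q + 1) div 2))] (mod int q)"
    unfolding i0 by (intro cong_add cong_mult cong_refl) (simp add: cong_def)
  ultimately have d0: "int q dvd a + 2 * int i0" by (simp add: cong_dvd_iff)
  have sub: "(\<lambda>j. i0 + q * j) ` {..<T div q} \<subseteq> {i \<in> {..<T}. int q dvd a + 2 * int i}"
  proof
    fix i assume "i \<in> (\<lambda>j. i0 + q * j) ` {..<T div q}"
    then obtain j where j: "j < T div q" "i = i0 + q * j" by auto
    have "q * Suc j \<le> q * (T div q)" using j by (intro mult_le_mono2) simp
    also have "\<dots> \<le> T" by simp
    finally have "i < T" using i0q j by simp
    moreover have "a + 2 * int i = (a + 2 * int i0) + int q * (2 * int j)" using j by simp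
    then have "int q dvd a + 2 * int i" using d0 by (metis dvd_add dvd_triv_left)
    ultimately show "i \<in> {i \<in> {..<T}. int q dvd a + 2 * int i}" by simp
  qed
  have "T div q = card ((\<lambda>j. i0 + q * j) ` {..<T div q})"
    using q0 by (subst card_image) (auto simp: inj_on_def)
  also have "\<dots> \<le> card {i \<in> {..<T}. int q dvd a + 2 * int i}" by (rule card_mono[OF _ sub]) simp
  finally show ?thesis .
qed

lemma multiplicity_fact:
  assumes p: "prime (p::nat)" and H: "T < p ^ Suc H"
  shows "multiplicity p (fact T :: nat) = (\<Sum>h=1..H. T div p ^ h)"
proof -
  have "multiplicity p (fact T :: nat) = multiplicity p (\<Prod>i=1..T. i)" by (simp add: fact_prod)
  also have "\<dots> = (\<Sum>h=1..H. card {i \<in> {1..T}. p ^ h dvd i})"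
    by (rule multiplicity_prod_eq_sum_card[OF p]) (use H in auto)
  also have "\<dots> = (\<Sum>h=1..H. T div p ^ h)"
  proof (rule sum.cong)
    fix h
    have p0: "p ^ h > 0" using prime_gt_0_nat[OF p] by simp
    have "{i \<in> {1..T}. p ^ h dvd i} = (\<lambda>j. p ^ h * j) ` {1..T div p ^ h}" (is "?L = ?R")
    proof (intro equalityI subsetI)
      fix i assume i: "i \<in> ?L"
      then obtain j where j: "i = p ^ h * j" by (auto simp: dvd_def)
      then have "j \<le> T div p ^ h" using i p0 by (simp add: less_eq_div_iff_mult_less_eq mult.commute)
      moreover have "1 \<le> j" using i j by (cases j) auto
      ultimately show "i \<in> ?R" using j by (intro image_eqI[of _ _ j]) auto
    next
      fix i assume "i \<in> ?R"
      then obtain j where "j \<in> {1..T div p ^ h}" "i = p ^ h * j" by blast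
      then have j: "i = p ^ h * j" "1 \<le> j" "j \<le> T div p ^ h" by simp_all
      then have "i \<le> T" using p0 by (simp add: less_eq_div_iff_mult_less_eq mult.commute)
      then show "i \<in> ?L" using j p0 by (simp add: Suc_le_eq)
    qed
    then have "card {i \<in> {1..T}. p ^ h dvd i} = card ((\<lambda>j. p ^ h * j) ` {1..T div p ^ h})" by simp
    also have "\<dots> = T div p ^ h" using p0 by (subst card_image) (auto simp: inj_on_def)
    finally show "card {i \<in> {1..T}. p ^ h dvd i} = T div p ^ h" .
  qed simp
  finally show ?thesis .
qed

lemma multiplicity_int_of_nat:
  assumes p: "prime p"
  shows "multiplicity (int p) (int n) = multiplicity p n"
proof (cases "n = 0")
  case False
  have nu: "\<not> is_unit p" "\<not> is_unit (int p)" using p by auto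
  have "p ^ multiplicity (int p) (int n) dvd n"
    using multiplicity_dvd[of "int p" "int n"] by (simp only: of_nat_power[symmetric] int_dvd_int_iff)
  moreover have "int p ^ multiplicity p n dvd int n"
    using multiplicity_dvd[of p n] by (simp only: of_nat_power[symmetric] int_dvd_int_iff)
  ultimately show ?thesis
    by (intro antisym multiplicity_geI) (use nu False in simp_all)
qed simp

lemma Zloc_frac_nat:
  assumes p: "prime p" and "a \<noteq> 0" "b \<noteq> 0" "multiplicity p b \<le> multiplicity p a"
  shows "of_nat a / of_nat b \<in> Zloc p"
  using Zloc_frac[OF p, of "int a" "int b"] assms by (simp add: multiplicity_int_of_nat)

text \<open>For each \<open>h\<close> with \<open>p ^ h \<le> T\<close> the progression has at least
  as many multiples of \<open>p ^ h\<close> as 1, ..., \<open>T\<close> have, and deleting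
  \<open>B\<close> removes at most \<open>card B\<close> of them. By \<open>dT\<close> there are at
  most \<open>multiplicity p d\<close> such \<open>h \<ge> 1\<close>.\<close>

lemma multiplicity_fact_le_deleted_product:
  fixes a :: int and p d T :: nat
  assumes p: "prime p" "p \<noteq> 2" and a: "odd a" and B: "B \<subseteq> {..<T}" and d: "d > 0"
    and dT: "\<And>h. p ^ h \<le> T \<Longrightarrow> p ^ h dvd d"
  shows "multiplicity p (fact T :: nat) \<le>
    multiplicity p (\<Prod>i\<in>{..<T} - B. nat \<bar>a + 2 * int i\<bar>) + card B * multiplicity p d"
proof -
  define c where "c i = nat \<bar>a + 2 * int i\<bar>" for i
  define H where "H = T + (\<Sum>i<T. c i)"
  have pH: "n < p ^ Suc H" if "n \<le> H" for n
  proof -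
    have "n < 2 ^ Suc H" using that less_exp[of "Suc H"] by linarith
    also have "\<dots> \<le> p ^ Suc H" using prime_ge_2_nat[OF p(1)] by (intro power_mono) auto
    finally show ?thesis .
  qed
  have cH: "c i \<le> H" if "i < T" for i
    using member_le_sum[of i "{..<T}" c] that by (simp add: H_def)
  have c0: "c i > 0" for i using a by (simp add: c_def) presburger
  have fB: "finite B" using B finite_subset by blast
  have "multiplicity p (fact T :: nat) = (\<Sum>h=1..H. T div p ^ h)"
    by (rule multiplicity_fact[OF p(1) pH]) (simp add: H_def)
  also have "\<dots> \<le> (\<Sum>h=1..H. card {i \<in> {..<T} - B. p ^ h dvd c i} + card B * (if p ^ h \<le> T then 1 else 0))"
  proof (rule sum_mono)
    fix h assume h: "h \<in> {1..H}"
    show "T div p ^ h \<le> card {i \<in> {..<T} - B. p ^ h dvd c i} + card B * (if p ^ h \<le> T then 1 else 0)"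
    proof (cases "p ^ h \<le> T")
      case True
      have "odd p" using p prime_odd_nat[of p] prime_ge_2_nat[of p] by linarith
      then have "odd (p ^ h)" by simp
      have "(p ^ h dvd c i) = (int (p ^ h) dvd a + 2 * int i)" for i
      proof -
        have "int (p ^ h) dvd int (c i) \<longleftrightarrow> int (p ^ h) dvd \<bar>a + 2 * int i\<bar>" by (simp only: c_def int_nat_eq abs_ge_zero if_True)
        then show ?thesis by (simp only: int_dvd_int_iff dvd_abs_iff)
      qed
      then have "T div p ^ h \<le> card {i \<in> {..<T}. p ^ h dvd c i}"
        using card_dvd_progression_ge[OF \<open>odd (p ^ h)\<close>, of T a] by simp
      also have "\<dots> \<le> card ({i \<in> {..<T} - B. p ^ h dvd c i} \<union> B)"
        using fB by (intro card_mono) auto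
      also have "\<dots> \<le> card {i \<in> {..<T} - B. p ^ h dvd c i} + card B" by (rule card_Un_le)
      finally show ?thesis using True by simp
    qed (simp add: div_less)
  qed
  also have "\<dots> = (\<Sum>h=1..H. card {i \<in> {..<T} - B. p ^ h dvd c i}) + card B * card {h \<in> {1..H}. p ^ h \<le> T}"
    by (simp add: sum.distrib sum_distrib_left[symmetric] flip: sum.inter_filter)
  also have "(\<Sum>h=1..H. card {i \<in> {..<T} - B. p ^ h dvd c i}) = multiplicity p (\<Prod>i\<in>{..<T} - B. c i)"
    by (rule multiplicity_prod_eq_sum_card[OF p(1), symmetric]) (use c0 cH pH in auto)
  also have "card {h \<in> {1..H}. p ^ h \<le> T} \<le> multiplicity p d"
  proof -
    have nu: "\<not> is_unit p" using p by auto
    have "{h \<in> {1..H}. p ^ h \<le> T} \<subseteq> {1..multiplicity p d}"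
    proof
      fix h assume "h \<in> {h \<in> {1..H}. p ^ h \<le> T}"
      then have "p ^ h dvd d" "1 \<le> h" using dT by auto
      moreover have "h \<le> multiplicity p d" by (rule multiplicity_geI) (use \<open>p ^ h dvd d\<close> d nu in simp_all)
      ultimately show "h \<in> {1..multiplicity p d}" by simp
    qed
    then have "card {h \<in> {1..H}. p ^ h \<le> T} \<le> card {1..multiplicity p d}" by (intro card_mono) auto
    then show ?thesis by simp
  qed
  finally show ?thesis unfolding c_def by simp
qed

text \<open>A substitute for the integrality of binomial coefficients and of their derivatives: the
  coefficient of order \<open>l\<close> is the sum of all products with \<open>l\<close> factors
  deleted, and each deleted factor costs at most one \<open>d\<close>.\<close>

lemma fps_denom_odd_progression:
  fixes a :: int and p d T :: nat
  assumes p: "prime p" "p \<noteq> 2" and a: "odd a" and d: "d > 0"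
    and dT: "\<And>h. p ^ h \<le> T \<Longrightarrow> p ^ h dvd d"
  shows "fps_denom p d (fps_const (1 / fact T) * (\<Prod>i<T. lin (of_int (a + 2 * int i))))"
  unfolding fps_denom_def
proof
  fix l
  have "of_nat d ^ l * fps_nth (fps_const (1 / fact T) * (\<Prod>i<T. lin (of_int (a + 2 * int i)))) l =
    (\<Sum>B | B \<subseteq> {..<T} \<and> card B = l. of_nat d ^ l * (\<Prod>i\<in>{..<T} - B. of_int (a + 2 * int i)) / fact T)"
    by (simp add: prod_lin_nth sum_distrib_left mult_ac flip: sum_divide_distrib)
  also have "\<dots> \<in> Zloc p"
  proof (rule Zloc_sum[OF p(1)])
    fix B assume "B \<in> {B. B \<subseteq> {..<T} \<and> card B = l}"
    then have B: "B \<subseteq> {..<T}" "card B = l" by auto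
    define P where "P = (\<Prod>i\<in>{..<T} - B. a + 2 * int i)"
    have nz: "a + 2 * int i \<noteq> 0" for i using a by presburger
    have P0: "P \<noteq> 0" using nz by (simp add: P_def)
    have "nat \<bar>P\<bar> = (\<Prod>i\<in>{..<T} - B. nat \<bar>a + 2 * int i\<bar>)"
    proof -
      have "int (nat \<bar>P\<bar>) = (\<Prod>i\<in>{..<T} - B. int (nat \<bar>a + 2 * int i\<bar>))"
        by (simp only: int_nat_eq abs_ge_zero if_True) (simp only: P_def abs_prod)
      then show ?thesis by (simp only: of_nat_prod[symmetric] of_nat_eq_iff)
    qed
    then have "multiplicity p (fact T :: nat) \<le> multiplicity p (nat \<bar>P\<bar>) + l * multiplicity p d"
      using multiplicity_fact_le_deleted_product[OF p a B(1) d dT] B(2) by simp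
    also have "\<dots> = multiplicity p (d ^ l * nat \<bar>P\<bar>)"
      using p(1) P0 d by (subst prime_elem_multiplicity_mult_distrib) (auto simp: prime_elem_multiplicity_power_distrib)
    finally have "multiplicity (int p) (int (fact T)) \<le> multiplicity (int p) (int (d ^ l * nat \<bar>P\<bar>))"
      by (simp only: multiplicity_int_of_nat[OF p(1)])
    also have "\<dots> = multiplicity (int p) (int d ^ l * P)"
    proof -
      have "int (d ^ l * nat \<bar>P\<bar>) = \<bar>int d ^ l * P\<bar>" by (simp add: abs_mult)
      then show ?thesis using multiplicity_normalize_right[of "int p" "int d ^ l * P"] by simp
    qed
    finally have "of_int (int d ^ l * P) / of_int (int (fact T)) \<in> Zloc p"
      using P0 d by (intro Zloc_frac p) auto
    then show "of_nat d ^ l * (\<Prod>i\<in>{..<T} - B. of_int (a + 2 * int i)) / fact T \<in> Zloc p"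
      by (simp add: P_def)
  qed
  finally show "of_nat d ^ l * fps_nth (fps_const (1 / fact T) * (\<Prod>i<T. lin (of_int (a + 2 * int i)))) l \<in> Zloc p" .
qed

section \<open>Volkenborn means\<close>

lemma abs2_rat_le_1_if_Zloc:
  assumes "x \<in> Zloc 2"
  shows "abs2_rat x \<le> 1"
proof (cases "x = 0")
  case False
  obtain a b :: int where ab: "\<not> int 2 dvd b" "x = of_int a / of_int b" using assms unfolding Zloc_def by blast
  then have "a \<noteq> 0" "b \<noteq> 0" "\<not> 2 dvd b" using False by auto
  then have "val2_rat x \<ge> 0" using ab by (simp add: val2_rat_divide not_dvd_imp_multiplicity_0)
  then show ?thesis using False by (simp add: abs2_rat_def power_int_minus power_int_def field_simps)
qed simp

lemma abs2_rat_odd: "odd k \<Longrightarrow> abs2_rat (of_int k) = 1"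
  using val2_rat_divide[of k 1] by (auto simp: abs2_rat_def not_dvd_imp_multiplicity_0)

lemma abs2_rat_power: "abs2_rat (x ^ n) = abs2_rat x ^ n"
  by (induction n) (simp_all add: abs2_rat_mult)

lemma abs2_rat_2: "abs2_rat 2 = 1 / 2"
  using val2_rat_divide[of 2 1] by (simp add: abs2_rat_def power_int_minus)

lemma abs2_rat_divide: "abs2_rat (x / y) = abs2_rat x / abs2_rat y"
  by (simp add: divide_inverse abs2_rat_mult abs2_rat_inverse)

lemma abs2_rat_of_int: "abs2_rat (of_int k) \<le> 1"
  by (rule abs2_rat_le_1_if_Zloc) (simp add: Zloc_of_int)

lemma abs2_rat_of_int_dvd:
  assumes "2 ^ L dvd k"
  shows "abs2_rat (of_int k) \<le> (1 / 2) ^ L"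
proof -
  obtain c where "k = 2 ^ L * c" using assms by (rule dvdE)
  then have "abs2_rat (of_int k) = (1 / 2) ^ L * abs2_rat (of_int c)"
    by (simp add: abs2_rat_mult abs2_rat_power abs2_rat_2)
  also have "\<dots> \<le> (1 / 2) ^ L * 1" by (intro mult_left_mono abs2_rat_of_int) simp
  finally show ?thesis by simp
qed

lemma abs2_rat_sum_le:
  assumes "\<And>i. i \<in> A \<Longrightarrow> abs2_rat (f i) \<le> e" "0 \<le> e"
  shows "abs2_rat (sum f A) \<le> e"
  using assms
proof (induction A rule: infinite_finite_induct)
  case (insert x A)
  have "abs2_rat (f x + sum f A) \<le> max (abs2_rat (f x)) (abs2_rat (sum f A))" by (rule abs2_rat_add)
  then show ?case using insert by force
qed simp_all

section \<open>Finite averages of integer polynomials\<close>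

definition vmean :: "nat \<Rightarrow> (int \<Rightarrow> rat) \<Rightarrow> rat" where
  "vmean M F = (\<Sum>k<2 ^ M. F (int k)) / 2 ^ M"

lemma vmean_diff: "vmean M (\<lambda>t. F t - G t) = vmean M F - vmean M G"
  and vmean_scale: "vmean M (\<lambda>t. c * F t) = c * vmean M F"
  and vmean_sum: "vmean M (\<lambda>t. \<Sum>i\<in>A. H i t) = (\<Sum>i\<in>A. vmean M (H i))"
  by (simp_all add: vmean_def sum.distrib sum_subtractf add_divide_distrib diff_divide_distrib
      sum_distrib_left sum_divide_distrib sum.swap[of _ A])

lemma abs2_vmean_le:
  assumes "\<And>t. abs2_rat (F t) \<le> (1 / 2) ^ (L + M)"
  shows "abs2_rat (vmean M F) \<le> (1 / 2) ^ L"
proof -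
  have "abs2_rat (\<Sum>k<2 ^ M. F (int k)) \<le> (1 / 2) ^ (L + M)"
    by (rule abs2_rat_sum_le) (use assms in auto)
  then show ?thesis
    by (simp add: vmean_def abs2_rat_divide abs2_rat_power abs2_rat_2 power_add field_simps)
qed

lemma poly_taylor_cong:
  fixes q :: "int poly"
  shows "\<exists>c. poly q (x + h) = poly q x + h * poly (pderiv q) x + h * h * c"
proof (induction q)
  case (pCons a q)
  then obtain c where c: "poly q (x + h) = poly q x + h * poly (pderiv q) x + h * h * c" by blast
  have "poly (pCons a q) (x + h) = poly (pCons a q) x + h * poly (pderiv (pCons a q)) x
      + h * h * (poly (pderiv q) x + x * c + h * c)"
    unfolding pderiv_pCons poly_pCons poly_add c by (simp add: algebra_simps)
  then show ?case by blast
qed simp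

lemma sum_lessThan_double:
  fixes g :: "nat \<Rightarrow> 'a :: comm_monoid_add"
  shows "sum g {..<2 * h} = (\<Sum>k<h. g k) + (\<Sum>k<h. g (k + h))"
proof -
  have "sum g {..<2 * h} = sum g {0..<h} + sum g {h..<h + h}"
    by (simp add: sum.atLeastLessThan_concat mult_2 lessThan_atLeast0)
  also have "sum g {h..<h + h} = (\<Sum>k<h. g (k + h))"
    using sum.shift_bounds_nat_ivl[of g 0 h h] by (simp add: lessThan_atLeast0)
  finally show ?thesis by (simp add: lessThan_atLeast0)
qed

text \<open>Doubling the range adds a copy of the sum translated by 2 ^ M, which agrees with the sum
  modulo 2 ^ M. The factor 2 in front is genuine: the means of \<open>t\<close> tend to -1/2. It
  corresponds to 2 dividing denominators of Bernoulli numbers at most once.\<close>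

lemma dvd_twice_sum_poly:
  fixes q :: "int poly"
  shows "2 ^ M dvd 2 * (\<Sum>k<2 ^ M. poly q (int k))"
proof (induction M)
  case (Suc M)
  define h :: nat where "h = 2 ^ M"
  have "int h dvd (\<Sum>k<h. poly q (int (k + h)) - poly q (int k))"
  proof (rule dvd_sum)
    fix k
    obtain c where "poly q (int k + int h) = poly q (int k) + int h * poly (pderiv q) (int k) + int h * int h * c"
      using poly_taylor_cong by blast
    then have "poly q (int (k + h)) - poly q (int k) = int h * (poly (pderiv q) (int k) + int h * c)"
      by (simp add: algebra_simps)
    then show "int h dvd poly q (int (k + h)) - poly q (int k)" by simp
  qed
  then have 1: "2 * int h dvd 2 * (\<Sum>k<h. poly q (int (k + h)) - poly q (int k))"
    by (rule mult_dvd_mono[OF dvd_refl])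
  have 2: "2 * int h dvd 2 * (2 * (\<Sum>k<h. poly q (int k)))"
    using Suc by (intro mult_dvd_mono) (simp_all add: h_def)
  have "2 * (\<Sum>k<2 ^ Suc M. poly q (int k)) = 2 * (\<Sum>k<2 * h. poly q (int k))" by (simp add: h_def)
  also have "\<dots> = 2 * (\<Sum>k<h. poly q (int (k + h)) - poly q (int k)) + 2 * (2 * (\<Sum>k<h. poly q (int k)))"
    unfolding sum_lessThan_double by (simp add: sum_subtractf)
  finally show ?case using dvd_add[OF 1 2] by (simp add: h_def)
qed simp

definition ipoly :: "int poly \<Rightarrow> int \<Rightarrow> rat" where "ipoly q t = of_int (poly q t)"

lemma abs2_vmean_ipoly: "abs2_rat (vmean M (ipoly q)) \<le> 2"
proof -
  obtain c where c: "2 * (\<Sum>k<2 ^ M. poly q (int k)) = 2 ^ M * c" using dvd_twice_sum_poly by (rule dvdE)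
  have "2 * vmean M (ipoly q) = of_int (2 * (\<Sum>k<2 ^ M. poly q (int k))) / 2 ^ M"
    by (simp add: vmean_def ipoly_def)
  also have "\<dots> = of_int c" unfolding c by simp
  finally have "abs2_rat (2 * vmean M (ipoly q)) \<le> 1" by (simp add: abs2_rat_of_int)
  then show ?thesis by (simp add: abs2_rat_mult abs2_rat_2)
qed

lemma abs2_sum_ipoly: "abs2_rat (\<Sum>k<2 ^ M. ipoly q (int k)) \<le> 2 * (1 / 2) ^ M"
proof -
  have "(\<Sum>k<2 ^ M. ipoly q (int k)) = 2 ^ M * vmean M (ipoly q)" by (simp add: vmean_def)
  then have "abs2_rat (\<Sum>k<2 ^ M. ipoly q (int k)) = (1 / 2) ^ M * abs2_rat (vmean M (ipoly q))"
    by (simp add: abs2_rat_mult abs2_rat_power abs2_rat_2)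
  also have "\<dots> \<le> (1 / 2) ^ M * 2" by (intro mult_left_mono abs2_vmean_ipoly) simp
  finally show ?thesis by simp
qed

lemma ipoly_taylor_sum:
  fixes h :: nat and e :: int
  shows "\<exists>c. (\<Sum>k<h. ipoly q (int k + e)) = (\<Sum>k<h. ipoly q (int k)) + of_int e * (\<Sum>k<h. ipoly (pderiv q) (int k))
    + of_int e * of_int e * of_int c"
proof -
  obtain c where c: "\<And>k. poly q (int k + e) = poly q (int k) + e * poly (pderiv q) (int k) + e * e * c k"
    using choice[of "\<lambda>k c. poly q (int k + e) = poly q (int k) + e * poly (pderiv q) (int k) + e * e * c"] poly_taylor_cong
    by blast
  have "(\<Sum>k<h. ipoly q (int k + e)) = (\<Sum>k<h. ipoly q (int k)) + of_int e * (\<Sum>k<h. ipoly (pderiv q) (int k))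
    + of_int e * of_int e * of_int (\<Sum>k<h. c k)"
    by (simp add: ipoly_def c sum.distrib sum_distrib_left)
  then show ?thesis by blast
qed

lemma abs2_rat_add_le: "abs2_rat x \<le> e \<Longrightarrow> abs2_rat y \<le> e \<Longrightarrow> abs2_rat (x + y) \<le> e"
  using abs2_rat_add[of x y] by simp

text \<open>Taylor expansion with increment 2 ^ M: the linear term is half the sum of
  \<open>pderiv q\<close> over 2 ^ M points, which is itself of size O(2 ^ (- M)).\<close>

lemma vmean_ipoly_step: "abs2_rat (vmean (Suc M) (ipoly q) - vmean M (ipoly q)) \<le> 4 * (1 / 2) ^ M"
proof -
  define h :: nat where "h = 2 ^ M"
  have h: "(2::rat) ^ M = of_nat h" by (simp add: h_def)
  obtain c where c: "(\<Sum>k<h. ipoly q (int k + int h)) = (\<Sum>k<h. ipoly q (int k)) + of_int (int h) * (\<Sum>k<h. ipoly (pderiv q) (int k))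
    + of_int (int h) * of_int (int h) * of_int c"
    using ipoly_taylor_sum by blast
  have "(\<Sum>k<2 * h. ipoly q (int k)) = 2 * (\<Sum>k<h. ipoly q (int k)) + of_nat h * (\<Sum>k<h. ipoly (pderiv q) (int k))
    + of_nat h * of_nat h * of_int c"
    unfolding sum_lessThan_double using c by simp
  moreover have "(of_nat h :: rat) \<noteq> 0" by (simp add: h_def)
  ultimately have "vmean (Suc M) (ipoly q) - vmean M (ipoly q) = (\<Sum>k<h. ipoly (pderiv q) (int k)) / 2 + of_nat h * of_int c / 2"
    unfolding vmean_def power_Suc by (simp add: h h_def[symmetric] field_simps)
  moreover have "abs2_rat ((\<Sum>k<h. ipoly (pderiv q) (int k)) / 2) \<le> 4 * (1 / 2) ^ M"
    using abs2_sum_ipoly[of "pderiv q" M] by (simp add: h_def abs2_rat_divide abs2_rat_2)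
  moreover have "abs2_rat (of_nat h * of_int c / 2) \<le> 4 * (1 / 2) ^ M"
  proof -
    have "abs2_rat (of_nat h * of_int c / 2) = 2 * (1 / 2) ^ M * abs2_rat (of_int c)"
      by (simp add: h_def abs2_rat_divide abs2_rat_mult abs2_rat_power abs2_rat_2)
    also have "\<dots> \<le> 2 * (1 / 2) ^ M * 1" by (intro mult_left_mono abs2_rat_of_int) simp
    also have "\<dots> \<le> 4 * (1 / 2) ^ M" by simp
    finally show ?thesis .
  qed
  ultimately show ?thesis using abs2_rat_add_le by metis
qed

text \<open>Reversing the order of summation turns \<open>- 1 - k\<close> into
  \<open>k - 2 ^ M\<close>, so the reflection becomes a translation by 2 ^ M, again treated by
  Taylor expansion.\<close>

lemma vmean_ipoly_reflect: "abs2_rat (vmean M (\<lambda>t. ipoly q (- 1 - t)) - vmean M (ipoly q)) \<le> 4 * (1 / 2) ^ M"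
proof -
  define h :: nat where "h = 2 ^ M"
  have h: "(2::rat) ^ M = of_nat h" and h0: "(of_nat h :: rat) \<noteq> 0" by (simp_all add: h_def)
  have "(\<Sum>k<h. ipoly q (- 1 - int k)) = (\<Sum>k<h. ipoly q (int k + (- int h)))"
    by (subst sum.nat_diff_reindex[symmetric]) (auto intro!: sum.cong arg_cong[of _ _ "ipoly q"])
  moreover obtain c where "(\<Sum>k<h. ipoly q (int k + (- int h))) = (\<Sum>k<h. ipoly q (int k)) + of_int (- int h) * (\<Sum>k<h. ipoly (pderiv q) (int k))
    + of_int (- int h) * of_int (- int h) * of_int c"
    using ipoly_taylor_sum by blast
  ultimately have "vmean M (\<lambda>t. ipoly q (- 1 - t)) - vmean M (ipoly q) = (- (\<Sum>k<h. ipoly (pderiv q) (int k))) + of_nat h * of_int c"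
    using h0 unfolding vmean_def by (simp add: h h_def[symmetric] field_simps)
  moreover have "abs2_rat (- (\<Sum>k<h. ipoly (pderiv q) (int k))) \<le> 4 * (1 / 2) ^ M"
  proof -
    have "2 * (1 / 2 :: real) ^ M \<le> 4 * (1 / 2) ^ M" by simp
    then show ?thesis using abs2_sum_ipoly[of "pderiv q" M] unfolding h_def abs2_rat_minus by linarith
  qed
  moreover have "abs2_rat (of_nat h * of_int c) \<le> 4 * (1 / 2) ^ M"
  proof -
    have "abs2_rat (of_nat h * of_int c) = (1 / 2) ^ M * abs2_rat (of_int c)"
      by (simp add: h_def abs2_rat_mult abs2_rat_power abs2_rat_2)
    also have "\<dots> \<le> (1 / 2) ^ M * 1" by (intro mult_left_mono abs2_rat_of_int) simp
    also have "\<dots> \<le> 4 * (1 / 2) ^ M" by simp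
    finally show ?thesis by simp
  qed
  ultimately show ?thesis using abs2_rat_add_le by metis
qed

lemma vmean_shift: "vmean M (\<lambda>t. F (t + 1)) - vmean M F = (F (2 ^ M) - F 0) / 2 ^ M"
proof -
  have "(\<Sum>k<n. F (int k + 1)) - (\<Sum>k<n. F (int k)) = F (int n) - F 0" for n
    by (induction n) (simp_all add: algebra_simps)
  from this[of "2 ^ M"] show ?thesis by (simp add: vmean_def flip: diff_divide_distrib)
qed

section \<open>Functions approximable together with their derivative\<close>

lemma half_power_le: "m \<le> n \<Longrightarrow> (1 / 2 :: real) ^ n \<le> (1 / 2) ^ m"
  by (rule power_decreasing) simp_all

lemma abs2_rat_add3_le:
  assumes "abs2_rat x \<le> e" "abs2_rat y \<le> e" "abs2_rat z \<le> e"
  shows "abs2_rat (x + (y + - z)) \<le> e"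
  using assms by (intro abs2_rat_add_le) (simp_all only: abs2_rat_minus)

text \<open>A form of strict differentiability adapted to averages: at every 2-adic precision one
  integer polynomial approximates \<open>F\<close> uniformly on the integers while its derivative
  approximates \<open>F'\<close>. The precision may be chosen after the level \<open>M\<close>,
  which offsets the division by 2 ^ M.\<close>

definition vapp :: "(int \<Rightarrow> rat) \<Rightarrow> (int \<Rightarrow> rat) \<Rightarrow> bool" where
  "vapp F F' \<longleftrightarrow> (\<forall>L. \<exists>q. \<forall>t. abs2_rat (F t - ipoly q t) \<le> (1 / 2) ^ L \<and> abs2_rat (F' t - ipoly (pderiv q) t) \<le> (1 / 2) ^ L)"

lemma vapp_vmean:
  assumes "vapp F F'"
  obtains q where "\<And>t. abs2_rat (F t - ipoly q t) \<le> (1 / 2) ^ (L + M)"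
    "\<And>t. abs2_rat (F' t - ipoly (pderiv q) t) \<le> (1 / 2) ^ (L + M)"
    "\<And>M'. M' \<le> M \<Longrightarrow> abs2_rat (vmean M' F - vmean M' (ipoly q)) \<le> (1 / 2) ^ L"
    "\<And>M'. M' \<le> M \<Longrightarrow> abs2_rat (vmean M' (\<lambda>t. F (- 1 - t)) - vmean M' (\<lambda>t. ipoly q (- 1 - t))) \<le> (1 / 2) ^ L"
proof -
  obtain q where q: "\<And>t. abs2_rat (F t - ipoly q t) \<le> (1 / 2) ^ (L + M)"
    "\<And>t. abs2_rat (F' t - ipoly (pderiv q) t) \<le> (1 / 2) ^ (L + M)"
    using assms unfolding vapp_def by blast
  have le: "abs2_rat (F t - ipoly q t) \<le> (1 / 2) ^ (L + M')" if "M' \<le> M" for t M'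
    by (rule order_trans[OF q(1)[of t] half_power_le]) (use that in simp)
  show thesis
    using that[OF q] abs2_vmean_le[of "\<lambda>t. F t - ipoly q t", OF le] abs2_vmean_le[of "\<lambda>t. F (- 1 - t) - ipoly q (- 1 - t)", OF le]
    by (simp add: vmean_diff)
qed

lemma vapp_step:
  assumes "vapp F F'"
  shows "abs2_rat (vmean (Suc M) F - vmean M F) \<le> 4 * (1 / 2) ^ M"
proof -
  obtain q where q: "\<And>M'. M' \<le> Suc M \<Longrightarrow> abs2_rat (vmean M' F - vmean M' (ipoly q)) \<le> (1 / 2) ^ M"
    using vapp_vmean[OF assms] by metis
  have "vmean (Suc M) F - vmean M F = (vmean (Suc M) F - vmean (Suc M) (ipoly q)) +
    ((vmean (Suc M) (ipoly q) - vmean M (ipoly q)) + - (vmean M F - vmean M (ipoly q)))" by simp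
  moreover have e: "(1 / 2 :: real) ^ M \<le> 4 * (1 / 2) ^ M" by simp
  ultimately show ?thesis
    by (simp only:) (intro abs2_rat_add3_le order_trans[OF q e] vmean_ipoly_step; simp)
qed

lemma vapp_reflect:
  assumes "vapp F F'"
  shows "abs2_rat (vmean M (\<lambda>t. F (- 1 - t)) - vmean M F) \<le> 4 * (1 / 2) ^ M"
proof -
  obtain q where q: "abs2_rat (vmean M F - vmean M (ipoly q)) \<le> (1 / 2) ^ M"
    "abs2_rat (vmean M (\<lambda>t. F (- 1 - t)) - vmean M (\<lambda>t. ipoly q (- 1 - t))) \<le> (1 / 2) ^ M"
    using vapp_vmean[OF assms] by (metis order_refl)
  have "vmean M (\<lambda>t. F (- 1 - t)) - vmean M F = (vmean M (\<lambda>t. F (- 1 - t)) - vmean M (\<lambda>t. ipoly q (- 1 - t))) +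
    ((vmean M (\<lambda>t. ipoly q (- 1 - t)) - vmean M (ipoly q)) + - (vmean M F - vmean M (ipoly q)))" by simp
  moreover have e: "(1 / 2 :: real) ^ M \<le> 4 * (1 / 2) ^ M" by simp
  ultimately show ?thesis
    by (simp only:) (intro abs2_rat_add3_le order_trans[OF q(1) e] order_trans[OF q(2) e] vmean_ipoly_reflect)
qed

text \<open>The Volkenborn integral is not translation invariant: the difference telescopes to the
  quotient (F (2 ^ M) - F 0) / 2 ^ M, which tends to the derivative at 0.\<close>

lemma vapp_shift:
  assumes "vapp F F'"
  shows "abs2_rat (vmean M (\<lambda>t. F (t + 1)) - vmean M F - F' 0) \<le> (1 / 2) ^ M"
proof -
  \<comment> \<open>Precision 2 M, as the difference quotient loses M of it.\<close>
  obtain q where q: "\<And>t. abs2_rat (F t - ipoly q t) \<le> (1 / 2) ^ (M + M)"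
    "\<And>t. abs2_rat (F' t - ipoly (pderiv q) t) \<le> (1 / 2) ^ (M + M)"
    using vapp_vmean[OF assms] by metis
  obtain c where c: "poly q (0 + 2 ^ M) = poly q 0 + 2 ^ M * poly (pderiv q) 0 + 2 ^ M * 2 ^ M * c"
    using poly_taylor_cong by blast
  have e: "abs2_rat ((F t - ipoly q t) / 2 ^ M) \<le> (1 / 2) ^ M" for t
    using q(1)[of t] by (simp add: abs2_rat_divide abs2_rat_power abs2_rat_2 power_add field_simps)
  have "(F (2 ^ M) - F 0) / 2 ^ M - F' 0 = (F (2 ^ M) - ipoly q (2 ^ M)) / 2 ^ M + (- ((F 0 - ipoly q 0) / 2 ^ M) +
    (of_int (2 ^ M * c) + - (F' 0 - ipoly (pderiv q) 0)))"
    using c by (simp add: ipoly_def field_simps)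
  moreover have "abs2_rat (of_int (2 ^ M * c)) \<le> (1 / 2) ^ M" by (rule abs2_rat_of_int_dvd) simp
  moreover have le: "(1 / 2 :: real) ^ (M + M) \<le> (1 / 2) ^ M" by (rule half_power_le) simp
  moreover have "abs2_rat (- ((F 0 - ipoly q 0) / 2 ^ M)) \<le> (1 / 2) ^ M" using e[of 0] by (simp only: abs2_rat_minus)
  ultimately show ?thesis unfolding vmean_shift
    by (simp only:) (intro abs2_rat_add_le[OF e] abs2_rat_add_le[of "- _"] abs2_rat_add3_le[where y = 0, simplified] order_trans[OF q(2) le]
      abs2_rat_add_le[of "of_int _"]; simp only: abs2_rat_minus order_trans[OF q(2) le])
qed

lemma null2I_half_power:
  assumes "\<And>M. abs2_rat (X M) \<le> 4 * (1 / 2) ^ M"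
  shows "null2 X"
  unfolding null2_def
proof (intro allI impI)
  fix e :: real assume "e > 0"
  then obtain K where K: "(1 / 2) ^ K < e / 4" using real_arch_pow_inv[of "e / 4" "1 / 2"] by auto
  show "\<exists>K. \<forall>n\<ge>K. abs2_rat (X n) < e"
  proof (intro exI allI impI)
    fix n assume "n \<ge> K"
    then show "abs2_rat (X n) < e" using assms[of n] K half_power_le[of K n] by linarith
  qed
qed

lemma cauchy2I_half_power:
  assumes "\<And>M. abs2_rat (X (Suc M) - X M) \<le> 4 * (1 / 2) ^ M"
  shows "cauchy2 X"
  unfolding cauchy2_def
proof (intro allI impI)
  fix e :: real assume "e > 0"
  then obtain K where K: "(1 / 2) ^ K < e / 4" using real_arch_pow_inv[of "e / 4" "1 / 2"] by auto
  have *: "abs2_rat (X (K + i) - X K) \<le> 4 * (1 / 2) ^ K" for i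
  proof (induction i)
    case (Suc i)
    have "abs2_rat (X (Suc (K + i)) - X (K + i)) \<le> 4 * (1 / 2) ^ K"
      using assms[of "K + i"] half_power_le[of K "K + i"] by linarith
    then have "abs2_rat ((X (Suc (K + i)) - X (K + i)) + (X (K + i) - X K)) \<le> 4 * (1 / 2) ^ K"
      using Suc by (rule abs2_rat_add_le)
    then show ?case by simp
  qed simp
  show "\<exists>K. \<forall>m\<ge>K. \<forall>n\<ge>K. abs2_rat (X m - X n) < e"
  proof (intro exI allI impI)
    fix m n assume "K \<le> m" "K \<le> n"
    then obtain a b where "m = K + a" "n = K + b" using le_Suc_ex by metis
    then have "abs2_rat (X m - X K) \<le> 4 * (1 / 2) ^ K" "abs2_rat (X n - X K) \<le> 4 * (1 / 2) ^ K" using * by auto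
    then have "abs2_rat ((X m - X K) + - (X n - X K)) \<le> 4 * (1 / 2) ^ K"
      by (intro abs2_rat_add_le) (simp_all only: abs2_rat_minus)
    then show "abs2_rat (X m - X n) < e" using K by simp
  qed
qed

section \<open>Negative powers of 4 t + 1\<close>

definition ipow :: "nat \<Rightarrow> int \<Rightarrow> rat" where "ipow q t = 1 / of_int (4 * t + 1) ^ q"

definition dipow :: "nat \<Rightarrow> int \<Rightarrow> rat" where "dipow q t = - 4 * of_nat q / of_int (4 * t + 1) ^ Suc q"

lemma odd_power_cong_1:
  fixes x :: int
  assumes "odd x"
  shows "2 ^ L dvd x ^ (2 ^ L) - 1"
proof (induction L)
  case (Suc L)
  have "2 * 2 ^ L dvd (x ^ (2 ^ L) + 1) * (x ^ (2 ^ L) - 1)"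
    using Suc assms by (intro mult_dvd_mono) auto
  also have "(x ^ (2 ^ L) + 1) * (x ^ (2 ^ L) - 1) = x ^ (2 ^ Suc L) - 1"
  proof -
    have "x ^ (2 ^ Suc L) = x ^ (2 ^ L) * x ^ (2 ^ L)" by (simp only: power_Suc mult_2 power_add)
    then show ?thesis by (simp only:) (simp add: algebra_simps)
  qed
  finally show ?case by simp
qed simp

text \<open>For odd \<open>y\<close> the power y ^ (2 ^ L) is 1 modulo 2 ^ L, so y ^ (- q) is close
  to the positive power with exponent \<open>n = q * (2 ^ Suc L - 1)\<close>; as \<open>n\<close> is
  congruent to - q modulo 2 ^ (L + 1), the derivatives are close as well. \<open>Suc L\<close> keeps
  \<open>n\<close> positive for \<open>L = 0\<close>.\<close>

lemma vapp_ipow: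
  assumes q: "q \<ge> 1"
  shows "vapp (ipow q) (dipow q)"
  unfolding vapp_def
proof
  fix L
  define n where "n = q * (2 ^ Suc L - 1)"
  define P :: "int poly" where "P = [:1, 4:] ^ n"
  have n1: "n \<ge> 1"
  proof -
    have "(2::nat) ^ Suc L \<ge> 2" by simp
    then have "1 \<le> (2::nat) ^ Suc L - 1" by linarith
    then show ?thesis unfolding n_def using q mult_le_mono[of 1 q 1 "2 ^ Suc L - 1"] by simp
  qed
  then obtain n' where n': "n = Suc n'" by (cases n) auto
  show "\<exists>P. \<forall>t. abs2_rat (ipow q t - ipoly P t) \<le> (1 / 2) ^ L \<and> abs2_rat (dipow q t - ipoly (pderiv P) t) \<le> (1 / 2) ^ L"
  proof (intro exI[of _ P] allI)
    fix t :: int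
    define y where "y = 4 * t + 1"
    define e where "e = y ^ (q * 2 ^ Suc L) - 1"
    have "odd y" by (simp add: y_def)
    then have y0: "(of_int y :: rat) \<noteq> 0" and ya: "abs2_rat (of_int y) = 1" by (auto simp: abs2_rat_odd)
    have "2 ^ Suc L dvd e" unfolding e_def using odd_power_cong_1[of "y ^ q" "Suc L"] \<open>odd y\<close> by (simp add: power_mult)
    then have ea: "2 ^ L dvd e" by (rule dvd_trans[rotated]) (simp add: le_imp_power_dvd)
    have nq: "n + q = q * 2 ^ Suc L" unfolding n_def by (simp add: algebra_simps)
    have 1: "ipow q t - ipoly P t = of_int (- e) / of_int y ^ q"
    proof -
      have "poly P t = y ^ n" by (simp add: P_def y_def poly_power mult.commute add.commute)
      moreover have "y ^ n * y ^ q = e + 1" unfolding e_def nq[symmetric] by (simp add: power_add)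
      then have "(of_int y ^ n :: rat) * of_int y ^ q = of_int e + 1" by (metis of_int_1 of_int_add of_int_mult of_int_power)
      ultimately show ?thesis using y0 unfolding ipow_def ipoly_def y_def[symmetric] by (simp add: field_simps)
    qed
    have 2: "dipow q t - ipoly (pderiv P) t = of_int (4 * int q * (e - 2 ^ Suc L * (e + 1))) / of_int y ^ Suc q"
    proof -
      have "poly (pderiv P) t = 4 * int n * y ^ n'"
        unfolding P_def n' pderiv_power_Suc by (simp add: y_def poly_power pderiv_pCons mult_ac add.commute)
      moreover have "n' + Suc q = q * 2 ^ Suc L" using nq n' by linarith
      then have "y ^ n' * y ^ Suc q = e + 1" unfolding e_def by (simp only: power_add[symmetric])
      then have "(of_int y ^ n' :: rat) * of_int y ^ Suc q = of_int e + 1" by (metis of_int_1 of_int_add of_int_mult of_int_power)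
      then have "ipoly (pderiv P) t * of_int y ^ Suc q = 4 * of_nat n * (of_int e + 1)"
        unfolding ipoly_def \<open>poly (pderiv P) t = _\<close> by (simp add: mult.assoc)
      moreover have "(of_nat n :: rat) = of_nat q * (2 ^ Suc L - 1)" unfolding n_def by (simp add: of_nat_diff)
      ultimately show ?thesis using y0
        unfolding dipow_def y_def[symmetric] by (simp add: divide_simps del: power_Suc) (simp add: algebra_simps del: power_Suc)
    qed
    have fr: "abs2_rat (of_int k / of_int y ^ n) \<le> (1 / 2) ^ L" if "2 ^ L dvd k" for k n
      unfolding abs2_rat_divide abs2_rat_power ya power_one div_by_1 using that by (rule abs2_rat_of_int_dvd)
    have "2 ^ L dvd - e" using ea by simp
    then have "abs2_rat (of_int (- e) / of_int y ^ q) \<le> (1 / 2) ^ L" by (rule fr)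
    moreover have "2 ^ L dvd 4 * int q * (e - 2 ^ Suc L * (e + 1))"
    proof -
      have "(2::int) ^ L dvd 2 ^ Suc L * (e + 1)" by (rule dvd_mult2) (simp add: le_imp_power_dvd)
      with ea have "2 ^ L dvd e - 2 ^ Suc L * (e + 1)" by (rule dvd_diff)
      then show ?thesis by (rule dvd_mult)
    qed
    then have "abs2_rat (of_int (4 * int q * (e - 2 ^ Suc L * (e + 1))) / of_int y ^ Suc q) \<le> (1 / 2) ^ L" by (rule fr)
    ultimately show "abs2_rat (ipow q t - ipoly P t) \<le> (1 / 2) ^ L \<and> abs2_rat (dipow q t - ipoly (pderiv P) t) \<le> (1 / 2) ^ L"
      unfolding 1 2 by blast
  qed
qed

section \<open>Zeta values as Volkenborn integrals\<close>

lemma abs2_1 [simp]: "abs2 1 = 1"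
  using abs2_of_rat[of 1] by simp

text \<open>\<open>x\<close> is a unit congruent to \<open>e\<close> modulo 4, so x / 4 has
  valuation -2 and \<open>omega (x / 4)\<close> is e / 4.\<close>

lemma omega_quarter:
  fixes x e :: q2
  assumes e: "e \<in> {1, -1}" and x: "abs2 (x - e) \<le> 1 / 4"
  shows "angle (x / 4) = x / e"
proof -
  have e1: "abs2 e = 1" using e by auto
  have "abs2 x \<le> 1" using abs2_add[of "x - e" e] x e1 by simp
  moreover have "abs2 e \<le> max (abs2 x) (abs2 (x - e))"
    using abs2_add[of x "- (x - e)"] by (simp only: abs2_minus) simp
  then have "abs2 x \<ge> 1" using x e1 by (auto simp: max_def split: if_splits)
  ultimately have x1: "abs2 x = 1" by simp
  have a4: "abs2 4 = 2 powi (- 2)" using abs2_mult[of 2 2] by (simp add: abs2_2 power_int_minus)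
  have "abs2 (x / 4) * abs2 4 = 1" using abs2_mult[of "x / 4" 4] x1 by simp
  then have q: "abs2 (x / 4) = 2 powi 2" using a4 by (simp add: power_int_minus field_simps)
  then have "x / 4 \<noteq> 0" by auto
  then have "(2::real) powi (- val2 (x / 4)) = 2 powi 2" using abs2_val2[of "x / 4"] q by simp
  then have v: "val2 (x / 4) = - 2" by (simp only: two_powi_inject)
  have v4: "(2::q2) powi (- 2) = 1 / 4" by (simp add: power_int_minus field_simps)
  have "x / 4 / 2 powi (- 2) = x" by (simp only: v4) simp
  then have "omega (x / 4) = (1 / 4) * omega_unit x" unfolding omega_def v v4 by simp
  also have "omega_unit x = e"
    unfolding omega_unit_def using e x by (intro the1_equality[OF omega_unit_unique[OF x1]] conjI) (simp_all add: Z2_4)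
  finally have "omega (x / 4) = 1 / 4 * e" .
  then show ?thesis unfolding angle_def by (simp only:) simp
qed

lemma abs2_of_int_4: "abs2 (of_int (4 * k)) \<le> 1 / 4"
proof -
  have "abs2_rat (of_int (2 ^ 2 * k)) \<le> (1 / 2) ^ 2" by (rule abs2_rat_of_int_dvd) simp
  then have "abs2_rat (of_int (4 * k)) \<le> 1 / 4" by (simp add: power2_eq_square)
  then show ?thesis using abs2_of_rat[of "of_int (4 * k)"] by (simp only: of_rat_of_int_eq)
qed

text \<open>The cases \<open>e = 1\<close> and \<open>e = - 1\<close> are the arguments 1/4 and 3/4.
  In both, \<open>4 * t + 2 - e\<close> is congruent to \<open>e\<close> modulo 4, and the sign
  \<open>e\<close> disappears because \<open>q\<close> is even.\<close>

lemma hurwitz_quarter: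
  assumes e: "e \<in> {1, - 1 :: int}" and q: "even q"
  shows "hurwitz_zeta2 (int (Suc q)) (of_int (2 - e) / 4) =
    lim (\<lambda>M. of_rat (vmean M (\<lambda>t. 1 / of_int (4 * t + 2 - e) ^ q))) / of_nat q"
proof -
  have "angle (of_nat k + of_int (2 - e) / 4) powi (1 - int (Suc q)) = of_rat (1 / of_int (4 * int k + 2 - e) ^ q)" for k
  proof -
    define y where "y = 4 * int k + 2 - e"
    have "of_nat k + of_int (2 - e) / 4 = (of_int y / 4 :: q2)" by (simp add: y_def field_simps)
    moreover have "angle (of_int y / 4) = (of_int y / of_int e :: q2)"
    proof (rule omega_quarter)
      show "of_int e \<in> {1, - 1 :: q2}" using e by auto
      have "(of_int y - of_int e :: q2) = of_int (y - e)" by simp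
      also have "y - e = 4 * (if e = 1 then int k else int k + 1)" using e by (auto simp: y_def)
      finally show "abs2 (of_int y - of_int e) \<le> 1 / 4" using abs2_of_int_4 by (simp only:)
    qed
    moreover have "(of_int y / of_int e :: q2) powi (1 - int (Suc q)) = 1 / of_int y ^ q"
    proof -
      have "(of_int e :: q2) ^ q = 1" using e q by auto
      moreover have "1 - int (Suc q) = - int q" by simp
      ultimately show ?thesis by (simp only: power_int_minus power_int_of_nat power_divide) (simp add: field_simps)
    qed
    ultimately show ?thesis by (simp only: y_def[symmetric] of_rat_divide of_rat_power of_rat_1 of_rat_of_int_eq)
  qed
  then have "hurwitz_zeta2 (int (Suc q)) (of_int (2 - e) / 4) =
    lim (\<lambda>M. (\<Sum>k<2 ^ M. of_rat (1 / of_int (4 * int k + 2 - e) ^ q)) / 2 ^ M) / of_int (int (Suc q) - 1)"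
    by (simp only: hurwitz_zeta2_def volkenborn_def)
  then show ?thesis by (simp add: vmean_def of_rat_sum of_rat_divide of_rat_power)
qed

text \<open>The reflection of \<open>t\<close> to - 1 - t sends 4 t + 1 to - (4 t + 3). For even
  \<open>q\<close> the integrals belonging to 1/4 and 3/4 therefore have the same value z, and the
  zeta value is (z / q + z / q) / 4.\<close>

lemma zeta2_tendsto:
  assumes q: "even q" "q \<ge> 2"
  shows "(\<lambda>M. of_rat (vmean M (ipow q))) \<longlonglongrightarrow> 2 * of_nat q * zeta2 (int (Suc q))"
proof -
  have "cauchy2 (\<lambda>M. vmean M (ipow q))"
    by (rule cauchy2I_half_power, rule vapp_step, rule vapp_ipow) (use q in simp)
  then obtain z where z: "(\<lambda>M. of_rat (vmean M (ipow q))) \<longlonglongrightarrow> (z :: q2)" using of_rat_tendsto_Q2 by blast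
  define R where "R = (\<lambda>t. ipow q (- 1 - t))"
  have "null2 (\<lambda>M. vmean M R - vmean M (ipow q))"
    unfolding R_def by (rule null2I_half_power, rule vapp_reflect, rule vapp_ipow) (use q in simp)
  then have "(\<lambda>M. of_rat (vmean M R - vmean M (ipow q))) \<longlonglongrightarrow> (0 :: q2)"
    unfolding tendsto_iff null2_def dist_q2_def eventually_sequentially by (simp add: abs2_of_rat)
  have lim2: "(\<lambda>M. of_rat (vmean M R)) \<longlonglongrightarrow> z"
  proof (rule metric_LIMSEQ_I)
    fix e :: real assume e: "e > 0"
    obtain K1 where K1: "\<And>n. n \<ge> K1 \<Longrightarrow> abs2 (of_rat (vmean n (ipow q)) - z) < e"
      using metric_LIMSEQ_D[OF z e] by (auto simp: dist_q2_def)
    obtain K2 where K2: "\<And>n. n \<ge> K2 \<Longrightarrow> abs2_rat (vmean n R - vmean n (ipow q)) < e"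
      using null2D[OF \<open>null2 _\<close> e] by blast
    have "dist (of_rat (vmean n R)) z < e" if "n \<ge> max K1 K2" for n
    proof -
      have "of_rat (vmean n R) - z = of_rat (vmean n R - vmean n (ipow q)) + (of_rat (vmean n (ipow q)) - z)"
        by (simp add: of_rat_diff)
      also have "abs2 \<dots> \<le> max (abs2 (of_rat (vmean n R - vmean n (ipow q)))) (abs2 (of_rat (vmean n (ipow q)) - z))"
        by (rule abs2_add)
      also have "\<dots> < e" using K1[of n] K2[of n] that by (simp only: abs2_of_rat) simp
      finally show ?thesis by (simp only: dist_q2_def)
    qed
    then show "\<exists>K. \<forall>n\<ge>K. dist (of_rat (vmean n R)) z < e" by blast
  qed
  have "(\<lambda>t. 1 / of_int (4 * t + 2 - 1) ^ q) = ipow q" by (simp add: ipow_def fun_eq_iff add.commute)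
  then have h1: "hurwitz_zeta2 (int (Suc q)) (1 / 4) = z / of_nat q"
    using hurwitz_quarter[of 1 q] q z by (simp add: limI)
  have "(\<lambda>t. 1 / of_int (4 * t + 2 - (- 1)) ^ q) = R"
  proof
    fix t
    have "(of_int (4 * (- 1 - t) + 1) :: rat) = - of_int (4 * t + 2 - (- 1))" by simp
    then show "1 / of_int (4 * t + 2 - (- 1)) ^ q = R t"
      using q by (simp only: R_def ipow_def power_minus_even)
  qed
  then have h2: "hurwitz_zeta2 (int (Suc q)) (3 / 4) = z / of_nat q"
    using hurwitz_quarter[of "- 1" q] q lim2 by (simp add: limI)
  have "odd (int (Suc q))" using q by simp
  then have "zeta2 (int (Suc q)) = 1 / 4 * (z / of_nat q + z / of_nat q)"
    using zeta2_odd[of "int (Suc q)"] unfolding h1 h2 using q by simp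
  then have "2 * of_nat q * zeta2 (int (Suc q)) = z" using q by (simp add: field_simps)
  then show ?thesis using z by simp
qed

lemma zeta2_null2:
  assumes q: "even q" "q \<ge> 2" and z: "zeta2 (int (Suc q)) = of_rat z"
  shows "null2 (\<lambda>M. vmean M (ipow q) - 2 * of_nat q * z)"
proof -
  have "(\<lambda>M. of_rat (vmean M (ipow q))) \<longlonglongrightarrow> (of_rat (2 * of_nat q * z) :: q2)"
    using zeta2_tendsto[OF q] z by (simp add: of_rat_mult)
  then have "\<forall>e>0. \<exists>K. \<forall>n\<ge>K. abs2 (of_rat (vmean n (ipow q)) - of_rat (2 * of_nat q * z)) < e"
    unfolding tendsto_iff dist_q2_def eventually_sequentially by blast
  then show ?thesis unfolding null2_def by (simp only: of_rat_diff[symmetric] abs2_of_rat)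
qed

section \<open>The linear forms\<close>

lemma fps_inverse_prod:
  fixes f :: "'a \<Rightarrow> rat fps"
  shows "inverse (\<Prod>i\<in>A. f i) = (\<Prod>i\<in>A. inverse (f i))"
  by (induction A rule: infinite_finite_induct) (simp_all add: fps_inverse_mult)

text \<open>Substitution of c X for X. The factor -1 expresses parity, the factor 4 the passage from
  y = 4 t + 1 to t, and the factor N the passage to a residue class modulo N.\<close>

definition fps_scale :: "rat \<Rightarrow> rat fps \<Rightarrow> rat fps" where
  "fps_scale c G = Abs_fps (\<lambda>n. c ^ n * fps_nth G n)"

lemma fps_scale_nth [simp]: "fps_nth (fps_scale c G) n = c ^ n * fps_nth G n"
  by (simp add: fps_scale_def)

lemma fps_scale_mult: "fps_scale c (F * G) = fps_scale c F * fps_scale c G"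
proof (rule fps_ext)
  fix n
  have "c ^ n = c ^ i * c ^ (n - i)" if "i \<le> n" for i
    using that by (simp flip: power_add)
  then show "fps_nth (fps_scale c (F * G)) n = fps_nth (fps_scale c F * fps_scale c G) n"
    by (simp add: fps_mult_nth sum_distrib_left mult_ac)
qed

lemma fps_scale_1: "fps_scale c 1 = 1"
  by (rule fps_ext) auto

lemma fps_scale_power: "fps_scale c (F ^ n) = fps_scale c F ^ n"
  by (induction n) (simp_all add: fps_scale_mult fps_scale_1)

lemma fps_scale_prod: "fps_scale c (\<Prod>i\<in>A. f i) = (\<Prod>i\<in>A. fps_scale c (f i))"
  by (induction A rule: infinite_finite_induct) (simp_all add: fps_scale_mult fps_scale_1)

lemma fps_scale_lin: "fps_scale c (lin b) = fps_const b + fps_const c * fps_X"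
  by (rule fps_ext) (auto simp: lin_def fps_X_def)

lemma fps_refl_lin: "fps_scale (- 1) (lin b) = - lin (- b)"
  by (rule fps_ext) (auto simp: lin_def fps_X_def)

lemma fps_refl_inverse_lin:
  assumes "b \<noteq> 0"
  shows "fps_scale (- 1) (inverse (lin b)) = - inverse (lin (- b))"
proof -
  have "inverse (lin b) * lin b = 1" using assms by (simp add: inverse_mult_eq_1)
  then have "fps_scale (- 1) (inverse (lin b)) * (- lin (- b)) = 1"
    by (metis fps_scale_1 fps_scale_mult fps_refl_lin)
  then have "inverse (- lin (- b)) = fps_scale (- 1) (inverse (lin b))"
    by (intro fps_inverse_unique) (simp add: mult.commute)
  then show ?thesis by (simp add: fps_inverse_minus)
qed

lemma vapp_translate:
  assumes "vapp F F'"
  shows "vapp (\<lambda>t. F (t - \<kappa>)) (\<lambda>t. F' (t - \<kappa>))"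
  unfolding vapp_def
proof
  fix L
  obtain q where q: "\<And>t. abs2_rat (F t - ipoly q t) \<le> (1 / 2) ^ L \<and> abs2_rat (F' t - ipoly (pderiv q) t) \<le> (1 / 2) ^ L"
    using assms unfolding vapp_def by blast
  have "ipoly (pcompose q [:- \<kappa>, 1:]) t = ipoly q (t - \<kappa>)"
    "ipoly (pderiv (pcompose q [:- \<kappa>, 1:])) t = ipoly (pderiv q) (t - \<kappa>)" for t
    by (simp_all add: ipoly_def poly_pcompose pderiv_pcompose pderiv_pCons)
  then have "\<forall>t. abs2_rat (F (t - \<kappa>) - ipoly (pcompose q [:- \<kappa>, 1:]) t) \<le> (1 / 2) ^ L \<and>
      abs2_rat (F' (t - \<kappa>) - ipoly (pderiv (pcompose q [:- \<kappa>, 1:])) t) \<le> (1 / 2) ^ L"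
    using q by (simp only:) blast
  then show "\<exists>q. \<forall>t. abs2_rat (F (t - \<kappa>) - ipoly q t) \<le> (1 / 2) ^ L \<and> abs2_rat (F' (t - \<kappa>) - ipoly (pderiv q) t) \<le> (1 / 2) ^ L"
    by (rule exI)
qed

text \<open>The sum of derivatives collected when t - \<kappa> is moved back to t by unit steps; one
  of the two ranges is always empty, according to the sign of \<open>\<kappa>\<close>.\<close>

definition vdrift :: "nat \<Rightarrow> int \<Rightarrow> rat" where
  "vdrift q \<kappa> = (\<Sum>\<nu>\<in>{0..<- \<kappa>}. dipow q \<nu>) - (\<Sum>\<nu>\<in>{- \<kappa>..<0}. dipow q \<nu>)"

lemma vdrift_step: "vdrift q \<kappa> - vdrift q (\<kappa> + 1) = dipow q (- \<kappa> - 1)"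
proof (cases "\<kappa> \<ge> 0")
  case True
  then have "{- (\<kappa> + 1)..<0} = insert (- \<kappa> - 1) {- \<kappa>..<0}" "{0..<- \<kappa>} = {}" "{0..<- (\<kappa> + 1)} = {}" by auto
  then show ?thesis by (simp only: vdrift_def) simp
next
  case False
  then have "{0..<- \<kappa>} = insert (- \<kappa> - 1) {0..<- (\<kappa> + 1)}" "{- \<kappa>..<0} = {}" "{- (\<kappa> + 1)..<0} = {}" by auto
  then show ?thesis by (simp only: vdrift_def) simp
qed

lemma null2_diff: "null2 X \<Longrightarrow> null2 Y \<Longrightarrow> null2 (\<lambda>n. X n - Y n)"
  using null2_add[OF _ null2_minus] by simp

lemma null2_scale: "null2 X \<Longrightarrow> null2 (\<lambda>n. c * X n)"
  by (rule null2_mult) simp_all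

lemma null2_sum: "(\<And>i. i \<in> A \<Longrightarrow> null2 (X i)) \<Longrightarrow> null2 (\<lambda>n. \<Sum>i\<in>A. X i n)"
  by (induction A rule: infinite_finite_induct) (simp_all add: null2_add)

lemma vmean_ipow_translate:
  assumes q: "q \<ge> 1"
  shows "null2 (\<lambda>M. vmean M (\<lambda>t. ipow q (t - \<kappa>)) - vmean M (ipow q) - vdrift q \<kappa>)" (is "null2 (?E \<kappa>)")
proof -
  have step: "null2 (\<lambda>M. ?E \<kappa> M - ?E (\<kappa> + 1) M)" for \<kappa>
  proof -
    have "vapp (\<lambda>t. ipow q (t - (\<kappa> + 1))) (\<lambda>t. dipow q (t - (\<kappa> + 1)))"
      by (intro vapp_translate vapp_ipow q)
    moreover have "0 - (\<kappa> + 1) = - \<kappa> - 1" "\<And>t. t + 1 - (\<kappa> + 1) = t - \<kappa>" by simp_all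
    ultimately have "abs2_rat (vmean M (\<lambda>t. ipow q (t - \<kappa>)) - vmean M (\<lambda>t. ipow q (t - (\<kappa> + 1))) - dipow q (- \<kappa> - 1)) \<le> (1 / 2) ^ M" for M
      using vapp_shift[of "\<lambda>t. ipow q (t - (\<kappa> + 1))" "\<lambda>t. dipow q (t - (\<kappa> + 1))" M] by (simp only:)
    moreover have "?E \<kappa> M - ?E (\<kappa> + 1) M = vmean M (\<lambda>t. ipow q (t - \<kappa>)) - vmean M (\<lambda>t. ipow q (t - (\<kappa> + 1))) - dipow q (- \<kappa> - 1)" for M
      using vdrift_step[of q \<kappa>] by simp
    ultimately have "abs2_rat (?E \<kappa> M - ?E (\<kappa> + 1) M) \<le> (1 / 2) ^ M" for M by (simp only:)
    then have "abs2_rat (?E \<kappa> M - ?E (\<kappa> + 1) M) \<le> 4 * (1 / 2) ^ M" for M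
      by (rule order_trans) simp
    then show ?thesis by (rule null2I_half_power)
  qed
  have zero: "null2 (?E 0)" by (simp add: vdrift_def)
  show ?thesis
  proof (induction \<kappa> rule: int_induct[where k = 0])
    case base
    then show ?case by (rule zero)
  next
    case (step1 i)
    have c: "x - (x - y) = y" for x y :: rat by simp
    show ?case using null2_diff[OF step1(2) step[of i]] unfolding c .
  next
    case (step2 i)
    have c: "(x - y) + y = x" "i - 1 + 1 = i" for x y :: rat by simp_all
    show ?case using null2_add[OF step[of "i - 1", unfolded c] step2(2)] unfolding c .
  qed
qed

section \<open>The rational function and its partial fractions\<close>

locale zeta_construction =
  fixes s K :: nat
begin

definition N :: nat where "N = 2 ^ K"
definition m :: nat where "m = s + 2"
definition sg :: nat where "sg = s mod 2"
definition T :: nat where "T = 4 * N - 2"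
definition J :: "int set" where "J = {1 - int N..int N - 1}"
definition I :: "int set" where "I = {- int N..int N}"
text \<open>The zeros 4 j + 1 (even index) and - (4 j + 1) (odd index) together are all odd integers
  of absolute value at most 4 N - 3. Listed in this order they form a single progression of step -2,
  which is what the integrality at odd primes relies on.\<close>

definition xi :: "nat \<Rightarrow> int" where "xi i = 4 * int N - 3 - 2 * int i"
definition P :: "rat poly" where
  "P = [:0, 1:] ^ sg * (\<Prod>i<T. [:- of_int (xi i), 1:]) ^ m"
definition SI :: "rat set" where "SI = (\<lambda>\<kappa>. of_int (4 * \<kappa>)) ` I"

lemma N_pos: "N \<ge> 1"
  by (simp add: N_def)

lemma m_ge: "m \<ge> 2"
  by (simp add: m_def)

lemma finite_I [simp]: "finite I" and finite_J [simp]: "finite J"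
  by (simp_all add: I_def J_def)

lemma card_I: "card I = 2 * N + 1"
  by (simp add: I_def)

lemma inj_SI: "inj_on (\<lambda>\<kappa>. of_int (4 * \<kappa>) :: rat) B"
  by (auto simp: inj_on_def)

lemma card_SI: "card SI = 2 * N + 1"
  unfolding SI_def by (subst card_image[OF inj_SI]) (rule card_I)

lemma sum_SI: "(\<Sum>k\<in>SI. h k) = (\<Sum>\<kappa>\<in>I. h (of_int (4 * \<kappa>)))" for h :: "rat \<Rightarrow> 'a :: comm_monoid_add"
  unfolding SI_def sum.reindex[OF inj_SI] o_def ..

lemma prod_SI: "(\<Prod>k\<in>SI. h k) = (\<Prod>\<kappa>\<in>I. h (of_int (4 * \<kappa>)))" for h :: "rat \<Rightarrow> 'a :: comm_monoid_mult"
  unfolding SI_def prod.reindex[OF inj_SI] o_def ..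

lemma degree_P_le: "degree P \<le> sg + m * T"
proof -
  have "degree (\<Prod>i<T. [:- of_int (xi i), 1:] :: rat poly) \<le> T"
    by (rule order_trans[OF degree_prod_sum_le]) (simp_all add: o_def)
  then have "degree ((\<Prod>i<T. [:- of_int (xi i), 1:]) ^ m :: rat poly) \<le> T * m"
    by (meson degree_power_le le_trans mult_le_mono1)
  moreover have "degree ([:0, 1:] ^ sg :: rat poly) \<le> sg"
    using degree_power_le[of "[:0, 1:] :: rat poly" sg] by simp
  ultimately show ?thesis unfolding P_def
    by (intro order_trans[OF degree_mult_le] add_mono) (simp_all add: mult.commute)
qed

lemma degree_P_less: "degree P + 1 < 2 * m * card SI"
proof -
  have "m * T + 2 * m = 4 * (N * m)" using N_pos by (simp add: T_def algebra_simps)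
  moreover have "sg \<le> 1" by (simp add: sg_def)
  moreover have "2 * m * card SI = 4 * (N * m) + 2 * m" by (simp add: card_SI algebra_simps)
  ultimately show ?thesis using degree_P_le m_ge by linarith
qed

end

sublocale zeta_construction \<subseteq> pfd SI "2 * m" P
  using degree_P_less by unfold_locales (simp_all add: SI_def)

context zeta_construction
begin

lemma prod_xi:
  fixes g :: "int \<Rightarrow> 'a :: comm_monoid_mult"
  shows "(\<Prod>i<T. g (xi i)) = (\<Prod>j\<in>J. g (4 * j + 1)) * (\<Prod>j\<in>J. g (- (4 * j + 1)))"
proof -
  have T: "T = 2 * (2 * N - 1)" using N_pos by (simp add: T_def)
  have "(\<Prod>i<2 * R. u i) = (\<Prod>e<R. u (2 * e)) * (\<Prod>e<R. u (2 * e + 1))" for R and u :: "nat \<Rightarrow> 'a"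
    by (induction R) (simp_all add: mult_ac)
  then have "(\<Prod>i<T. g (xi i)) = (\<Prod>e<2 * N - 1. g (xi (2 * e))) * (\<Prod>e<2 * N - 1. g (xi (2 * e + 1)))"
    unfolding T by blast
  also have "(\<Prod>e<2 * N - 1. g (xi (2 * e))) = (\<Prod>j\<in>J. g (4 * j + 1))"
    by (rule prod.reindex_bij_witness[of _ "\<lambda>j. nat (int N - 1 - j)" "\<lambda>e. int N - 1 - int e"])
      (use N_pos in \<open>auto simp: J_def xi_def nat_less_iff intro!: arg_cong[of _ _ g]\<close>)
  also have "(\<Prod>e<2 * N - 1. g (xi (2 * e + 1))) = (\<Prod>j\<in>J. g (- (4 * j + 1)))"
    by (rule prod.reindex_bij_witness[of _ "\<lambda>j. nat (j + int N - 1)" "\<lambda>e. int e + 1 - int N"])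
      (use N_pos in \<open>auto simp: J_def xi_def nat_less_iff intro!: arg_cong[of _ _ g]\<close>)
  finally show ?thesis .
qed

lemma taylor_P: "taylor c P = lin c ^ sg * (\<Prod>i<T. lin (c - of_int (xi i))) ^ m"
  using taylor_linear[of c 0] by (simp add: P_def taylor_mult taylor_power taylor_prod taylor_linear)

text \<open>The expansion at y = 4 \<kappa> of f(y) times (y - 4 \<kappa>) ^ (2 m), so that
  \<open>a \<kappa> i\<close> below is the coefficient of (y - 4 \<kappa>) ^ (- i) in the principal
  part.\<close>

definition G :: "int \<Rightarrow> rat fps" where
  "G \<kappa> = lin (of_int (4 * \<kappa>)) ^ sg * (\<Prod>i<T. lin (of_int (4 * \<kappa> - xi i))) ^ m *
    (\<Prod>\<kappa>'\<in>I - {\<kappa>}. inverse (lin (of_int (4 * (\<kappa> - \<kappa>'))))) ^ (2 * m)"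

lemma Glau_eq: "Glau (of_int (4 * \<kappa>)) = G \<kappa>"
proof -
  have "SI - {of_int (4 * \<kappa>)} = (\<lambda>\<kappa>. of_int (4 * \<kappa>)) ` (I - {\<kappa>})" unfolding SI_def by auto
  then have "taylor (of_int (4 * \<kappa>)) (rest (of_int (4 * \<kappa>))) = (\<Prod>\<kappa>'\<in>I - {\<kappa>}. lin (of_int (4 * (\<kappa> - \<kappa>')))) ^ (2 * m)"
    unfolding taylor_rest by (simp add: prod.reindex inj_on_def prod_power_distrib right_diff_distrib)
  then show ?thesis
    unfolding Glau_def G_def taylor_P by (simp add: fps_inverse_power fps_inverse_prod)
qed

definition a :: "int \<Rightarrow> nat \<Rightarrow> rat" where "a \<kappa> i = fps_nth (G \<kappa>) (2 * m - i)"

lemma A_eq_a: "A (of_int (4 * \<kappa>)) i = a \<kappa> i"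
  by (simp only: A_def a_def Glau_eq)

lemma sum_a_1: "(\<Sum>\<kappa>\<in>I. a \<kappa> 1) = 0"
proof -
  have "(\<Sum>\<kappa>\<in>I. A (of_int (4 * \<kappa>)) 1) = 0"
    using sum_residues[OF degree_P_less] unfolding sum_SI .
  then show ?thesis by (simp only: A_eq_a)
qed

lemma fps_refl_G: "fps_scale (- 1) (G \<kappa>) = (- 1) ^ sg * G (- \<kappa>)"
proof -
  have neg: "(\<Prod>i\<in>B. - f i) = (- 1) ^ card B * prod f B" for f :: "'b \<Rightarrow> rat fps" and B
    using prod.distrib[of "\<lambda>_. - 1" f B] by simp
  have 1: "(\<Prod>i<T. fps_scale (- 1) (lin (of_int (4 * \<kappa> - xi i)))) = (\<Prod>i<T. lin (of_int (4 * (- \<kappa>) - xi i)))"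
  proof -
    have "even T" unfolding T_def using N_pos by simp
    then have "(\<Prod>i<T. fps_scale (- 1) (lin (of_int (4 * \<kappa> - xi i)))) = (\<Prod>i<T. lin (of_int (4 * (- \<kappa>) - (- xi i))))"
      by (simp add: fps_refl_lin neg)
    also have "\<dots> = (\<Prod>i<T. lin (of_int (4 * (- \<kappa>) - xi i)))"
      unfolding prod_xi[of "\<lambda>x. lin (of_int (4 * (- \<kappa>) - (- x)))"] prod_xi[of "\<lambda>x. lin (of_int (4 * (- \<kappa>) - x))"]
      by (simp only: minus_minus mult.commute)
    finally show ?thesis .
  qed
  have 2: "(\<Prod>\<kappa>'\<in>I - {\<kappa>}. fps_scale (- 1) (inverse (lin (of_int (4 * (\<kappa> - \<kappa>')))))) ^ (2 * m) =
    (\<Prod>\<kappa>'\<in>I - {- \<kappa>}. inverse (lin (of_int (4 * (- \<kappa> - \<kappa>'))))) ^ (2 * m)"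
  proof -
    have "(\<Prod>\<kappa>'\<in>I - {\<kappa>}. fps_scale (- 1) (inverse (lin (of_int (4 * (\<kappa> - \<kappa>')))))) =
      (\<Prod>\<kappa>'\<in>I - {\<kappa>}. - inverse (lin (- of_int (4 * (\<kappa> - \<kappa>')))))"
    proof (rule prod.cong[OF refl])
      fix \<kappa>' assume "\<kappa>' \<in> I - {\<kappa>}"
      then have "(of_int (4 * (\<kappa> - \<kappa>')) :: rat) \<noteq> 0" by (simp only: of_int_eq_0_iff) auto
      then show "fps_scale (- 1) (inverse (lin (of_int (4 * (\<kappa> - \<kappa>'))))) = - inverse (lin (- of_int (4 * (\<kappa> - \<kappa>'))))"
        by (rule fps_refl_inverse_lin)
    qed
    also have "\<dots> = (- 1) ^ card (I - {\<kappa>}) * (\<Prod>\<kappa>'\<in>I - {\<kappa>}. inverse (lin (- of_int (4 * (\<kappa> - \<kappa>')))))" by (rule neg)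
    also have "(\<Prod>\<kappa>'\<in>I - {\<kappa>}. inverse (lin (- of_int (4 * (\<kappa> - \<kappa>'))))) =
      (\<Prod>\<kappa>'\<in>I - {- \<kappa>}. inverse (lin (of_int (4 * (- \<kappa> - \<kappa>')))))"
      by (rule prod.reindex_bij_witness[of _ uminus uminus]) (auto simp: I_def algebra_simps)
    finally show ?thesis by (simp add: power_mult_distrib flip: power_mult)
  qed
  show ?thesis
    unfolding G_def fps_scale_mult fps_scale_power fps_scale_prod unfolding 1 2 unfolding fps_refl_lin
    by (simp add: power_minus[of "lin _"] mult.assoc)
qed

text \<open>The sets of zeros and poles are symmetric, so f has the parity of \<open>sg\<close>,
  hence of \<open>s\<close>; reflecting (y - 4 \<kappa>) ^ (- i) contributes the sign (- 1) ^ i. The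
  factor y ^ (s mod 2) is there to tie the parity to \<open>s\<close>.\<close>

lemma a_uminus:
  assumes "i \<le> 2 * m"
  shows "a (- \<kappa>) i = (- 1) ^ (s + i) * a \<kappa> i"
proof -
  have "fps_nth (fps_scale (- 1) (G \<kappa>)) (2 * m - i) = fps_nth (fps_const ((- 1) ^ sg) * G (- \<kappa>)) (2 * m - i)"
    unfolding fps_refl_G by (simp add: fps_const_power[symmetric] fps_const_neg[symmetric] del: fps_const_power fps_const_neg)
  then have "(- 1) ^ (2 * m - i) * a \<kappa> i = (- 1) ^ sg * a (- \<kappa>) i"
    by (simp add: a_def)
  then have "(- 1) ^ sg * ((- 1) ^ (2 * m - i) * a \<kappa> i) = ((- 1) ^ sg * (- 1) ^ sg) * a (- \<kappa>) i"
    by (simp only: mult.assoc)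
  moreover have "(- 1 :: rat) ^ sg * (- 1) ^ sg = 1" by (simp flip: power_add)
  moreover have "(- 1 :: rat) ^ sg * (- 1) ^ (2 * m - i) = (- 1) ^ (s + i)"
  proof -
    have "even (sg + (2 * m - i)) \<longleftrightarrow> even (s + i)" using assms by (simp add: sg_def even_diff_nat)
    then show ?thesis by (simp only: power_add[symmetric]) (simp only: minus_one_power_iff)
  qed
  ultimately show ?thesis by (simp add: mult.assoc[symmetric])
qed

lemma sum_a_odd:
  assumes "i \<le> 2 * m" "odd (s + i)"
  shows "(\<Sum>\<kappa>\<in>I. a \<kappa> i) = 0"
proof -
  have "(\<Sum>\<kappa>\<in>I. a \<kappa> i) = (\<Sum>\<kappa>\<in>I. a (- \<kappa>) i)"
    by (rule sum.reindex_bij_witness[of _ uminus uminus]) (auto simp: I_def)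
  also have "\<dots> = - (\<Sum>\<kappa>\<in>I. a \<kappa> i)" using assms by (simp add: a_uminus sum_negf)
  finally show ?thesis by simp
qed

definition f :: "int \<Rightarrow> rat fps" where
  "f y = lin (of_int y) ^ sg * (\<Prod>i<T. lin (of_int (y - xi i))) ^ m *
    (\<Prod>\<kappa>\<in>I. inverse (lin (of_int (y - 4 * \<kappa>)))) ^ (2 * m)"

lemma f_nth: "fps_nth (f (4 * t + 1)) e =
  (\<Sum>\<kappa>\<in>I. \<Sum>i=1..2 * m. a \<kappa> i * lin_inverse_coeff (of_int (4 * (t - \<kappa>) + 1)) i e)"
proof -
  define c :: rat where "c = of_int (4 * t + 1)"
  have ne: "c - of_int (4 * \<kappa>) = of_int (4 * (t - \<kappa>) + 1)" "c - of_int (4 * \<kappa>) \<noteq> 0" for \<kappa>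
  proof -
    show 1: "c - of_int (4 * \<kappa>) = of_int (4 * (t - \<kappa>) + 1)" by (simp add: c_def)
    have "4 * (t - \<kappa>) + 1 \<noteq> 0" by presburger
    then show "c - of_int (4 * \<kappa>) \<noteq> 0" unfolding 1 by (simp only: of_int_eq_0_iff not_False_eq_True)
  qed
  have "c \<notin> SI"
  proof
    assume "c \<in> SI"
    then obtain \<kappa> where "c = of_int (4 * \<kappa>)" unfolding SI_def by blast
    then show False using ne(2)[of \<kappa>] by simp
  qed
  have "f (4 * t + 1) = taylor c P * inverse (\<Prod>j\<in>SI. lin (c - j) ^ (2 * m))"
    unfolding f_def taylor_P prod_SI
    by (simp add: c_def fps_inverse_power fps_inverse_prod prod_power_distrib)
  also have "\<dots> = (\<Sum>k\<in>SI. \<Sum>i=1..2 * m. fps_const (A k i) * inverse (lin (c - k)) ^ i)"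
    by (rule fps_decomposition) fact
  also have "\<dots> = (\<Sum>\<kappa>\<in>I. \<Sum>i=1..2 * m. fps_const (a \<kappa> i) * inverse (lin (c - of_int (4 * \<kappa>))) ^ i)"
    unfolding sum_SI A_eq_a ..
  finally show ?thesis by (simp only: fps_sum_nth fps_mult_left_const_nth lin_inverse_power_nth[OF ne(2)]) (simp only: ne(1))
qed

text \<open>The zero at 4 j + 1 has order \<open>m = s + 2\<close>, one more than the order of the
  coefficient.\<close>

lemma f_zero:
  assumes "j \<in> J"
  shows "fps_nth (f (4 * j + 1)) (s + 1) = 0"
proof -
  have "\<exists>W. (\<Prod>i<T. lin (of_int (4 * j + 1 - xi i))) = fps_X * W"
    unfolding prod_xi[of "\<lambda>x. lin (of_int (4 * j + 1 - x))"] using assms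
    by (subst prod.remove[of J j]) (simp_all add: lin_0 mult.assoc)
  then obtain W where W: "(\<Prod>i<T. lin (of_int (4 * j + 1 - xi i))) = fps_X * W" ..
  have "f (4 * j + 1) = fps_X ^ m * (lin (of_int (4 * j + 1)) ^ sg * W ^ m *
    (\<Prod>\<kappa>\<in>I. inverse (lin (of_int (4 * j + 1 - 4 * \<kappa>)))) ^ (2 * m))"
    unfolding f_def W by (simp only: power_mult_distrib mult_ac)
  then show ?thesis by (simp only: fps_X_power_mult_nth) (simp add: m_def)
qed

section \<open>The linear form and its rational part\<close>

definition F :: "int \<Rightarrow> rat" where "F t = fps_nth (f (4 * t + 1)) s"

definition \<beta> :: "nat \<Rightarrow> rat" where "\<beta> i = (- 1) ^ s * of_nat ((i + s - 1) choose s)"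

definition rho :: "nat \<Rightarrow> rat" where "rho i = \<beta> i * (\<Sum>\<kappa>\<in>I. a \<kappa> i)"

definition rho0 :: rat where "rho0 = (\<Sum>\<kappa>\<in>I. \<Sum>i=1..2 * m. a \<kappa> i * \<beta> i * vdrift (i + s) \<kappa>)"

lemma F_eq: "F t = (\<Sum>\<kappa>\<in>I. \<Sum>i=1..2 * m. a \<kappa> i * \<beta> i * ipow (i + s) (t - \<kappa>))"
  unfolding F_def f_nth by (simp add: lin_inverse_coeff_def \<beta>_def ipow_def mult_ac)

lemma vmean_F_null2:
  assumes "\<And>i. i \<in> {2..2 * m} \<Longrightarrow> even (i + s) \<Longrightarrow> null2 (\<lambda>M. vmean M (ipow (i + s)) - z i)"
  shows "null2 (\<lambda>M. vmean M F - ((\<Sum>i=1..2 * m. rho i * z i) + rho0))"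
proof -
  have 1: "null2 (\<lambda>M. \<Sum>\<kappa>\<in>I. \<Sum>i=1..2 * m. a \<kappa> i * \<beta> i * (vmean M (\<lambda>t. ipow (i + s) (t - \<kappa>)) - vmean M (ipow (i + s)) - vdrift (i + s) \<kappa>))"
    by (intro null2_sum null2_scale vmean_ipow_translate) simp
  have 2: "null2 (\<lambda>M. \<Sum>i=1..2 * m. rho i * (vmean M (ipow (i + s)) - z i))"
  proof (rule null2_sum)
    fix i assume i: "i \<in> {1..2 * m}"
    show "null2 (\<lambda>M. rho i * (vmean M (ipow (i + s)) - z i))"
    proof (cases "i = 1 \<or> odd (i + s)")
      case True
      then have "rho i = 0" using sum_a_1 sum_a_odd[of i] i by (auto simp: rho_def add.commute)
      then show ?thesis by simp
    next
      case False
      then show ?thesis using i by (intro null2_scale assms) auto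
    qed
  qed
  have "vmean M F = (\<Sum>\<kappa>\<in>I. \<Sum>i=1..2 * m. a \<kappa> i * \<beta> i * vmean M (\<lambda>t. ipow (i + s) (t - \<kappa>)))" for M
  proof -
    have "F = (\<lambda>t. \<Sum>\<kappa>\<in>I. \<Sum>i=1..2 * m. a \<kappa> i * \<beta> i * ipow (i + s) (t - \<kappa>))" by (rule ext) (rule F_eq)
    then show ?thesis by (simp only: vmean_sum vmean_scale)
  qed
  moreover have "(\<Sum>i=1..2 * m. rho i * (v i - z i)) =
    (\<Sum>\<kappa>\<in>I. \<Sum>i=1..2 * m. a \<kappa> i * \<beta> i * v i) - (\<Sum>i=1..2 * m. rho i * z i)" for v :: "nat \<Rightarrow> rat"
  proof -
    have "(\<Sum>i=1..2 * m. rho i * v i) = (\<Sum>\<kappa>\<in>I. \<Sum>i=1..2 * m. a \<kappa> i * \<beta> i * v i)"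
      by (subst sum.swap) (simp add: rho_def sum_distrib_left sum_distrib_right mult_ac)
    then show ?thesis by (simp add: right_diff_distrib sum_subtractf)
  qed
  ultimately have "vmean M F - ((\<Sum>i=1..2 * m. rho i * z i) + rho0) =
    (\<Sum>\<kappa>\<in>I. \<Sum>i=1..2 * m. a \<kappa> i * \<beta> i * (vmean M (\<lambda>t. ipow (i + s) (t - \<kappa>)) - vmean M (ipow (i + s)) - vdrift (i + s) \<kappa>)) +
    (\<Sum>i=1..2 * m. rho i * (vmean M (ipow (i + s)) - z i))" for M
    by (simp add: rho0_def right_diff_distrib sum_subtractf)
  then show ?thesis using null2_add[OF 1 2] by simp
qed

text \<open>The Taylor coefficient of order s + 1 at y = 4 (\<kappa> + \<nu>) + 1 of the principal
  part at 4 \<kappa>. The order is s + 1 since translating the integral differentiates the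
  coefficient of order s once more.\<close>

definition pp :: "int \<Rightarrow> int \<Rightarrow> rat" where
  "pp \<kappa> \<nu> = (\<Sum>i=1..2 * m. a \<kappa> i * lin_inverse_coeff (of_int (4 * \<nu> + 1)) i (s + 1))"

lemma rho0_eq: "rho0 = 4 * of_nat (s + 1) *
  (\<Sum>\<kappa>\<in>I. (\<Sum>\<nu>\<in>{0..<- \<kappa>}. pp \<kappa> \<nu>) - (\<Sum>\<nu>\<in>{- \<kappa>..<0}. pp \<kappa> \<nu>))"
proof -
  have c: "\<beta> i * dipow (i + s) \<nu> = 4 * of_nat (s + 1) * lin_inverse_coeff (of_int (4 * \<nu> + 1)) i (s + 1)" for i \<nu>
  proof -
    have "(s + 1) * ((i + s) choose (s + 1)) = (i + s) * ((i + s - 1) choose s)"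
      using binomial_absorption[of s "i + s"] by simp
    then have "(of_nat (s + 1) :: rat) * of_nat ((i + s) choose (s + 1)) = of_nat (i + s) * of_nat ((i + s - 1) choose s)"
      by (simp only: of_nat_mult[symmetric])
    moreover have "i + (s + 1) - 1 = i + s" "i + (s + 1) = Suc (i + s)" by simp_all
    ultimately show ?thesis
      unfolding \<beta>_def dipow_def lin_inverse_coeff_def by (simp del: of_nat_add of_nat_Suc of_int_add of_int_mult power_Suc add: mult_ac) (simp del: of_nat_add of_nat_Suc of_int_add of_int_mult)
  qed
  have "(\<Sum>i=1..2 * m. a \<kappa> i * \<beta> i * (\<Sum>\<nu>\<in>B. dipow (i + s) \<nu>)) = 4 * of_nat (s + 1) * (\<Sum>\<nu>\<in>B. pp \<kappa> \<nu>)" for B \<kappa>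
  proof -
    have "(\<Sum>i=1..2 * m. a \<kappa> i * \<beta> i * (\<Sum>\<nu>\<in>B. dipow (i + s) \<nu>)) = (\<Sum>\<nu>\<in>B. \<Sum>i=1..2 * m. a \<kappa> i * (\<beta> i * dipow (i + s) \<nu>))"
      by (subst sum.swap) (simp add: sum_distrib_left mult.assoc)
    also have "\<dots> = 4 * of_nat (s + 1) * (\<Sum>\<nu>\<in>B. pp \<kappa> \<nu>)"
      unfolding c pp_def sum_distrib_left by (simp only: mult.left_commute)
    finally show ?thesis .
  qed
  then show ?thesis
    unfolding rho0_def vdrift_def right_diff_distrib sum_subtractf sum_distrib_left by (simp only: sum_distrib_left[symmetric])
qed

text \<open>The principal parts at all poles add up to f, whose coefficient of order s + 1 vanishes
  at 4 j + 1. This relation lets one principal part be traded for the others.\<close>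

lemma sum_pp:
  assumes "j \<in> J"
  shows "(\<Sum>\<kappa>\<in>I. pp \<kappa> (j - \<kappa>)) = 0"
  using f_zero[OF assms] unfolding f_nth pp_def by simp

end

section \<open>Integrality at odd primes\<close>

context zeta_construction
begin

text \<open>Chosen with r ^ 2 \<ge> 4 N: every prime whose square is at most \<open>T\<close> lies
  below \<open>r\<close>, so \<open>fact r\<close> provides one more factor of it than the least
  common multiple does. As \<open>r\<close> has order sqrt N, the logarithm of \<open>fact r\<close>
  is only O(sqrt N ln N).\<close>

definition r :: nat where "r = 2 ^ (K div 2 + 2)"
definition d :: nat where "d = lcmn (2 * N) * fact r"
definition \<Theta> :: nat where "\<Theta> = \<Prod>{p. prime p \<and> 2 * N < p \<and> p \<le> 4 * N}"
text \<open>\<open>fact T\<close> normalises each of the \<open>m\<close> copies of the numerator,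
  and \<open>fact (2 * N)\<close> each of the \<open>2 * m\<close> copies of the denominator. The
  primes above 2 N occur in \<open>fact T\<close> at most once; \<open>\<Theta>\<close> restores
  them there, so that they need not enter \<open>d\<close>, which is raised to the power
  \<open>3 * m - 1\<close>.\<close>

definition D0 :: rat where "D0 = (of_nat \<Theta> / fact T) ^ m * fact (2 * N) ^ (2 * m)"

lemma d_pos: "d > 0"
  by (simp add: d_def lcmn_pos)

lemma finite_primes: "finite {p. prime p \<and> 2 * N < p \<and> p \<le> 4 * N}"
  by (rule finite_subset[of _ "{..4 * N}"]) auto

lemma \<Theta>_pos: "\<Theta> > 0"
  unfolding \<Theta>_def by (rule prod_pos) (auto dest: prime_gt_0_nat)

context
  fixes p :: nat
  assumes p: "prime p" "p \<noteq> 2"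
begin

lemma not_dvd_4_power: "\<not> int p dvd 4 ^ n"
proof
  assume "int p dvd 4 ^ n"
  moreover have "prime (int p)" using p(1) by simp
  ultimately have "int p dvd 4" using prime_dvd_power by blast
  then have "int p dvd 2 * 2" by simp
  then have "int p dvd int 2" using \<open>prime (int p)\<close> by (simp only: prime_dvd_mult_iff) simp
  then have "p dvd 2" by (simp only: int_dvd_int_iff)
  then show False using p by (simp add: primes_dvd_imp_eq)
qed

text \<open>From 2 p ^ (h - 1) \<le> p ^ h \<le> T < 4 N it follows that \<open>lcmn (2 * N)\<close>
  lacks at most one factor \<open>p\<close>; for \<open>h \<ge> 2\<close> this factor is found in
  \<open>fact r\<close>, since then p ^ 2 \<le> T.\<close>

lemma power_dvd_d:
  assumes "p \<le> 2 * N" "p ^ h \<le> T"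
  shows "p ^ h dvd d"
proof (cases "h \<le> 1")
  case True
  then have "h = 0 \<or> h = 1" by linarith
  moreover have "p dvd d" unfolding d_def using assms(1) prime_ge_1_nat[OF p(1)] by (intro dvd_mult2 dvd_lcmn)
  ultimately show ?thesis by auto
next
  case False
  then obtain g where h: "h = Suc (Suc g)" by (metis One_nat_def Suc_le_D not_less_eq_eq numeral_2_eq_2)
  have p2: "p \<ge> 2" by (rule prime_ge_2_nat[OF p(1)])
  have TN: "T < 4 * N" using N_pos by (simp add: T_def)
  have "p * p * 1 \<le> p * p * p ^ g" using p2 by (intro mult_le_mono2) simp
  moreover have "p * p * p ^ g \<le> T" using assms(2) by (simp add: h mult.assoc)
  ultimately have "p * p \<le> T" by linarith
  also have "T < 2 ^ (K + 2)" using TN by (simp add: N_def)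
  also have "\<dots> \<le> 2 ^ ((K div 2 + 2) + (K div 2 + 2))" by (intro power_increasing) simp_all
  also have "\<dots> = r * r" by (simp only: r_def power_add)
  finally have "p < r" by (meson leI mult_le_mono not_less)
  then have "p dvd fact r" using p2 by (intro dvd_fact) simp_all
  moreover have "p ^ Suc g dvd lcmn (2 * N)"
  proof -
    have "2 * p ^ Suc g \<le> p * p ^ Suc g" using p2 by (rule mult_le_mono1)
    moreover have "p * p ^ Suc g \<le> T" using assms(2) by (simp add: h)
    ultimately have "p ^ Suc g \<le> 2 * N" using TN by linarith
    then show ?thesis using prime_power_dvd_lcmn_iff[OF p(1)] by blast
  qed
  ultimately have "p ^ Suc g * p dvd d" unfolding d_def by (intro mult_dvd_mono)
  then show ?thesis by (simp add: h mult_ac)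
qed

lemma fps_denom_lin: "fps_denom p e (lin (of_int b))"
  unfolding fps_denom_def
proof
  fix l
  have "fps_nth (lin (of_int b)) l = of_int (if l = 0 then b else if l = 1 then 1 else 0)"
    by (simp add: lin_def fps_X_def)
  then show "of_nat e ^ l * fps_nth (lin (of_int b)) l \<in> Zloc p"
    by (simp only:) (intro Zloc_mult[OF p(1)] Zloc_power[OF p(1)] Zloc_of_nat[OF p(1)] Zloc_of_int[OF p(1)])
qed

text \<open>For \<open>p \<le> 2 * N\<close> the product runs over a progression of odd numbers with
  step 2, and \<open>d\<close> absorbs the denominators. For larger \<open>p\<close> one has T < 2
  p, so \<open>fact T\<close> contains \<open>p\<close> at most once; if it does,
  \<open>\<Theta>\<close> cancels it and all coefficients are integral at \<open>p\<close>.\<close>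

lemma fps_denom_numerator:
  "fps_denom p d (fps_const (of_nat \<Theta> / fact T) * (\<Prod>i<T. lin (of_int (4 * \<kappa> - xi i))))"
proof (cases "p \<le> 2 * N")
  case True
  define b where "b = 4 * \<kappa> - (4 * int N - 3)"
  have "odd b" by (simp add: b_def)
  have "4 * \<kappa> - xi i = b + 2 * int i" for i by (simp add: b_def xi_def)
  moreover have "fps_denom p d (fps_const (1 / fact T) * (\<Prod>i<T. lin (of_int (b + 2 * int i))))"
    by (rule fps_denom_odd_progression[OF p \<open>odd b\<close> d_pos]) (rule power_dvd_d[OF True])
  then have "fps_denom p d (fps_const (of_nat \<Theta>) * (fps_const (1 / fact T) * (\<Prod>i<T. lin (of_int (b + 2 * int i)))))"
    by (rule fps_denom_mult[OF p(1) fps_denom_const[OF p(1) Zloc_of_nat[OF p(1)]]])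
  moreover have "fps_const (of_nat \<Theta> / fact T :: rat) = fps_const (of_nat \<Theta>) * fps_const (1 / fact T)" by simp
  ultimately show ?thesis by (simp only: mult.assoc)
next
  case False
  have pp: "T < p ^ Suc 1"
  proof -
    have "2 * p \<le> p * p" using prime_ge_2_nat[OF p(1)] by (rule mult_le_mono1)
    then have "T < p * p" using False N_pos unfolding T_def by linarith
    then show ?thesis by simp
  qed
  have "multiplicity p (fact T) = T div p" using multiplicity_fact[OF p(1) pp] by simp
  also have "\<dots> \<le> multiplicity p \<Theta>"
  proof (cases "p \<le> T")
    case True
    have "T < p * 2" using False by (simp add: T_def)
    then have "T div p < 2" by (simp add: div_less_iff_less_mult mult.commute prime_gt_0_nat[OF p(1)])
    moreover have "p \<in> {p. prime p \<and> 2 * N < p \<and> p \<le> 4 * N}" using True False p(1) by (simp add: T_def)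
    then have "p dvd \<Theta>" unfolding \<Theta>_def using dvd_prodI[OF finite_primes, of p "\<lambda>x. x"] by simp
    then have "p ^ 1 dvd \<Theta>" by simp
    then have "1 \<le> multiplicity p \<Theta>" using p(1) \<Theta>_pos by (intro multiplicity_geI) auto
    ultimately show ?thesis by linarith
  qed simp
  finally have "of_nat \<Theta> / of_nat (fact T) \<in> Zloc p" using \<Theta>_pos by (intro Zloc_frac_nat[OF p(1)]) simp_all
  then have "of_nat \<Theta> / fact T \<in> Zloc p" by (simp only: of_nat_fact)
  then show ?thesis
    by (intro fps_denom_mult[OF p(1)] fps_denom_const[OF p(1)] fps_denom_prod[OF p(1)] fps_denom_lin)
qed

lemma dvd_d:
  assumes "x \<noteq> 0" "\<bar>x\<bar> \<le> 2 * int N"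
  shows "x dvd int d"
proof -
  have "nat \<bar>x\<bar> dvd lcmn (2 * N)" using assms by (intro dvd_lcmn) auto
  then have "nat \<bar>x\<bar> dvd d" unfolding d_def by (rule dvd_mult2)
  then have "int (nat \<bar>x\<bar>) dvd int d" by (simp only: int_dvd_int_iff)
  then show ?thesis by simp
qed

lemma d_divide:
  assumes "x \<noteq> 0" "\<bar>x\<bar> \<le> 2 * int N"
  shows "of_nat d / of_int (4 * x) \<in> Zloc p"
proof -
  obtain c where "int d = x * c" using dvd_d[OF assms] by (rule dvdE)
  then have "(of_nat d :: rat) = of_int x * of_int c" by (metis of_int_mult of_int_of_nat_eq)
  then have "of_nat d / of_int (4 * x) = (of_int c / of_int (4 ^ 1) :: rat)" using assms(1) by simp
  moreover have "of_int c / of_int (4 ^ 1) \<in> Zloc p"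
    by (rule Zloc_divide_unit[OF p(1) Zloc_of_int[OF p(1)] not_dvd_4_power])
  ultimately show ?thesis by (simp only:)
qed

text \<open>Up to sign the product is (N + \<kappa>)! (N - \<kappa>)!.\<close>

lemma prod_differences_dvd:
  assumes "\<kappa> \<in> I"
  shows "(\<Prod>\<kappa>'\<in>I - {\<kappa>}. \<kappa> - \<kappa>') dvd fact (2 * N)"
proof -
  have k: "- int N \<le> \<kappa>" "\<kappa> \<le> int N" using assms by (auto simp: I_def)
  have f: "int (fact n) = (\<Prod>i\<in>{1..int n}. i)" for n
  proof -
    have "int (fact n) = (\<Prod>i\<in>{1..n}. int i)" by (simp add: fact_prod)
    also have "\<dots> = (\<Prod>i\<in>{1..int n}. i)"
      by (rule prod.reindex_bij_witness[of _ nat int]) auto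
    finally show ?thesis .
  qed
  have "I - {\<kappa>} = {- int N..<\<kappa>} \<union> {\<kappa><..int N}" using k by (auto simp: I_def)
  then have "(\<Prod>\<kappa>'\<in>I - {\<kappa>}. \<bar>\<kappa> - \<kappa>'\<bar>) = (\<Prod>\<kappa>'\<in>{- int N..<\<kappa>}. \<bar>\<kappa> - \<kappa>'\<bar>) * (\<Prod>\<kappa>'\<in>{\<kappa><..int N}. \<bar>\<kappa> - \<kappa>'\<bar>)"
    by (simp only:) (rule prod.union_disjoint, simp, simp, simp add: disjoint_iff)
  also have "(\<Prod>\<kappa>'\<in>{- int N..<\<kappa>}. \<bar>\<kappa> - \<kappa>'\<bar>) = int (fact (nat (int N + \<kappa>)))"
    unfolding f by (rule prod.reindex_bij_witness[of _ "\<lambda>i. \<kappa> - i" "\<lambda>i. \<kappa> - i"]) (use k in auto)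
  also have "(\<Prod>\<kappa>'\<in>{\<kappa><..int N}. \<bar>\<kappa> - \<kappa>'\<bar>) = int (fact (nat (int N - \<kappa>)))"
    unfolding f by (rule prod.reindex_bij_witness[of _ "\<lambda>i. \<kappa> + i" "\<lambda>i. i - \<kappa>"]) (use k in auto)
  finally have "\<bar>\<Prod>\<kappa>'\<in>I - {\<kappa>}. \<kappa> - \<kappa>'\<bar> = int (fact (nat (int N + \<kappa>)) * fact (nat (int N - \<kappa>)))"
    by (simp only: abs_prod of_nat_mult)
  moreover have "fact (nat (int N + \<kappa>)) * fact (nat (int N - \<kappa>)) dvd (fact (nat (int N + \<kappa>) + nat (int N - \<kappa>)) :: nat)"
    by (rule fact_fact_dvd_fact)
  moreover have "nat (int N + \<kappa>) + nat (int N - \<kappa>) = 2 * N" using k by linarith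
  ultimately have "\<bar>\<Prod>\<kappa>'\<in>I - {\<kappa>}. \<kappa> - \<kappa>'\<bar> dvd int (fact (2 * N))" by (simp only: int_dvd_int_iff)
  then show ?thesis by (simp only: abs_dvd_iff of_nat_fact)
qed

text \<open>Each inverse is written as b / (b + X) divided by b = 4 (\<kappa> - \<kappa>'). The
  coefficients of b / (b + X) are powers of - 1 / b, controlled because \<kappa> - \<kappa>' divides
  \<open>d\<close>, and \<open>fact (2 * N)\<close> clears the product of the b up to powers of
  4.\<close>

lemma fps_denom_denominator:
  assumes "\<kappa> \<in> I"
  shows "fps_denom p d (fps_const (fact (2 * N)) * (\<Prod>\<kappa>'\<in>I - {\<kappa>}. inverse (lin (of_int (4 * (\<kappa> - \<kappa>'))))))"
proof -
  define b :: "int \<Rightarrow> rat" where "b = (\<lambda>\<kappa>'. of_int (4 * (\<kappa> - \<kappa>')))"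
  define B where "B = I - {\<kappa>}"
  have b0: "b \<kappa>' \<noteq> 0" if "\<kappa>' \<in> B" for \<kappa>' using that unfolding b_def B_def of_int_eq_0_iff by auto
  have prodconst: "(\<Prod>x\<in>B. fps_const (b x)) = fps_const (\<Prod>x\<in>B. b x)"
    by (induction B rule: infinite_finite_induct) simp_all
  obtain c where c: "fact (2 * N) = (\<Prod>\<kappa>'\<in>B. \<kappa> - \<kappa>') * c" using prod_differences_dvd[OF assms] unfolding B_def by (rule dvdE)
  have pb: "(\<Prod>x\<in>B. b x) = 4 ^ card B * of_int (\<Prod>\<kappa>'\<in>B. \<kappa> - \<kappa>')"
    unfolding b_def of_int_mult prod.distrib by simp
  have pb0: "(\<Prod>x\<in>B. b x) \<noteq> 0" using b0 by (simp add: B_def)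
  have "fact (2 * N) / (\<Prod>x\<in>B. b x) = of_int c / of_int (4 ^ card B)"
  proof -
    have "(fact (2 * N) :: rat) = of_int (\<Prod>\<kappa>'\<in>B. \<kappa> - \<kappa>') * of_int c"
      using arg_cong[OF c, of "of_int :: int \<Rightarrow> rat"] by (simp only: of_int_mult of_int_fact)
    moreover have "of_int (\<Prod>\<kappa>'\<in>B. \<kappa> - \<kappa>') \<noteq> (0::rat)" using pb0 unfolding pb by simp
    ultimately show ?thesis unfolding pb by simp
  qed
  then have 1: "fact (2 * N) / (\<Prod>x\<in>B. b x) \<in> Zloc p"
    using Zloc_divide_unit[OF p(1) Zloc_of_int[OF p(1)] not_dvd_4_power] by simp
  have 2: "fps_denom p d (fps_const (b x) * inverse (lin (b x)))" if x: "x \<in> B" for x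
    unfolding fps_denom_def
  proof
    fix l
    have "fps_nth (inverse (lin (b x)) ^ 1) l = lin_inverse_coeff (b x) 1 l" by (rule lin_inverse_power_nth[OF b0[OF x]])
    then have "of_nat d ^ l * fps_nth (fps_const (b x) * inverse (lin (b x))) l = (- (of_nat d / b x)) ^ l"
      using b0[OF x] by (simp add: lin_inverse_coeff_def power_divide power_minus[of "_ / _"])
    moreover have "of_nat d / b x \<in> Zloc p"
      unfolding b_def by (rule d_divide) (use x assms in \<open>auto simp: B_def I_def\<close>)
    ultimately show "of_nat d ^ l * fps_nth (fps_const (b x) * inverse (lin (b x))) l \<in> Zloc p"
      by (simp only:) (intro Zloc_power[OF p(1)] Zloc_minus[OF p(1)])
  qed
  have "fps_const (fact (2 * N)) = fps_const (fact (2 * N) / (\<Prod>x\<in>B. b x)) * (\<Prod>x\<in>B. fps_const (b x))"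
    unfolding prodconst using pb0 by simp
  then have "fps_const (fact (2 * N)) * (\<Prod>x\<in>B. inverse (lin (b x))) =
    fps_const (fact (2 * N) / (\<Prod>x\<in>B. b x)) * (\<Prod>x\<in>B. fps_const (b x) * inverse (lin (b x)))"
    by (simp only: prod.distrib mult.assoc)
  then have "fps_denom p d (fps_const (fact (2 * N)) * (\<Prod>x\<in>B. inverse (lin (b x))))"
    by (simp only:) (intro fps_denom_mult[OF p(1)] fps_denom_const[OF p(1) 1] fps_denom_prod[OF p(1)] 2)
  then show ?thesis unfolding b_def B_def .
qed

lemma fps_denom_G:
  assumes "\<kappa> \<in> I"
  shows "fps_denom p d (fps_const D0 * G \<kappa>)"
proof -
  have "fps_const D0 = fps_const (of_nat \<Theta> / fact T) ^ m * fps_const (fact (2 * N)) ^ (2 * m)"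
    by (simp add: D0_def fps_const_power)
  then have "fps_const D0 * G \<kappa> = lin (of_int (4 * \<kappa>)) ^ sg *
    (fps_const (of_nat \<Theta> / fact T) * (\<Prod>i<T. lin (of_int (4 * \<kappa> - xi i)))) ^ m *
    (fps_const (fact (2 * N)) * (\<Prod>\<kappa>'\<in>I - {\<kappa>}. inverse (lin (of_int (4 * (\<kappa> - \<kappa>')))))) ^ (2 * m)"
    unfolding G_def by (simp only: power_mult_distrib mult_ac)
  then show ?thesis
    by (simp only:) (intro fps_denom_mult[OF p(1)] fps_denom_power[OF p(1)] fps_denom_lin fps_denom_numerator
        fps_denom_denominator assms)
qed

lemma Zloc_a:
  assumes "\<kappa> \<in> I"
  shows "of_nat d ^ (2 * m - i) * (D0 * a \<kappa> i) \<in> Zloc p"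
  using fps_denom_G[OF assms] unfolding fps_denom_def a_def by (metis fps_mult_left_const_nth)

lemma Zloc_rho:
  assumes i: "i \<in> {1..2 * m}"
  shows "D0 * of_nat d ^ (3 * m - 1) * rho i \<in> Zloc p"
proof -
  have "3 * m - 1 = (m - 1 + i) + (2 * m - i)" using i m_ge by auto
  then have e: "(of_nat d :: rat) ^ (3 * m - 1) = of_nat d ^ (m - 1 + i) * of_nat d ^ (2 * m - i)" by (simp only: power_add)
  have "D0 * of_nat d ^ (3 * m - 1) * rho i =
    of_nat d ^ (m - 1 + i) * \<beta> i * (\<Sum>\<kappa>\<in>I. of_nat d ^ (2 * m - i) * (D0 * a \<kappa> i))"
    unfolding e rho_def by (simp add: sum_distrib_left mult_ac)
  moreover have "\<beta> i = of_int ((- 1) ^ s * int ((i + s - 1) choose s))" by (simp add: \<beta>_def)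
  then have "\<beta> i \<in> Zloc p" using Zloc_of_int[OF p(1)] by (simp only:)
  ultimately show ?thesis
    by (simp only:) (intro Zloc_mult[OF p(1)] Zloc_power[OF p(1)] Zloc_of_nat[OF p(1)] Zloc_sum[OF p(1)] Zloc_a)
qed

lemma Zloc_pp_if:
  assumes "\<kappa> \<in> I" and u: "of_nat d / of_int (4 * \<nu> + 1) \<in> Zloc p"
  shows "D0 * of_nat d ^ (3 * m - 1) * pp \<kappa> \<nu> \<in> Zloc p"
proof -
  have "D0 * of_nat d ^ (3 * m - 1) * (a \<kappa> i * lin_inverse_coeff (of_int (4 * \<nu> + 1)) i (s + 1)) =
      (of_nat d ^ (2 * m - i) * (D0 * a \<kappa> i)) *
      (of_int ((- 1) ^ (s + 1) * int ((i + (s + 1) - 1) choose (s + 1))) * (of_nat d / of_int (4 * \<nu> + 1)) ^ (i + (s + 1)))"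
    if "i \<in> {1..2 * m}" for i
  proof -
    \<comment> \<open>This is where the exponent comes from: \<open>a \<kappa> i\<close> costs 2 m -
      i and the pole order i + s + 1, together 2 m + s + 1 = 3 m - 1 for every
      \<open>i\<close>.\<close>
    have "3 * m - 1 = (2 * m - i) + (i + (s + 1))" using that by (auto simp: m_def)
    then have e: "(of_nat d :: rat) ^ (3 * m - 1) = of_nat d ^ (2 * m - i) * of_nat d ^ (i + (s + 1))" by (simp only: power_add)
    show ?thesis unfolding e lin_inverse_coeff_def power_divide
      by (simp only: of_int_mult of_int_power of_int_minus of_int_1 of_int_of_nat_eq times_divide_eq_right times_divide_eq_left mult_ac)
  qed
  then have "D0 * of_nat d ^ (3 * m - 1) * pp \<kappa> \<nu> = (\<Sum>i=1..2 * m. (of_nat d ^ (2 * m - i) * (D0 * a \<kappa> i)) *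
      (of_int ((- 1) ^ (s + 1) * int ((i + (s + 1) - 1) choose (s + 1))) * (of_nat d / of_int (4 * \<nu> + 1)) ^ (i + (s + 1))))"
    unfolding pp_def sum_distrib_left by (rule sum.cong[OF refl])
  then show ?thesis using u
    by (simp only:) (intro Zloc_sum[OF p(1)] Zloc_mult[OF p(1), of "_ * (_ * _)"] Zloc_mult[OF p(1), of "of_int _"]
        Zloc_power[OF p(1)] Zloc_a assms(1) Zloc_of_int[OF p(1)])
qed

text \<open>If \<open>4 \<nu> + 1\<close> is divisible by a higher power of \<open>p\<close> than \<open>d\<close> is, then \<open>pp \<kappa> \<nu>\<close> is rewritten by means of the
  other principal parts at \<open>4 (\<kappa> + \<nu>) + 1\<close>, where \<open>f\<close> vanishes to order \<open>m = s + 2\<close>.\<close>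

lemma Zloc_pp:
  assumes k: "\<kappa> \<in> I" and j: "\<kappa> + \<nu> \<in> J \<or> \<nu> = 0"
  shows "D0 * of_nat d ^ (3 * m - 1) * pp \<kappa> \<nu> \<in> Zloc p"
proof (cases "multiplicity (int p) (4 * \<nu> + 1) \<le> multiplicity (int p) (int d)")
  case True
  have "4 * \<nu> + 1 \<noteq> 0" by presburger
  then have "of_int (int d) / of_int (4 * \<nu> + 1) \<in> Zloc p" using d_pos True by (intro Zloc_frac[OF p(1)]) simp_all
  then show ?thesis by (intro Zloc_pp_if k) simp
next
  case False
  define e where "e = Suc (multiplicity (int p) (int d))"
  have nu: "\<not> is_unit (int p)" using p(1) by auto
  have de: "\<not> int p ^ e dvd int d"
  proof
    assume "int p ^ e dvd int d"
    then have "e \<le> multiplicity (int p) (int d)" using nu d_pos by (intro multiplicity_geI) simp_all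
    then show False by (simp add: e_def)
  qed
  have u: "int p ^ e dvd 4 * \<nu> + 1" by (rule multiplicity_dvd') (use False in \<open>simp add: e_def\<close>)
  have "\<nu> \<noteq> 0"
  proof
    assume "\<nu> = 0"
    then have "int p ^ e dvd 1" using u by simp
    then show False using de by (meson dvd_trans one_dvd)
  qed
  then have jJ: "\<kappa> + \<nu> \<in> J" using j by blast
  have sumz: "pp \<kappa> \<nu> = - (\<Sum>\<kappa>'\<in>I - {\<kappa>}. pp \<kappa>' (\<kappa> + \<nu> - \<kappa>'))"
    using sum_pp[OF jJ] sum.remove[OF finite_I k, of "\<lambda>\<kappa>'. pp \<kappa>' (\<kappa> + \<nu> - \<kappa>')"] by simp
  have good: "D0 * of_nat d ^ (3 * m - 1) * pp \<kappa>' (\<kappa> + \<nu> - \<kappa>') \<in> Zloc p" if k': "\<kappa>' \<in> I - {\<kappa>}" for \<kappa>'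
  proof (rule Zloc_pp_if)
    show "\<kappa>' \<in> I" using k' by simp
    define v where "v = 4 * (\<kappa> + \<nu> - \<kappa>') + 1"
    have v0: "v \<noteq> 0" unfolding v_def by presburger
    have x: "\<kappa> - \<kappa>' dvd int d" by (rule dvd_d) (use k k' in \<open>auto simp: I_def\<close>)
    \<comment> \<open>If \<open>p ^ e\<close> divided two of the denominators, it would divide their
      difference 4 (\<kappa> - \<kappa>'), although \<kappa> - \<kappa>' divides \<open>d\<close>
      and \<open>p ^ e\<close> does not. So only one of the principal parts can be bad.\<close>
    have "multiplicity (int p) v \<le> multiplicity (int p) (int d)"
    proof (rule ccontr)
      assume "\<not> ?thesis"
      then have "int p ^ e dvd v" by (intro multiplicity_dvd') (simp add: e_def)
      then have "int p ^ e dvd v - (4 * \<nu> + 1)" using u by (rule dvd_diff)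
      then have "int p ^ e dvd 4 * (\<kappa> - \<kappa>')" by (simp add: v_def algebra_simps)
      moreover have "coprime (int p ^ e) 4"
        using p(1) not_dvd_4_power[of 1] prime_imp_coprime[of "int p" 4] by (simp add: coprime_power_left_iff)
      ultimately have "int p ^ e dvd \<kappa> - \<kappa>'" by (simp only: coprime_dvd_mult_right_iff)
      then show False using x de dvd_trans by blast
    qed
    then have "of_int (int d) / of_int v \<in> Zloc p" using d_pos v0 by (intro Zloc_frac[OF p(1)]) simp_all
    then show "of_nat d / of_int (4 * (\<kappa> + \<nu> - \<kappa>') + 1) \<in> Zloc p" by (simp add: v_def)
  qed
  have "D0 * of_nat d ^ (3 * m - 1) * pp \<kappa> \<nu> = - (\<Sum>\<kappa>'\<in>I - {\<kappa>}. D0 * of_nat d ^ (3 * m - 1) * pp \<kappa>' (\<kappa> + \<nu> - \<kappa>'))"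
    unfolding sumz by (simp add: sum_distrib_left)
  then show ?thesis using good by (simp only:) (intro Zloc_minus[OF p(1)] Zloc_sum[OF p(1)])
qed

text \<open>All points 4 (\<kappa> + \<nu>) + 1 that occur have \<kappa> + \<nu> in
  \<open>J\<close>, except for \<kappa> = - N, \<nu> = 0; this one is harmless, as its denominator 4
  \<nu> + 1 is 1.\<close>

lemma Zloc_rho0: "D0 * of_nat d ^ (3 * m - 1) * rho0 \<in> Zloc p"
proof -
  define Z where "Z = D0 * of_nat d ^ (3 * m - 1)"
  have "Z * rho0 = of_nat (4 * (s + 1)) *
    (\<Sum>\<kappa>\<in>I. (\<Sum>\<nu>\<in>{0..<- \<kappa>}. Z * pp \<kappa> \<nu>) - (\<Sum>\<nu>\<in>{- \<kappa>..<0}. Z * pp \<kappa> \<nu>))"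
    unfolding rho0_eq sum_distrib_left[symmetric] right_diff_distrib[symmetric] of_nat_mult of_nat_numeral
    by (simp only: mult_ac)
  moreover have z1: "Z * pp \<kappa> \<nu> \<in> Zloc p" if "\<kappa> \<in> I" "\<nu> \<in> {0..<- \<kappa>}" for \<kappa> \<nu>
    using that unfolding Z_def by (intro Zloc_pp) (auto simp: I_def J_def)
  moreover have z2: "Z * pp \<kappa> \<nu> \<in> Zloc p" if "\<kappa> \<in> I" "\<nu> \<in> {- \<kappa>..<0}" for \<kappa> \<nu>
    using that unfolding Z_def by (intro Zloc_pp) (auto simp: I_def J_def)
  ultimately show ?thesis unfolding Z_def[symmetric]
    by (simp only:) (intro Zloc_mult[OF p(1)] Zloc_of_nat[OF p(1)] Zloc_sum[OF p(1)] Zloc_diff[OF p(1)] z1 z2)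
qed

end

end

section \<open>Archimedean estimates\<close>

text \<open>Domination by a geometric progression. Under products the constants multiply and the
  rates add, by the binomial theorem.\<close>

definition fps_bnd :: "rat \<Rightarrow> rat \<Rightarrow> rat fps \<Rightarrow> bool" where
  "fps_bnd C M G \<longleftrightarrow> 0 \<le> C \<and> 0 \<le> M \<and> (\<forall>l. \<bar>fps_nth G l\<bar> \<le> C * M ^ l)"

lemma fps_bnd_mult:
  assumes F: "fps_bnd C1 M1 F" and G: "fps_bnd C2 M2 G"
  shows "fps_bnd (C1 * C2) (M1 + M2) (F * G)"
  unfolding fps_bnd_def
proof (intro conjI allI)
  have nn: "0 \<le> C1" "0 \<le> M1" "0 \<le> C2" "0 \<le> M2" using F G by (auto simp: fps_bnd_def)
  then show "0 \<le> C1 * C2" "0 \<le> M1 + M2" by simp_all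
  fix l
  have "\<bar>fps_nth (F * G) l\<bar> \<le> (\<Sum>i=0..l. \<bar>fps_nth F i * fps_nth G (l - i)\<bar>)"
    unfolding fps_mult_nth by (rule sum_abs)
  also have "\<dots> \<le> (\<Sum>i=0..l. (C1 * C2) * (of_nat (l choose i) * M1 ^ i * M2 ^ (l - i)))"
  proof (rule sum_mono)
    fix i assume i: "i \<in> {0..l}"
    have "(1::nat) \<le> l choose i" using i by (simp add: Suc_le_eq zero_less_binomial_iff)
    then have c1: "(1::rat) \<le> of_nat (l choose i)" by (metis of_nat_1 of_nat_mono)
    have "\<bar>fps_nth F i * fps_nth G (l - i)\<bar> \<le> (C1 * M1 ^ i) * (C2 * M2 ^ (l - i))"
      unfolding abs_mult using F G nn by (intro mult_mono) (auto simp: fps_bnd_def)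
    also have "\<dots> = 1 * ((C1 * C2) * (M1 ^ i * M2 ^ (l - i)))" by simp
    also have "\<dots> \<le> of_nat (l choose i) * ((C1 * C2) * (M1 ^ i * M2 ^ (l - i)))"
      using c1 nn by (intro mult_right_mono) simp_all
    finally show "\<bar>fps_nth F i * fps_nth G (l - i)\<bar> \<le> (C1 * C2) * (of_nat (l choose i) * M1 ^ i * M2 ^ (l - i))"
      by (simp only: mult_ac)
  qed
  also have "\<dots> = C1 * C2 * (M1 + M2) ^ l"
    by (simp only: sum_distrib_left[symmetric] binomial_ring atMost_atLeast0)
  finally show "\<bar>fps_nth (F * G) l\<bar> \<le> C1 * C2 * (M1 + M2) ^ l" .
qed

lemma fps_bnd_1: "fps_bnd 1 0 1"
  by (auto simp: fps_bnd_def)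

lemma fps_bnd_power: "fps_bnd C M G \<Longrightarrow> fps_bnd (C ^ n) (of_nat n * M) (G ^ n)"
proof (induction n)
  case (Suc n)
  then show ?case using fps_bnd_mult[OF Suc.prems Suc.IH[OF Suc.prems]] by (simp add: distrib_right)
qed (simp add: fps_bnd_1)

lemma fps_bnd_prod:
  "finite A \<Longrightarrow> (\<And>i. i \<in> A \<Longrightarrow> fps_bnd (C i) 1 (f i)) \<Longrightarrow> fps_bnd (\<Prod>i\<in>A. C i) (of_nat (card A)) (\<Prod>i\<in>A. f i)"
proof (induction A rule: finite_induct)
  case (insert x A)
  then show ?case using fps_bnd_mult[of "C x" 1 "f x" "\<Prod>i\<in>A. C i" "of_nat (card A)" "\<Prod>i\<in>A. f i"] by simp
qed (simp add: fps_bnd_1)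

lemma fps_bnd_mono:
  assumes "fps_bnd C M G" "C \<le> C'" "M \<le> M'"
  shows "fps_bnd C' M' G"
proof -
  have "0 \<le> C" "0 \<le> M" using assms by (auto simp: fps_bnd_def)
  then have "C * M ^ l \<le> C' * M' ^ l" for l using assms by (intro mult_mono power_mono) auto
  then show ?thesis using assms \<open>0 \<le> C\<close> \<open>0 \<le> M\<close> unfolding fps_bnd_def by (meson order_trans)
qed

lemma fps_bnd_lin: "1 \<le> c \<Longrightarrow> \<bar>b\<bar> \<le> c \<Longrightarrow> fps_bnd c 1 (lin b)"
  by (auto simp: fps_bnd_def lin_def fps_X_def)

lemma fps_bnd_inverse_lin:
  assumes "1 \<le> \<bar>b\<bar>"
  shows "fps_bnd (1 / \<bar>b\<bar>) 1 (inverse (lin b))"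
  unfolding fps_bnd_def
proof (intro conjI allI)
  fix l
  have b: "b \<noteq> 0" using assms by auto
  have "\<bar>fps_nth (inverse (lin b) ^ 1) l\<bar> = 1 / \<bar>b\<bar> ^ (1 + l)"
    unfolding lin_inverse_power_nth[OF b] lin_inverse_coeff_def by (simp add: abs_mult power_abs)
  also have "\<dots> \<le> 1 / \<bar>b\<bar> ^ 1" using assms by (intro divide_left_mono power_increasing) auto
  finally show "\<bar>fps_nth (inverse (lin b)) l\<bar> \<le> 1 / \<bar>b\<bar> * 1 ^ l" by simp
qed (use assms in auto)

context zeta_construction
begin

text \<open>Pairing the zeros 4 j + 1 and 4 j - 1 gives the factors (4 (\<kappa> - j)) ^ 2 - 1, of
  absolute value at most (4 (\<kappa> - j)) ^ 2, or 1 if j = \<kappa>. So at each pole the numerator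
  is dominated by the square of the remaining denominator, and the coefficients
  \<open>a \<kappa> i\<close> grow only polynomially in \<open>N\<close>.\<close>

lemma prod_numerator_le:
  "(\<Prod>i<T. \<bar>4 * \<kappa> - xi i\<bar>) \<le> (\<Prod>\<kappa>'\<in>I - {\<kappa>}. \<bar>4 * (\<kappa> - \<kappa>')\<bar>) ^ 2"
proof -
  have "(\<Prod>j\<in>J. \<bar>4 * \<kappa> - - (4 * j + 1)\<bar>) = (\<Prod>j\<in>J. \<bar>4 * \<kappa> - 4 * j + 1\<bar>)"
    by (rule prod.reindex_bij_witness[of _ uminus uminus]) (auto simp: J_def)
  then have "(\<Prod>i<T. \<bar>4 * \<kappa> - xi i\<bar>) = (\<Prod>j\<in>J. \<bar>4 * \<kappa> - (4 * j + 1)\<bar> * \<bar>4 * \<kappa> - 4 * j + 1\<bar>)"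
    unfolding prod_xi[of "\<lambda>x. \<bar>4 * \<kappa> - x\<bar>"] by (simp only: prod.distrib)
  also have "\<dots> = (\<Prod>j\<in>J. \<bar>(4 * (\<kappa> - j)) ^ 2 - 1\<bar>)"
    by (simp only: abs_mult[symmetric]) (simp add: algebra_simps power2_eq_square)
  also have "\<dots> \<le> (\<Prod>j\<in>J - {\<kappa>}. \<bar>(4 * (\<kappa> - j)) ^ 2 - 1\<bar>)"
  proof (cases "\<kappa> \<in> J")
    case True
    then show ?thesis by (subst prod.remove[OF finite_J True]) simp
  qed simp
  also have "\<dots> \<le> (\<Prod>j\<in>J - {\<kappa>}. (4 * (\<kappa> - j)) ^ 2)"
  proof (rule prod_mono, intro conjI)
    fix j assume "j \<in> J - {\<kappa>}"
    then have "\<kappa> - j \<noteq> 0" by auto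
    then have "0 < (4 * (\<kappa> - j)) ^ 2" by simp
    then show "\<bar>(4 * (\<kappa> - j)) ^ 2 - 1\<bar> \<le> (4 * (\<kappa> - j)) ^ 2" by linarith
  qed simp
  also have "\<dots> \<le> (\<Prod>j\<in>I - {\<kappa>}. (4 * (\<kappa> - j)) ^ 2)"
  proof (rule prod_mono2)
    show "finite (I - {\<kappa>})" "J - {\<kappa>} \<subseteq> I - {\<kappa>}" by (auto simp: I_def J_def)
    fix b assume "b \<in> (I - {\<kappa>}) - (J - {\<kappa>})"
    then have "\<kappa> - b \<noteq> 0" by auto
    then have "0 < (4 * (\<kappa> - b)) ^ 2" by simp
    then show "1 \<le> (4 * (\<kappa> - b)) ^ 2" by linarith
  qed simp
  also have "\<dots> = (\<Prod>\<kappa>'\<in>I - {\<kappa>}. \<bar>4 * (\<kappa> - \<kappa>')\<bar>) ^ 2"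
    by (simp only: prod_power_distrib power2_abs)
  finally show ?thesis .
qed

lemma fps_bnd_G:
  assumes k: "\<kappa> \<in> I"
  shows "fps_bnd (4 * of_nat N) (16 * of_nat N * of_nat m) (G \<kappa>)"
proof -
  define X where "X = (\<Prod>i<T. \<bar>of_int (4 * \<kappa> - xi i)\<bar> :: rat)"
  define D where "D = (\<Prod>\<kappa>'\<in>I - {\<kappa>}. 1 / \<bar>of_int (4 * (\<kappa> - \<kappa>'))\<bar> :: rat)"
  have N1: "(1::rat) \<le> 4 * of_nat N" using N_pos of_nat_mono[OF N_pos, where 'a = rat] by simp
  have ge1: "1 \<le> \<bar>of_int x :: rat\<bar>" if "x \<noteq> 0" for x :: int
  proof -
    have "1 \<le> \<bar>x\<bar>" using that by linarith
    then have "(of_int 1 :: rat) \<le> of_int \<bar>x\<bar>" by (simp only: of_int_le_iff)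
    then show ?thesis by simp
  qed
  have 1: "fps_bnd (4 * of_nat N) 1 (lin (of_int (4 * \<kappa>)) ^ sg)"
  proof (cases "s mod 2 = 0")
    case True
    then show ?thesis using N1 by (simp add: sg_def) (rule fps_bnd_mono[OF fps_bnd_1], simp_all)
  next
    case False
    then have "sg = 1" by (simp add: sg_def)
    moreover have "\<bar>of_int (4 * \<kappa>) :: rat\<bar> \<le> 4 * of_nat N"
    proof -
      have "\<bar>4 * \<kappa>\<bar> \<le> 4 * int N" using k by (auto simp: I_def)
      then have "(of_int \<bar>4 * \<kappa>\<bar> :: rat) \<le> of_int (4 * int N)" by (simp only: of_int_le_iff)
      then show ?thesis by simp
    qed
    ultimately show ?thesis using fps_bnd_lin[OF N1] by simp
  qed
  have 2: "fps_bnd (X ^ m) (of_nat m * of_nat T) ((\<Prod>i<T. lin (of_int (4 * \<kappa> - xi i))) ^ m)"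
  proof -
    have "fps_bnd X (of_nat (card {..<T})) (\<Prod>i<T. lin (of_int (4 * \<kappa> - xi i)))"
      unfolding X_def
    proof (rule fps_bnd_prod, simp)
      fix i
      have "4 * \<kappa> - xi i \<noteq> 0" unfolding xi_def by presburger
      then show "fps_bnd \<bar>of_int (4 * \<kappa> - xi i)\<bar> 1 (lin (of_int (4 * \<kappa> - xi i)))" using ge1 by (intro fps_bnd_lin) simp_all
    qed
    then show ?thesis using fps_bnd_power by simp
  qed
  have 3: "fps_bnd (D ^ (2 * m)) (of_nat (2 * m) * of_nat (2 * N))
    ((\<Prod>\<kappa>'\<in>I - {\<kappa>}. inverse (lin (of_int (4 * (\<kappa> - \<kappa>'))))) ^ (2 * m))"
  proof -
    have "fps_bnd D (of_nat (card (I - {\<kappa>}))) (\<Prod>\<kappa>'\<in>I - {\<kappa>}. inverse (lin (of_int (4 * (\<kappa> - \<kappa>')))))"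
      unfolding D_def
    proof (rule fps_bnd_prod, simp)
      fix \<kappa>' assume "\<kappa>' \<in> I - {\<kappa>}"
      then have "4 * (\<kappa> - \<kappa>') \<noteq> 0" by auto
      then show "fps_bnd (1 / \<bar>of_int (4 * (\<kappa> - \<kappa>'))\<bar>) 1 (inverse (lin (of_int (4 * (\<kappa> - \<kappa>')))))"
        by (intro fps_bnd_inverse_lin ge1)
    qed
    moreover have "card (I - {\<kappa>}) = 2 * N" using k by (simp add: card_I)
    ultimately show ?thesis using fps_bnd_power by metis
  qed
  have XD: "X * D ^ 2 \<le> 1"
  proof -
    define E where "E = (\<Prod>\<kappa>'\<in>I - {\<kappa>}. \<bar>4 * (\<kappa> - \<kappa>')\<bar>)"
    have E: "E > 0" unfolding E_def by (intro prod_pos) auto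
    have "X = of_int (\<Prod>i<T. \<bar>4 * \<kappa> - xi i\<bar>)" unfolding X_def of_int_prod of_int_abs ..
    also have "\<dots> \<le> of_int (E ^ 2)" unfolding E_def using prod_numerator_le by (simp only: of_int_le_iff)
    finally have "X \<le> of_int E ^ 2" by simp
    moreover have "D = 1 / of_int E" unfolding D_def E_def prod_dividef of_int_prod of_int_abs by simp
    moreover have "(of_int E :: rat) > 0" using E by simp
    ultimately show ?thesis by (simp add: power_divide)
  qed
  have nn: "0 \<le> X" "0 \<le> D" unfolding X_def D_def by (auto intro!: prod_nonneg)
  have "fps_bnd (4 * of_nat N * X ^ m * D ^ (2 * m)) (1 + of_nat m * of_nat T + of_nat (2 * m) * of_nat (2 * N)) (G \<kappa>)"
    unfolding G_def by (intro fps_bnd_mult 1 2 3)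
  moreover have "4 * of_nat N * X ^ m * D ^ (2 * m) \<le> 4 * of_nat N"
  proof -
    have "4 * of_nat N * X ^ m * D ^ (2 * m) = 4 * of_nat N * (X * D ^ 2) ^ m" by (simp add: power_mult_distrib power_mult)
    also have "\<dots> \<le> 4 * of_nat N * 1" using XD nn by (intro mult_left_mono power_le_one) simp_all
    finally show ?thesis by simp
  qed
  moreover have "1 + of_nat m * of_nat T + of_nat (2 * m) * of_nat (2 * N) \<le> (16 * of_nat N * of_nat m :: rat)"
  proof -
    have "m * T \<le> m * (4 * N)" by (simp add: T_def)
    moreover have "1 * 1 \<le> m * N" using m_ge N_pos by (intro mult_le_mono) simp_all
    moreover have "m * (4 * N) = 4 * (m * N)" "2 * m * (2 * N) = 4 * (m * N)" "16 * N * m = 16 * (m * N)" by simp_all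
    ultimately have "1 + m * T + 2 * m * (2 * N) \<le> 16 * N * m" by linarith
    then have "of_nat (1 + m * T + 2 * m * (2 * N)) \<le> (of_nat (16 * N * m) :: rat)" by (simp only: of_nat_le_iff)
    then show ?thesis by simp
  qed
  ultimately show ?thesis by (rule fps_bnd_mono)
qed

definition Amax :: rat where "Amax = 4 * of_nat N * (16 * of_nat N * of_nat m) ^ (2 * m)"

lemma abs_a_le:
  assumes "\<kappa> \<in> I"
  shows "\<bar>a \<kappa> i\<bar> \<le> Amax"
proof -
  have "\<bar>a \<kappa> i\<bar> \<le> 4 * of_nat N * (16 * of_nat N * of_nat m) ^ (2 * m - i)"
    using fps_bnd_G[OF assms] unfolding fps_bnd_def a_def by blast
  moreover have "(1::rat) \<le> 16 * of_nat N * of_nat m"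
  proof -
    have "1 * 1 \<le> m * N" using m_ge N_pos by (intro mult_le_mono) simp_all
    then have "1 \<le> 16 * N * m" by (simp add: mult.commute)
    then have "of_nat 1 \<le> (of_nat (16 * N * m) :: rat)" by (simp only: of_nat_le_iff)
    then show ?thesis by simp
  qed
  ultimately show ?thesis unfolding Amax_def
    by (elim order_trans) (intro mult_left_mono power_increasing; simp)
qed

lemma Amax_nonneg: "Amax \<ge> 0"
  by (simp add: Amax_def)

lemma choose_le:
  assumes "n \<le> 3 * m"
  shows "(of_nat (n choose k) :: rat) \<le> 2 ^ (3 * m)"
proof -
  have "n choose k \<le> 2 ^ n" by (rule binomial_le_pow2)
  also have "\<dots> \<le> 2 ^ (3 * m)" using assms by (intro power_increasing) simp_all
  finally have "of_nat (n choose k) \<le> (of_nat (2 ^ (3 * m)) :: rat)" by (simp only: of_nat_le_iff)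
  then show ?thesis by simp
qed

lemma abs_rho_le:
  assumes "i \<in> {1..2 * m}"
  shows "\<bar>rho i\<bar> \<le> 2 ^ (3 * m) * (3 * of_nat N * Amax)"
proof -
  have "\<bar>\<beta> i\<bar> = of_nat ((i + s - 1) choose s)" by (simp add: \<beta>_def abs_mult power_abs)
  also have "\<dots> \<le> 2 ^ (3 * m)" using assms by (intro choose_le) (auto simp: m_def)
  finally have 1: "\<bar>\<beta> i\<bar> \<le> 2 ^ (3 * m)" .
  have "\<bar>\<Sum>\<kappa>\<in>I. a \<kappa> i\<bar> \<le> (\<Sum>\<kappa>\<in>I. Amax)" by (rule order_trans[OF sum_abs]) (intro sum_mono abs_a_le)
  also have "\<dots> = of_nat (2 * N + 1) * Amax" by (simp add: card_I)
  also have "\<dots> \<le> of_nat (3 * N) * Amax" using N_pos Amax_nonneg by (intro mult_right_mono of_nat_mono) simp_all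
  finally have "\<bar>\<Sum>\<kappa>\<in>I. a \<kappa> i\<bar> \<le> 3 * of_nat N * Amax" by simp
  then show ?thesis unfolding rho_def abs_mult using 1 Amax_nonneg by (intro mult_mono) simp_all
qed

lemma abs_pp_le:
  assumes "\<kappa> \<in> I"
  shows "\<bar>pp \<kappa> \<nu>\<bar> \<le> of_nat (2 * m) * (Amax * 2 ^ (3 * m))"
proof -
  define u :: rat where "u = of_int (4 * \<nu> + 1)"
  have "4 * \<nu> + 1 \<noteq> 0" by presburger
  then have "1 \<le> \<bar>4 * \<nu> + 1\<bar>" by linarith
  then have "(of_int 1 :: rat) \<le> of_int \<bar>4 * \<nu> + 1\<bar>" by (simp only: of_int_le_iff)
  then have u: "1 \<le> \<bar>u\<bar>" unfolding u_def by (simp only: of_int_1 of_int_abs)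
  have "\<bar>lin_inverse_coeff u i (s + 1)\<bar> \<le> 2 ^ (3 * m)" if "i \<in> {1..2 * m}" for i
  proof -
    have "\<bar>lin_inverse_coeff u i (s + 1)\<bar> = of_nat ((i + (s + 1) - 1) choose (s + 1)) / \<bar>u\<bar> ^ (i + (s + 1))"
      by (simp add: lin_inverse_coeff_def abs_mult power_abs)
    also have "\<dots> \<le> of_nat ((i + (s + 1) - 1) choose (s + 1)) / 1"
    proof -
      define v where "v = \<bar>u\<bar> ^ (i + (s + 1))"
      have "1 \<le> v" unfolding v_def by (rule one_le_power[OF u])
      then show ?thesis unfolding v_def[symmetric] by (intro divide_left_mono) simp_all
    qed
    also have "\<dots> \<le> 2 ^ (3 * m)" unfolding div_by_1 using that by (intro choose_le) (auto simp: m_def)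
    finally show ?thesis .
  qed
  then have "\<bar>pp \<kappa> \<nu>\<bar> \<le> (\<Sum>i=1..2 * m. Amax * 2 ^ (3 * m))"
    unfolding pp_def u_def[symmetric] using assms Amax_nonneg
    by (intro order_trans[OF sum_abs] sum_mono) (simp only: abs_mult, intro mult_mono abs_a_le, simp_all)
  then show ?thesis by simp
qed

lemma abs_rho0_le: "\<bar>rho0\<bar> \<le> 4 * of_nat (s + 1) * (of_nat (3 * N) * (of_nat (2 * N) * (of_nat (2 * m) * (Amax * 2 ^ (3 * m)))))"
proof -
  define B where "B = of_nat (2 * m) * (Amax * 2 ^ (3 * m))"
  have B: "B \<ge> 0" using Amax_nonneg by (simp add: B_def)
  have s: "\<bar>\<Sum>\<nu>\<in>X. pp \<kappa> \<nu>\<bar> \<le> of_nat N * B" if "\<kappa> \<in> I" "card X \<le> N" for X \<kappa>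
  proof -
    have "\<bar>\<Sum>\<nu>\<in>X. pp \<kappa> \<nu>\<bar> \<le> (\<Sum>\<nu>\<in>X. B)"
      unfolding B_def by (rule order_trans[OF sum_abs]) (intro sum_mono abs_pp_le that)
    also have "\<dots> = of_nat (card X) * B" by simp
    also have "\<dots> \<le> of_nat N * B" using that B by (intro mult_right_mono of_nat_mono)
    finally show ?thesis .
  qed
  have "\<bar>(\<Sum>\<nu>\<in>{0..<- \<kappa>}. pp \<kappa> \<nu>) - (\<Sum>\<nu>\<in>{- \<kappa>..<0}. pp \<kappa> \<nu>)\<bar> \<le> of_nat (2 * N) * B" if "\<kappa> \<in> I" for \<kappa>
  proof -
    have "card {0..<- \<kappa>} \<le> N" "card {- \<kappa>..<0} \<le> N" using that by (auto simp: I_def)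
    from s[OF that this(1)] s[OF that this(2)] show ?thesis by simp
  qed
  then have "\<bar>\<Sum>\<kappa>\<in>I. (\<Sum>\<nu>\<in>{0..<- \<kappa>}. pp \<kappa> \<nu>) - (\<Sum>\<nu>\<in>{- \<kappa>..<0}. pp \<kappa> \<nu>)\<bar> \<le> (\<Sum>\<kappa>\<in>I. of_nat (2 * N) * B)"
    by (intro order_trans[OF sum_abs] sum_mono)
  also have "\<dots> = of_nat (2 * N + 1) * (of_nat (2 * N) * B)" by (simp add: card_I)
  also have "\<dots> \<le> of_nat (3 * N) * (of_nat (2 * N) * B)" using N_pos B by (intro mult_right_mono of_nat_mono) simp_all
  finally have "\<bar>4 * of_nat (s + 1) :: rat\<bar> * \<bar>\<Sum>\<kappa>\<in>I. (\<Sum>\<nu>\<in>{0..<- \<kappa>}. pp \<kappa> \<nu>) - (\<Sum>\<nu>\<in>{- \<kappa>..<0}. pp \<kappa> \<nu>)\<bar> \<le>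
    \<bar>4 * of_nat (s + 1)\<bar> * (of_nat (3 * N) * (of_nat (2 * N) * B))" by (rule mult_left_mono) simp
  moreover have "\<bar>4 * of_nat (s + 1) :: rat\<bar> = 4 * of_nat (s + 1)" by simp
  ultimately show ?thesis unfolding rho0_eq B_def[symmetric] abs_mult[of "4 * of_nat (s + 1)"] by (simp only:)
qed

lemma abs_combination_le:
  assumes z: "\<And>i. i \<in> {1..2 * m} \<Longrightarrow> \<bar>z i\<bar> \<le> Z" and Z: "0 \<le> Z"
  shows "\<bar>(\<Sum>i=1..2 * m. rho i * z i) + rho0\<bar> \<le>
    (Z + 8 * of_nat (s + 1)) * (of_nat (2 * m) * 2 ^ (3 * m) * 3 * (4 * (16 * of_nat m) ^ (2 * m))) * of_nat N ^ (2 * m + 3)"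
proof -
  have "\<bar>\<Sum>i=1..2 * m. rho i * z i\<bar> \<le> (\<Sum>i=1..2 * m. 2 ^ (3 * m) * (3 * of_nat N * Amax) * Z)"
    using z Amax_nonneg by (intro order_trans[OF sum_abs] sum_mono) (simp only: abs_mult, intro mult_mono abs_rho_le, simp_all)
  also have "\<dots> = Z * (of_nat (2 * m) * 2 ^ (3 * m) * 3 * Amax) * of_nat N" by (simp add: mult_ac)
  also have "\<dots> \<le> Z * (of_nat (2 * m) * 2 ^ (3 * m) * 3 * Amax) * of_nat N ^ 2"
    using N_pos Z Amax_nonneg self_le_power[of "of_nat N :: rat" 2] by (intro mult_left_mono mult_nonneg_nonneg) simp_all
  finally have "\<bar>(\<Sum>i=1..2 * m. rho i * z i) + rho0\<bar> \<le> Z * (of_nat (2 * m) * 2 ^ (3 * m) * 3 * Amax) * of_nat N ^ 2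
    + 4 * of_nat (s + 1) * (of_nat (3 * N) * (of_nat (2 * N) * (of_nat (2 * m) * (Amax * 2 ^ (3 * m)))))"
    using abs_rho0_le by linarith
  also have "\<dots> = (Z + 8 * of_nat (s + 1)) * (of_nat (2 * m) * 2 ^ (3 * m) * 3 * Amax) * of_nat N ^ 2"
    by (simp add: algebra_simps power2_eq_square del: of_nat_Suc)
  also have "\<dots> = (Z + 8 * of_nat (s + 1)) * (of_nat (2 * m) * 2 ^ (3 * m) * 3 * (4 * (16 * of_nat m) ^ (2 * m))) * of_nat N ^ (2 * m + 3)"
    unfolding Amax_def by (simp add: power_mult_distrib power_add power3_eq_cube power2_eq_square mult_ac del: of_nat_Suc)
  finally show ?thesis .
qed

end

section \<open>2-adic size of the linear forms\<close>

lemma abs2_rat_of_int_eq: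
  assumes "k \<noteq> 0"
  shows "abs2_rat (of_int k) = (1 / 2) ^ multiplicity 2 k"
proof -
  have "val2_rat (of_int k) = int (multiplicity 2 k)" using val2_rat_divide[of k 1] assms by simp
  then show ?thesis using assms by (simp add: abs2_rat_def power_int_minus power_one_over inverse_eq_divide)
qed

lemma abs2_rat_not_dvd:
  assumes "\<not> 2 ^ i dvd k" "i \<ge> 1"
  shows "2 * (1 / 2) ^ i \<le> abs2_rat (of_int k)"
proof -
  have k: "k \<noteq> 0" using assms by (metis dvd_0_right)
  have "multiplicity 2 k < i" using assms(1) multiplicity_dvd'[of i 2 k] by (simp add: not_le[symmetric]) blast
  then have "(1 / 2 :: real) ^ (i - 1) \<le> (1 / 2) ^ multiplicity 2 k" by (intro half_power_le) simp
  moreover have "2 * (1 / 2 :: real) ^ i = (1 / 2) ^ (i - 1)" using assms(2) by (cases i) simp_all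
  ultimately show ?thesis using k by (simp add: abs2_rat_of_int_eq)
qed

section \<open>Taylor series of integer polynomials\<close>

definition tay :: "int poly \<Rightarrow> int \<Rightarrow> rat fps" where
  "tay q t = poly (map_poly of_int q) (lin (of_int t))"

lemma tay_0 [simp]: "tay 0 t = 0"
  by (simp add: tay_def)

lemma tay_pCons: "tay (pCons a q) t = fps_const (of_int a) + lin (of_int t) * tay q t"
  by (simp add: tay_def map_poly_pCons fps_of_int)

lemma tay_add: "tay (p + q) t = tay p t + tay q t"
proof -
  have "map_poly of_int (p + q) = (map_poly of_int p + map_poly of_int q :: rat fps poly)"
    by (rule poly_eqI) (simp add: coeff_map_poly)
  then show ?thesis by (simp add: tay_def)
qed

lemma tay_smult: "tay (smult c q) t = fps_const (of_int c) * tay q t"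
  by (induction q) (simp_all add: tay_pCons smult_pCons distrib_left mult.left_commute)

lemma tay_mult: "tay (p * q) t = tay p t * tay q t"
proof (induction p)
  case (pCons a p)
  have "tay (pCons 0 (p * q)) t = lin (of_int t) * tay (p * q) t" by (simp add: tay_pCons)
  then show ?case using pCons by (simp add: mult_pCons_left tay_add tay_smult tay_pCons distrib_right mult.assoc)
qed simp

lemma tay_const: "tay [:a:] t = fps_const (of_int a)"
  by (simp add: tay_pCons)

lemma tay_1 [simp]: "tay 1 t = 1"
  using tay_const[of 1 t] by (simp add: one_pCons)

lemma tay_power: "tay (q ^ n) t = tay q t ^ n"
  by (induction n) (simp_all add: tay_mult)

lemma tay_prod: "tay (\<Prod>i\<in>A. q i) t = (\<Prod>i\<in>A. tay (q i) t)"
  by (induction A rule: infinite_finite_induct) (simp_all add: tay_mult)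

lemma tay_sum: "tay (\<Sum>i\<in>A. q i) t = (\<Sum>i\<in>A. tay (q i) t)"
  by (induction A rule: infinite_finite_induct) (simp_all add: tay_add)

lemma tay_linear: "tay [:b, c:] t = fps_const (of_int (b + c * t)) + fps_const (of_int c) * fps_X"
  by (rule fps_ext) (auto simp: tay_pCons lin_def fps_X_def distrib_right mult.commute)

lemma tay_pcompose_linear: "tay (pcompose q [:r, n:]) t = fps_scale (of_int n) (tay q (n * t + r))"
proof (induction q)
  case 0
  show ?case by (rule fps_ext) simp
next
  case (pCons a q)
  have "fps_scale (of_int n) (lin (of_int (n * t + r))) = tay [:r, n:] t"
    unfolding fps_scale_lin tay_linear by (simp add: add.commute)
  moreover have "fps_scale c (F + G) = fps_scale c F + fps_scale c G" for c F G
    by (rule fps_ext) (simp add: distrib_left)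
  moreover have "fps_scale c (fps_const b) = fps_const b" for c b by (rule fps_ext) simp
  ultimately show ?case using pCons
    by (simp only: pcompose_pCons tay_add tay_const tay_mult tay_pCons fps_scale_mult tay_0 mult_zero_right add_0_right)
qed

lemma tay_nth_ipoly: "\<exists>q'. \<forall>t. fps_nth (tay q t) e = ipoly q' t"
proof (induction q arbitrary: e)
  case 0
  then show ?case by (intro exI[of _ 0]) (simp add: ipoly_def)
next
  case (pCons a q)
  obtain q1 where q1: "\<And>t. fps_nth (tay q t) e = ipoly q1 t" using pCons by blast
  obtain q2 where q2: "\<And>t. fps_nth (tay q t) (e - 1) = ipoly q2 t" using pCons by blast
  have "fps_nth (tay (pCons a q) t) e =
      ipoly ([:if e = 0 then a else 0:] + [:0, 1:] * q1 + (if e = 0 then 0 else q2)) t" for t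
    by (cases e) (use q1 q2 in \<open>simp_all add: tay_pCons lin_def distrib_right ipoly_def\<close>)
  then show ?case by blast
qed

lemma abs2_vmean_tay: "abs2_rat (vmean M (\<lambda>t. fps_nth (tay q t) e)) \<le> 2"
proof -
  obtain q' where "\<And>t. fps_nth (tay q t) e = ipoly q' t" using tay_nth_ipoly by blast
  then have "(\<lambda>t. fps_nth (tay q t) e) = ipoly q'" by blast
  then show ?thesis using abs2_vmean_ipoly by simp
qed

lemma lin_mult_nth_Suc: "fps_nth (lin b * G) (Suc e) = b * fps_nth G (Suc e) + fps_nth G e"
  by (simp add: lin_def distrib_right)

lemma lin_power_nth: "fps_nth (lin b ^ n) e = of_nat (n choose e) * b ^ (n - e)"
proof (induction n arbitrary: e)
  case (Suc n)
  show ?case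
  proof (cases e)
    case (Suc e')
    have "b * (of_nat (n choose Suc e') * b ^ (n - Suc e')) = of_nat (n choose Suc e') * b ^ (n - e')"
    proof (cases "e' < n")
      case True
      then have "n - e' = Suc (n - Suc e')" by simp
      then show ?thesis by simp
    qed (simp add: binomial_eq_0)
    then show ?thesis unfolding Suc power_Suc lin_mult_nth_Suc Suc.IH by (simp only:) (simp add: distrib_right)
  qed (simp add: fps_nth_power_0)
qed auto

lemma tay_monom_nth: "fps_nth (tay (monom c n) t) e = of_int c * of_nat (n choose e) * of_int t ^ (n - e)"
proof -
  have "tay (monom c n) t = fps_const (of_int c) * lin (of_int t) ^ n"
    by (simp add: tay_def map_poly_monom poly_monom fps_of_int)
  then show ?thesis by (simp add: lin_power_nth)
qed

section \<open>The mean of the dominant term\<close>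

definition mpow :: "nat \<Rightarrow> nat \<Rightarrow> rat" where "mpow M k = vmean M (\<lambda>t. of_int t ^ k)"

lemma abs2_mpow: "abs2_rat (mpow M k) \<le> 2"
proof -
  have "(\<lambda>t. of_int t ^ k) = ipoly (monom 1 k)" by (simp add: ipoly_def poly_monom fun_eq_iff)
  then show ?thesis using abs2_vmean_ipoly[of M "monom 1 k"] by (simp add: mpow_def)
qed

text \<open>The formula for sums of squares gives 6 times the mean as (2 ^ M - 1) (2 ^ (M + 1) - 1),
  which is odd for M \<ge> 1; in the limit this is B_2 = 1/6.\<close>

lemma abs2_mpow_2:
  assumes "M \<ge> 1"
  shows "abs2_rat (mpow M 2) = 2"
proof -
  have "6 * (\<Sum>k<n. of_int (int k) ^ 2) = (of_nat n * (of_nat n - 1) * (2 * of_nat n - 1) :: rat)" for n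
    by (induction n) (simp_all add: algebra_simps power2_eq_square)
  from this[of "2 ^ M"] have "6 * mpow M 2 = (2 ^ M - 1) * (2 * 2 ^ M - 1)" by (simp add: mpow_def vmean_def)
  also have "\<dots> = of_int ((2 ^ M - 1) * (2 * 2 ^ M - 1))" by simp
  finally have "abs2_rat (of_int 3 * (2 * mpow M 2)) = 1"
    using abs2_rat_odd[of "(2 ^ M - 1) * (2 * 2 ^ M - 1)"] assms by simp
  then show ?thesis using abs2_rat_odd[of 3] by (simp only: abs2_rat_mult abs2_rat_2) simp
qed

text \<open>Twice the binomial coefficient is (i + 2) (i + 1). One of the factors is odd and the
  other is smaller than 2 ^ (i + 1).\<close>

lemma not_power_dvd_choose_2:
  assumes "i \<ge> 1"
  shows "\<not> 2 ^ i dvd ((i + 2) choose 2)"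
proof
  assume "2 ^ i dvd ((i + 2) choose 2)"
  then have "2 * 2 ^ i dvd 2 * ((i + 2) choose 2)" by (rule mult_dvd_mono[OF dvd_refl])
  also have "2 * ((i + 2) choose 2) = (i + 2) * (i + 1)" by (simp add: choose_two)
  finally have d: "2 ^ Suc i dvd (i + 2) * (i + 1)" by simp
  have lt: "i + 2 < 2 ^ Suc i" using assms
  proof (induction i rule: dec_induct)
    case (step n)
    then show ?case by simp
  qed simp
  show False
  proof (cases "even i")
    case True
    then have "coprime (2 ^ Suc i) (i + 1)" by simp
    then have "2 ^ Suc i dvd i + 2" using d by (simp only: coprime_dvd_mult_left_iff)
    then show False using lt dvd_imp_le[of "2 ^ Suc i" "i + 2"] by simp
  next
    case False
    then have "coprime (2 ^ Suc i) (i + 2)" by simp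
    then have "2 ^ Suc i dvd i + 1" using d by (simp only: coprime_dvd_mult_right_iff)
    then show False using lt dvd_imp_le[of "2 ^ Suc i" "i + 1"] by simp
  qed
qed

text \<open>Equivalently, \<open>q\<close> is an integer polynomial in 2 t with odd constant
  term.\<close>

definition evp :: "int poly \<Rightarrow> bool" where
  "evp q \<longleftrightarrow> odd (coeff q 0) \<and> (\<forall>i. 2 ^ i dvd coeff q i)"

lemma evp_1: "evp 1"
  by (auto simp: evp_def coeff_1)

lemma evp_mult:
  assumes "evp p" "evp q"
  shows "evp (p * q)"
  unfolding evp_def
proof (intro conjI allI)
  show "odd (coeff (p * q) 0)" using assms by (simp add: evp_def coeff_mult)
  fix i
  show "2 ^ i dvd coeff (p * q) i"
    unfolding coeff_mult
  proof (rule dvd_sum)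
    fix k assume "k \<in> {..i}"
    then have "(2::int) ^ i = 2 ^ k * 2 ^ (i - k)" by (simp flip: power_add)
    then show "2 ^ i dvd coeff p k * coeff q (i - k)"
      using assms unfolding evp_def by (simp only:) (intro mult_dvd_mono; blast)
  qed
qed

lemma evp_power: "evp q \<Longrightarrow> evp (q ^ n)"
  by (induction n) (simp_all add: evp_1 evp_mult)

lemma evp_prod: "(\<And>i. i \<in> A \<Longrightarrow> evp (q i)) \<Longrightarrow> evp (\<Prod>i\<in>A. q i)"
  by (induction A rule: infinite_finite_induct) (simp_all add: evp_1 evp_mult)

lemma evp_linear: "odd b \<Longrightarrow> even c \<Longrightarrow> evp [:b, c:]"
  by (auto simp: evp_def coeff_pCons split: nat.splits)

text \<open>The term for \<open>i\<close> is the coefficient e_i times C(s + 2 + i, s) times the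
  mean of t ^ (i + 2). For i = 0 the size is twice that of C(s + 2, 2). For i \<ge> 1 the identity
  C(s + 2 + i, s) C(i + 2, 2) = C(s + 2, 2) C(s + 2 + i, i) bounds the binomial coefficient, 2 ^ i
  does not divide C(i + 2, 2), and 2 ^ i divides e_i; so the term is smaller at least by a factor
  2.\<close>

lemma abs2_vmean_tay_main:
  assumes e: "evp e" and M: "M \<ge> 1"
  shows "abs2_rat (vmean M (\<lambda>t. fps_nth (tay (monom 1 (s + 2) * e) t) s)) =
    2 * abs2_rat (of_nat ((s + 2) choose 2))"
proof -
  define b where "b = abs2_rat (of_nat ((s + 2) choose 2))"
  have b0: "b > 0" unfolding b_def by (rule abs2_rat_pos) simp
  define u where "u i = of_int (coeff e i) * of_nat ((s + 2 + i) choose s) * mpow M (i + 2)" for i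
  have "monom 1 (s + 2) * e = (\<Sum>i\<le>degree e. monom (coeff e i) (s + 2 + i))"
  proof -
    have "monom 1 (s + 2) * (\<Sum>i\<le>degree e. monom (coeff e i) i) = (\<Sum>i\<le>degree e. monom (coeff e i) (s + 2 + i))"
      by (simp only: sum_distrib_left mult_monom mult_1_left)
    then show ?thesis by (simp only: poly_as_sum_of_monoms)
  qed
  then have "fps_nth (tay (monom 1 (s + 2) * e) t) s =
    (\<Sum>i\<le>degree e. (of_int (coeff e i) * of_nat ((s + 2 + i) choose s)) * of_int t ^ (i + 2))" for t
    by (simp add: tay_sum fps_sum_nth tay_monom_nth add.commute)
  then have eq: "vmean M (\<lambda>t. fps_nth (tay (monom 1 (s + 2) * e) t) s) = (\<Sum>i\<le>degree e. u i)"
    by (simp only: vmean_sum vmean_scale mpow_def[symmetric] u_def)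
  have u0: "abs2_rat (u 0) = 2 * b"
  proof -
    have "abs2_rat (of_int (coeff e 0)) = 1" using e by (simp add: evp_def abs2_rat_odd)
    moreover have "(s + 2 + 0) choose s = (s + 2) choose 2" using binomial_symmetric[of s "s + 2"] by simp
    moreover have "0 + 2 = (2::nat)" by simp
    ultimately show ?thesis unfolding u_def abs2_rat_mult b_def by (simp only: abs2_mpow_2[OF M] mult_1_left mult.commute)
  qed
  have ui: "abs2_rat (u i) \<le> b" if i: "i \<ge> 1" for i
  proof -
    define c where "c = (i + 2) choose 2"
    have "((s + 2 + i) choose s) * c = ((s + 2) choose 2) * ((s + 2 + i) choose i)"
    proof -
      have "((s + 2 + i) choose (i + 2)) * ((i + 2) choose i) = ((s + 2 + i) choose i) * ((s + 2 + i - i) choose (i + 2 - i))"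
        by (rule choose_mult) simp_all
      moreover have "(s + 2 + i) choose (i + 2) = (s + 2 + i) choose s"
        using binomial_symmetric[of s "s + 2 + i"] by (simp add: add.commute)
      moreover have "(i + 2) choose i = c" using binomial_symmetric[of i "i + 2"] by (simp add: c_def)
      moreover have "s + 2 + i - i = s + 2" "i + 2 - i = 2" by simp_all
      ultimately show ?thesis by (simp only: mult.commute)
    qed
    then have "(of_nat ((s + 2 + i) choose s) :: rat) * of_nat c = of_nat ((s + 2) choose 2) * of_int (int ((s + 2 + i) choose i))"
      by (simp only: of_nat_mult[symmetric] of_int_of_nat_eq)
    then have "abs2_rat (of_nat ((s + 2 + i) choose s)) * abs2_rat (of_nat c) = b * abs2_rat (of_int (int ((s + 2 + i) choose i)))"
      unfolding b_def abs2_rat_mult[symmetric] by simp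
    also have "\<dots> \<le> b * 1" using b0 by (intro mult_left_mono abs2_rat_of_int) simp
    finally have 1: "abs2_rat (of_nat ((s + 2 + i) choose s)) * abs2_rat (of_nat c) \<le> b" by simp
    have "\<not> 2 ^ i dvd int c"
    proof
      assume "2 ^ i dvd int c"
      then have "int (2 ^ i) dvd int c" by simp
      then show False using not_power_dvd_choose_2[OF i] unfolding int_dvd_int_iff c_def by blast
    qed
    then have 2: "2 * (1 / 2) ^ i \<le> abs2_rat (of_nat c)" using abs2_rat_not_dvd[of i "int c"] i by simp
    have 3: "abs2_rat (of_int (coeff e i)) \<le> (1 / 2) ^ i" using e by (intro abs2_rat_of_int_dvd) (simp add: evp_def)
    have "abs2_rat (u i) \<le> (1 / 2) ^ i * abs2_rat (of_nat ((s + 2 + i) choose s)) * 2"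
      unfolding u_def abs2_rat_mult using 3 by (intro mult_mono abs2_mpow) simp_all
    also have "\<dots> = abs2_rat (of_nat ((s + 2 + i) choose s)) * (2 * (1 / 2) ^ i)" by simp
    also have "\<dots> \<le> abs2_rat (of_nat ((s + 2 + i) choose s)) * abs2_rat (of_nat c)"
      using 2 by (rule mult_left_mono) simp
    finally show ?thesis using 1 by linarith
  qed
  have "(\<Sum>i\<le>degree e. u i) - u 0 = (\<Sum>i\<in>{..degree e} - {0}. u i)"
    by (subst sum.remove[of "{..degree e}" 0]) simp_all
  moreover have "abs2_rat (\<Sum>i\<in>{..degree e} - {0}. u i) \<le> b"
    by (rule abs2_rat_sum_le) (use ui b0 in \<open>auto simp: Suc_le_eq\<close>)
  ultimately have "abs2_rat ((\<Sum>i\<le>degree e. u i) - u 0) < abs2_rat (u 0)" using u0 b0 by simp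
  then have "abs2_rat (\<Sum>i\<le>degree e. u i) = abs2_rat (u 0)" by (rule abs2_rat_eqI)
  then show ?thesis unfolding eq u0 b_def .
qed

lemma vmean_split:
  assumes "K \<le> M"
  shows "vmean M g = (\<Sum>r<2 ^ K. vmean (M - K) (\<lambda>t. g (2 ^ K * t + int r))) / 2 ^ K"
proof -
  have M: "(2::nat) ^ M = 2 ^ (M - K) * 2 ^ K" using assms by (simp flip: power_add)
  have "(\<Sum>k<2 ^ M. g (int k)) = (\<Sum>t<2 ^ (M - K). sum (\<lambda>k. g (int k)) {t * 2 ^ K..<t * 2 ^ K + 2 ^ K})"
    unfolding M by (rule sum.nat_group[symmetric])
  also have "\<dots> = (\<Sum>t<2 ^ (M - K). \<Sum>r<2 ^ K. g (int (t * 2 ^ K + r)))"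
  proof (rule sum.cong[OF refl])
    fix t :: nat
    show "sum (\<lambda>k. g (int k)) {t * 2 ^ K..<t * 2 ^ K + 2 ^ K} = (\<Sum>r<2 ^ K. g (int (t * 2 ^ K + r)))"
      using sum.shift_bounds_nat_ivl[of "\<lambda>k. g (int k)" 0 "t * 2 ^ K" "2 ^ K"]
      by (simp add: lessThan_atLeast0 add.commute)
  qed
  also have "\<dots> = (\<Sum>r<2 ^ K. \<Sum>t<2 ^ (M - K). g (2 ^ K * int t + int r))"
    by (subst sum.swap) (simp add: mult.commute)
  finally have "(\<Sum>k<2 ^ M. g (int k)) = (\<Sum>r<2 ^ K. \<Sum>t<2 ^ (M - K). g (2 ^ K * int t + int r))" .
  moreover have "(2::rat) ^ M = 2 ^ (M - K) * 2 ^ K" using assms by (simp flip: power_add)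
  ultimately show ?thesis by (simp add: vmean_def sum_divide_distrib)
qed

lemma prod_gcd_period:
  assumes "n > 0"
  shows "(\<Prod>x\<in>{a..<a + n}. gcd x n) = (\<Prod>x\<in>{0..<n}. gcd x (n::int))"
proof (induction a rule: int_induct[where k = 0])
  case (step1 i)
  have "{i + 1..<i + 1 + n} = insert (i + n) {i + 1..<i + n}" "{i..<i + n} = insert i {i + 1..<i + n}"
    using assms by auto
  then show ?case using step1 by simp
next
  case (step2 i)
  have "{i - 1..<i - 1 + n} = insert (i - 1) {i..<i - 1 + n}" "{i..<i + n} = insert (i - 1 + n) {i..<i - 1 + n}"
    using assms by auto
  then show ?case using step2 by simp
qed simp

text \<open>Odd \<open>x\<close> contribute 1, even \<open>x\<close> a factor 2 and the product for
  \<open>K - 1\<close>. The value is the 2-part of (2 ^ K)!.\<close>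

lemma prod_gcd_power_2: "(\<Prod>x\<in>{0..<2 ^ K}. gcd x (2 ^ K :: int)) = 2 ^ (2 ^ K - 1)"
proof -
  have "(\<Prod>x<2 ^ K. gcd (int x) (2 ^ K)) = 2 ^ (2 ^ K - 1)"
  proof (induction K)
    case (Suc K)
    have *: "(\<Prod>i<2 * R. u i) = (\<Prod>e<R. u (2 * e)) * (\<Prod>e<R. u (2 * e + 1))" for R and u :: "nat \<Rightarrow> int"
      by (induction R) (simp_all add: mult_ac)
    have "gcd (int (2 * e + 1)) (2 ^ Suc K) = 1" for e
    proof -
      have "coprime (int (2 * e + 1)) (2 ^ Suc K)" by simp
      then show ?thesis by (simp only: coprime_iff_gcd_eq_1)
    qed
    moreover have "gcd (int (2 * e)) (2 ^ Suc K) = 2 * gcd (int e) (2 ^ K)" for e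
      using gcd_mult_left[of 2 "int e" "2 ^ K"] by simp
    ultimately have "(\<Prod>x<2 ^ Suc K. gcd (int x) (2 ^ Suc K)) = 2 ^ 2 ^ K * (\<Prod>x<2 ^ K. gcd (int x) (2 ^ K))"
      unfolding power_Suc[of "2::nat"] * by (simp only: prod.distrib) simp
    also have "\<dots> = 2 ^ (2 ^ K + (2 ^ K - 1))" by (simp only: Suc power_add)
    also have "2 ^ K + (2 ^ K - 1) = 2 ^ Suc K - (1::nat)"
    proof -
      have "(2::nat) ^ K \<ge> 1" by simp
      then show ?thesis unfolding power_Suc by linarith
    qed
    finally show ?case .
  qed simp
  moreover have "(\<Prod>x\<in>{0..<2 ^ K}. gcd x (2 ^ K :: int)) = (\<Prod>x<2 ^ K. gcd (int x) (2 ^ K))"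
    by (rule prod.reindex_bij_witness[of _ int nat]) (auto simp: nat_less_iff)
  ultimately show ?thesis by simp
qed

lemma pcompose_power: "pcompose (p ^ n) q = pcompose p q ^ n"
  by (induction n) (simp_all add: pcompose_mult pcompose_1)

lemma fps_denom_add:
  assumes "prime p" "fps_denom p e F" "fps_denom p e G"
  shows "fps_denom p e (F + G)"
  using assms Zloc_add[OF assms(1)] by (simp add: fps_denom_def distrib_left)

lemma fps_denom_tay: "fps_denom 2 1 (tay q t)"
  unfolding fps_denom_def
proof
  fix l
  obtain q' where "fps_nth (tay q t) l = ipoly q' t" using tay_nth_ipoly by blast
  then show "of_nat 1 ^ l * fps_nth (tay q t) l \<in> Zloc 2" by (simp add: ipoly_def Zloc_of_int)
qed

definition one_mod :: "nat \<Rightarrow> rat fps \<Rightarrow> bool" where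
  "one_mod e G \<longleftrightarrow> (\<exists>Q. fps_denom 2 1 Q \<and> G = 1 + fps_const (2 ^ e) * Q)"

lemma one_mod_1: "one_mod e 1"
proof -
  have "fps_denom 2 1 0" by (simp add: fps_denom_def Zloc_0)
  then show ?thesis unfolding one_mod_def by (intro exI[of _ 0]) simp
qed

lemma one_mod_mult:
  assumes "one_mod e F" "one_mod e G"
  shows "one_mod e (F * G)"
proof -
  obtain Q R where Q: "fps_denom 2 1 Q" "F = 1 + fps_const (2 ^ e) * Q" and R: "fps_denom 2 1 R" "G = 1 + fps_const (2 ^ e) * R"
    using assms unfolding one_mod_def by blast
  define W where "W = Q + R + fps_const (2 ^ e) * (Q * R)"
  have "(2::rat) ^ e = of_int (2 ^ e)" by simp
  then have "(2::rat) ^ e \<in> Zloc 2" using Zloc_of_int[of 2 "2 ^ e"] by (simp only: two_is_prime_nat)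
  then have "fps_denom 2 1 W" unfolding W_def
    by (intro fps_denom_add fps_denom_mult fps_denom_const Q R two_is_prime_nat)
  moreover have "F * G = 1 + fps_const (2 ^ e) * W" unfolding Q(2) R(2) W_def by (simp add: algebra_simps)
  ultimately show ?thesis unfolding one_mod_def by blast
qed

lemma one_mod_prod: "(\<And>i. i \<in> A \<Longrightarrow> one_mod e (f i)) \<Longrightarrow> one_mod e (\<Prod>i\<in>A. f i)"
  by (induction A rule: infinite_finite_induct) (simp_all add: one_mod_1 one_mod_mult)

lemma one_mod_power: "one_mod e G \<Longrightarrow> one_mod e (G ^ n)"
  by (induction n) (simp_all add: one_mod_1 one_mod_mult)

lemma one_mod_square:
  assumes "one_mod (Suc e) G"
  shows "one_mod (Suc (Suc e)) (G * G)"
proof -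
  obtain Q where Q: "fps_denom 2 1 Q" "G = 1 + fps_const (2 ^ Suc e) * Q"
    using assms unfolding one_mod_def by blast
  define W where "W = Q + fps_const (2 ^ e) * (Q * Q)"
  have "(2::rat) ^ e = of_int (2 ^ e)" by simp
  then have "(2::rat) ^ e \<in> Zloc 2" using Zloc_of_int[of 2 "2 ^ e"] by (simp only: two_is_prime_nat)
  then have "fps_denom 2 1 W" unfolding W_def
    by (intro fps_denom_add fps_denom_mult fps_denom_const Q two_is_prime_nat)
  moreover have "G * G = 1 + fps_const (2 ^ Suc (Suc e)) * W"
  proof -
    have c: "fps_const (2 ^ Suc (Suc e)) = (2 :: rat fps) * fps_const (2 ^ Suc e)"
      "fps_const (2 ^ Suc e) = (2 :: rat fps) * fps_const (2 ^ e)"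
      by (simp_all add: fps_numeral_fps_const)
    show ?thesis unfolding Q(2) W_def c by (simp add: algebra_simps)
  qed
  ultimately show ?thesis unfolding one_mod_def by blast
qed

text \<open>Each squaring gains a factor 2: the power series version of
  \<open>odd_power_cong_1\<close>, and the reason why an inverse power can be replaced by a positive
  one.\<close>

lemma one_mod_power_2: "one_mod 1 G \<Longrightarrow> one_mod (Suc L) (G ^ (2 ^ L))"
proof (induction L)
  case (Suc L)
  have "G ^ (2 ^ Suc L) = G ^ (2 ^ L) * G ^ (2 ^ L)" by (simp only: power_Suc mult_2 power_add)
  then show ?case using one_mod_square[OF Suc.IH[OF Suc.prems]] by (simp only:)
qed simp

lemma gcd_power_2_quotients:
  fixes x :: int
  assumes "x \<noteq> 0" "\<bar>x\<bar> < 2 ^ K"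
  shows "even (2 ^ K div gcd x (2 ^ K))" "odd (x div gcd x (2 ^ K))"
proof -
  define g where "g = gcd x (2 ^ K)"
  have g0: "g > 0" using assms(1) by (simp add: g_def)
  have "g \<le> \<bar>x\<bar>" unfolding g_def using assms(1) by (intro zdvd_imp_le) simp_all
  then have gl: "g < 2 ^ K" using assms(2) by simp
  have gd: "g dvd 2 ^ K" by (simp add: g_def)
  then have eq: "2 ^ K = g * (2 ^ K div g)" by simp
  show e: "even (2 ^ K div gcd x (2 ^ K))"
  proof (rule ccontr)
    assume "odd (2 ^ K div gcd x (2 ^ K))"
    then have "coprime (2 ^ K div g) (2 ^ K)" by (simp add: g_def)
    moreover have "2 ^ K div g dvd 2 ^ K" using eq by (metis dvd_triv_right)
    ultimately have "is_unit (2 ^ K div g)" by (rule coprime_common_divisor[OF _ dvd_refl])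
    moreover have "2 ^ K div g > 0" using g0 gl by (simp add: pos_imp_zdiv_pos_iff)
    ultimately have "2 ^ K div g = 1" by simp
    then show False using eq gl by simp
  qed
  have cop: "coprime (x div gcd x (2 ^ K)) (2 ^ K div gcd x (2 ^ K))" using assms(1) by (intro div_gcd_coprime) simp
  have "even (x div gcd x (2 ^ K)) \<Longrightarrow> is_unit (2::int)" by (rule coprime_common_divisor[OF cop _ e])
  then show "odd (x div gcd x (2 ^ K))" by auto
qed

lemma prod_smult_poly:
  "(\<Prod>i\<in>A. smult (c i) (q i)) = smult (\<Prod>i\<in>A. c i) (\<Prod>i\<in>A. q i)" for q :: "'a \<Rightarrow> int poly"
  by (induction A rule: infinite_finite_induct) (simp_all add: mult.commute)

lemma choose_2_less_power: "n choose 2 < 2 ^ n"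
proof (induction n)
  case (Suc n)
  have "Suc n choose 2 = (n choose 2) + n" by (simp add: numeral_2_eq_2)
  moreover have "n < 2 ^ n" by (rule less_exp)
  ultimately show ?case using Suc unfolding power_Suc by linarith
qed simp

section \<open>Exact 2-adic size of the integral\<close>

context zeta_construction
begin

text \<open>The numerator in terms of t, with constants removed: for y = 4 t + 1 the factors are y -
  (4 j + 1) = 4 (t - j) and y + (4 j + 1) = 2 (2 t + 2 j + 1), so each j in \<open>J\<close> leaves
  a constant 8.\<close>

definition hnum :: "int poly" where
  "hnum = (\<Prod>j\<in>J. [:- j, 1:]) ^ m * ([:1, 4:] ^ sg * (\<Prod>j\<in>J. [:2 * j + 1, 2:]) ^ m)"

definition Y :: "int poly" where "Y = (\<Prod>\<kappa>\<in>I. [:1 - 4 * \<kappa>, 4:])"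

text \<open>The integer polynomial that stands for the rational function up to 2-adic precision L:
  since Y ^ (2 ^ L) is close to 1, the positive power of \<open>Y\<close> replaces Y ^ (- 2
  m).\<close>

definition h :: "nat \<Rightarrow> int poly" where "h L = hnum * Y ^ (2 * m * (2 ^ L - 1))"

lemma card_J: "card J = 2 * N - 1"
  using N_pos by (simp add: J_def)

text \<open>\<open>V\<close> is the expansion of 1 / Y. It is integral at 2, because 4 t + 1 - 4
  \<kappa> is odd.\<close>

lemma scale_f:
  "\<exists>V. fps_denom 2 1 V \<and> V * tay Y t = 1 \<and>
    fps_scale 4 (f (4 * t + 1)) = fps_const (8 ^ (m * card J)) * (tay hnum t * V ^ (2 * m))"
proof -
  define V where "V = (\<Prod>\<kappa>\<in>I. fps_scale 4 (inverse (lin (of_int (4 * t + 1 - 4 * \<kappa>)))))"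
  have odd: "odd (4 * t + 1 - 4 * \<kappa>)" for \<kappa> by simp
  have nz: "(of_int (4 * t + 1 - 4 * \<kappa>) :: rat) \<noteq> 0" for \<kappa>
    using odd[of \<kappa>] unfolding of_int_eq_0_iff by (metis even_zero)
  have scl: "fps_scale 4 (lin (of_int (4 * t + 1 - 4 * \<kappa>))) = tay [:1 - 4 * \<kappa>, 4:] t" for \<kappa>
    unfolding fps_scale_lin tay_linear by (simp add: algebra_simps)
  have "fps_denom 2 1 V"
    unfolding V_def
  proof (rule fps_denom_prod[OF two_is_prime_nat])
    fix \<kappa>
    define b where "b = 4 * t + 1 - 4 * \<kappa>"
    show "fps_denom 2 1 (fps_scale 4 (inverse (lin (of_int (4 * t + 1 - 4 * \<kappa>)))))"
      unfolding fps_denom_def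
    proof
      fix l
      have "fps_nth (inverse (lin (of_int b)) ^ 1) l = lin_inverse_coeff (of_int b) 1 l"
        by (rule lin_inverse_power_nth) (use nz in \<open>simp add: b_def\<close>)
      then have "of_nat 1 ^ l * fps_nth (fps_scale 4 (inverse (lin (of_int b)))) l = of_int (4 ^ l * (- 1) ^ l) / of_int (b ^ (1 + l))"
        by (simp add: lin_inverse_coeff_def)
      moreover have "\<not> int 2 dvd b ^ (1 + l)" using odd[of \<kappa>] by (simp add: b_def)
      ultimately show "of_nat 1 ^ l * fps_nth (fps_scale 4 (inverse (lin (of_int (4 * t + 1 - 4 * \<kappa>))))) l \<in> Zloc 2"
        unfolding b_def[symmetric] using Zloc_divide_unit[OF two_is_prime_nat Zloc_of_int[OF two_is_prime_nat]] by (simp only:)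
    qed
  qed
  moreover have "V * tay Y t = 1"
  proof -
    have "inverse (lin (of_int (4 * t + 1 - 4 * \<kappa>))) * lin (of_int (4 * t + 1 - 4 * \<kappa>)) = 1" for \<kappa>
      by (rule inverse_mult_eq_1) (use nz in \<open>simp only: lin_nth_0 not_False_eq_True\<close>)
    then have "fps_scale 4 (inverse (lin (of_int (4 * t + 1 - 4 * \<kappa>)))) * tay [:1 - 4 * \<kappa>, 4:] t = 1" for \<kappa>
      unfolding scl[symmetric] fps_scale_mult[symmetric] by (simp only: fps_scale_1)
    then show ?thesis unfolding V_def Y_def tay_prod prod.distrib[symmetric] by (simp only: prod.neutral_const)
  qed
  moreover have "fps_scale 4 (f (4 * t + 1)) = fps_const (8 ^ (m * card J)) * (tay hnum t * V ^ (2 * m))"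
  proof -
    have 1: "fps_scale 4 (lin (of_int (4 * t + 1 - (4 * j + 1)))) = fps_const 4 * tay [:- j, 1:] t" for j
      unfolding fps_scale_lin tay_linear by (simp add: distrib_left fps_const_mult[symmetric] del: fps_const_mult)
    have 2: "fps_scale 4 (lin (of_int (4 * t + 1 - - (4 * j + 1)))) = fps_const 2 * tay [:2 * j + 1, 2:] t" for j
      unfolding fps_scale_lin tay_linear distrib_left fps_const_mult mult.assoc[symmetric]
      by (simp add: algebra_simps)
    have 3: "fps_scale 4 (lin (of_int (4 * t + 1))) = tay [:1, 4:] t"
      unfolding fps_scale_lin tay_linear by (simp add: algebra_simps)
    have pc: "(\<Prod>j\<in>B. fps_const c * g j) = fps_const (c ^ card B) * (\<Prod>j\<in>B. g j)" for B c and g :: "int \<Rightarrow> rat fps"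
      by (simp add: prod.distrib fps_const_power[symmetric] del: fps_const_power)
    have "(\<Prod>i<T. fps_scale 4 (lin (of_int (4 * t + 1 - xi i)))) =
      fps_const (8 ^ card J) * ((\<Prod>j\<in>J. tay [:- j, 1:] t) * (\<Prod>j\<in>J. tay [:2 * j + 1, 2:] t))"
    proof -
      have "fps_const ((8::rat) ^ card J) = fps_const (4 ^ card J) * fps_const (2 ^ card J)"
        by (simp flip: power_mult_distrib)
      then show ?thesis unfolding prod_xi[of "\<lambda>x. fps_scale 4 (lin (of_int (4 * t + 1 - x)))"] 1 2 pc by (simp only: mult_ac)
    qed
    moreover have "fps_const (8 ^ (m * card J)) = fps_const ((8::rat) ^ card J) ^ m"
      by (simp only: fps_const_power power_mult[symmetric] mult.commute)
    ultimately show ?thesis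
      unfolding f_def fps_scale_mult fps_scale_power fps_scale_prod 3 V_def[symmetric] hnum_def tay_mult tay_power tay_prod
      by (simp only: power_mult_distrib mult_ac)
  qed
  ultimately show ?thesis by blast
qed

lemma one_mod_Y: "one_mod 1 (tay Y t)"
  unfolding Y_def tay_prod
proof (rule one_mod_prod)
  fix \<kappa> :: int
  have "[:1 - 4 * \<kappa>, 4:] = 1 + smult 2 [:- 2 * \<kappa>, 2:]" by (simp add: one_pCons)
  then have "tay [:1 - 4 * \<kappa>, 4:] t = 1 + fps_const (2 ^ 1) * tay [:- 2 * \<kappa>, 2:] t"
    by (simp only: tay_add tay_smult tay_1) simp
  then show "one_mod 1 (tay [:1 - 4 * \<kappa>, 4:] t)" unfolding one_mod_def using fps_denom_tay by blast
qed

lemma F_approx: "abs2_rat (4 ^ s * F t - 8 ^ (m * card J) * fps_nth (tay (h L) t) s) \<le> (1 / 2) ^ L"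
proof -
  obtain V where V: "fps_denom 2 1 V" "V * tay Y t = 1"
    "fps_scale 4 (f (4 * t + 1)) = fps_const (8 ^ (m * card J)) * (tay hnum t * V ^ (2 * m))"
    using scale_f by blast
  define U where "U = tay Y t"
  have "one_mod (Suc L) ((U ^ (2 * m)) ^ (2 ^ L))"
    unfolding U_def by (intro one_mod_power_2 one_mod_power one_mod_Y)
  then obtain Q where Q: "fps_denom 2 1 Q" "(U ^ (2 * m)) ^ (2 ^ L) = 1 + fps_const (2 ^ Suc L) * Q"
    unfolding one_mod_def by blast
  have "U ^ (2 * m * (2 ^ L - 1)) = V ^ (2 * m) * (U ^ (2 * m)) ^ (2 ^ L)"
  proof -
    have e: "(2::nat) ^ L = 1 + (2 ^ L - 1)" by simp
    have "V ^ (2 * m) * (U ^ (2 * m)) ^ (2 ^ L) = (V * U) ^ (2 * m) * (U ^ (2 * m)) ^ (2 ^ L - 1)"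
      by (subst e) (simp only: power_add power_one_right power_mult_distrib mult.assoc)
    then show ?thesis using V(2) by (simp add: U_def power_mult)
  qed
  then have "tay (h L) t = tay hnum t * (V ^ (2 * m) * (1 + fps_const (2 ^ Suc L) * Q))"
    by (simp only: h_def tay_mult tay_power U_def[symmetric] Q(2))
  then have eq: "fps_scale 4 (f (4 * t + 1)) - fps_const (8 ^ (m * card J)) * tay (h L) t =
    fps_const (2 ^ Suc L) * - (fps_const (8 ^ (m * card J)) * (tay hnum t * V ^ (2 * m) * Q))"
    unfolding V(3) by (simp add: algebra_simps del: power_Suc)
  define W where "W = fps_nth (fps_const (8 ^ (m * card J)) * (tay hnum t * V ^ (2 * m) * Q)) s"
  have "(8::rat) ^ (m * card J) = of_int (8 ^ (m * card J))" by simp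
  then have "(8::rat) ^ (m * card J) \<in> Zloc 2" using Zloc_of_int[of 2 "8 ^ (m * card J)"] by (simp only: two_is_prime_nat)
  then have "fps_denom 2 1 (fps_const (8 ^ (m * card J)) * (tay hnum t * V ^ (2 * m) * Q))"
    by (intro fps_denom_mult fps_denom_const fps_denom_power V Q fps_denom_tay two_is_prime_nat)
  then have W: "W \<in> Zloc 2" unfolding fps_denom_def W_def by (metis of_nat_1 power_one mult_1_left)
  have "4 ^ s * F t - 8 ^ (m * card J) * fps_nth (tay (h L) t) s = 2 ^ Suc L * - W"
    using arg_cong[OF eq, of "\<lambda>G. fps_nth G s"] by (simp add: F_def W_def del: power_Suc)
  then have "abs2_rat (4 ^ s * F t - 8 ^ (m * card J) * fps_nth (tay (h L) t) s) = (1 / 2) ^ Suc L * abs2_rat W"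
    by (simp only: abs2_rat_mult abs2_rat_power abs2_rat_2 abs2_rat_minus)
  also have "\<dots> \<le> (1 / 2) ^ L * 1"
    using abs2_rat_le_1_if_Zloc[OF W] by (intro mult_mono) simp_all
  finally show ?thesis by simp
qed

text \<open>The content of the product of the linear polynomials \<open>[:i - j, int N:]\<close>,
  that is, the power of 2 gained on the residue class of \<open>i\<close> modulo
  \<open>N\<close>.\<close>

definition C :: "int \<Rightarrow> int" where "C i = (\<Prod>j\<in>J. gcd (i - j) (int N))"

lemma int_N: "int N = 2 ^ K"
  by (simp add: N_def)

text \<open>The differences i - j fill an interval of length 2 N - 1: two full periods modulo
  \<open>N\<close> from which the residue of \<open>i\<close> has been dropped once. Each period
  contributes 2 ^ (N - 1).\<close>

lemma C_mult_gcd: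
  assumes "0 \<le> i" "i < int N"
  shows "C i * gcd i (int N) = 4 ^ (N - 1)"
proof -
  have n: "int N > 0" using N_pos by simp
  have G: "(\<Prod>x\<in>{b..<b + int N}. gcd x (int N)) = 2 ^ (N - 1)" for b
    using prod_gcd_power_2[of K, folded int_N N_def] by (simp only: prod_gcd_period[OF n])
  have "C i = (\<Prod>x\<in>{i - int N + 1..i + int N - 1}. gcd x (int N))"
    unfolding C_def by (rule prod.reindex_bij_witness[of _ "\<lambda>x. i - x" "\<lambda>x. i - x"]) (auto simp: J_def)
  also have "{i - int N + 1..i + int N - 1} = {i - int N + 1..<i - int N + 1 + int N} \<union> {i + 1..<i + int N}" using n by auto
  also have "(\<Prod>x\<in>{i - int N + 1..<i - int N + 1 + int N} \<union> {i + 1..<i + int N}. gcd x (int N)) =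
    (\<Prod>x\<in>{i - int N + 1..<i - int N + 1 + int N}. gcd x (int N)) * (\<Prod>x\<in>{i + 1..<i + int N}. gcd x (int N))"
    by (rule prod.union_disjoint) auto
  also have "(\<Prod>x\<in>{i - int N + 1..<i - int N + 1 + int N}. gcd x (int N)) = 2 ^ (N - 1)" by (rule G)
  finally have C: "C i = 2 ^ (N - 1) * (\<Prod>x\<in>{i + 1..<i + int N}. gcd x (int N))" .
  have "{i..<i + int N} = insert i {i + 1..<i + int N}" using n by auto
  then have "gcd i (int N) * (\<Prod>x\<in>{i + 1..<i + int N}. gcd x (int N)) = 2 ^ (N - 1)"
    using G[of i] by simp
  then have "C i * gcd i (int N) = 2 ^ (N - 1) * 2 ^ (N - 1)" unfolding C by (simp add: mult_ac)
  then show ?thesis by (simp flip: power_mult_distrib)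
qed

lemma prod_linear_gcd:
  "(\<Prod>j\<in>B. [:i - j, int N:]) = smult (\<Prod>j\<in>B. gcd (i - j) (int N))
    (\<Prod>j\<in>B. [:(i - j) div gcd (i - j) (int N), int N div gcd (i - j) (int N):])"
  by (simp flip: prod_smult_poly)

definition grest :: "nat \<Rightarrow> int poly" where
  "grest L = [:1, 4:] ^ sg * (\<Prod>j\<in>J. [:2 * j + 1, 2:]) ^ m * Y ^ (2 * m * (2 ^ L - 1))"

lemma pcompose_h: "pcompose (h L) [:i, int N:] = (\<Prod>j\<in>J. [:i - j, int N:]) ^ m * pcompose (grest L) [:i, int N:]"
  by (simp add: h_def hnum_def grest_def pcompose_mult pcompose_power pcompose_prod pcompose_pCons mult.assoc)

lemma evp_grest: "evp (pcompose (grest L) [:0, int N:])"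
  unfolding grest_def Y_def pcompose_mult pcompose_power pcompose_prod
  by (intro evp_mult evp_power evp_prod) (simp_all add: pcompose_pCons evp_linear)

text \<open>On splitting \<open>t\<close> into residue classes modulo \<open>N\<close>, the class of 0 dominates 2-adically: every other class
  contributes an additional factor \<open>2 ^ m\<close>.\<close>

lemma pcompose_h_0: "\<exists>e. evp e \<and> pcompose (h L) [:0, int N:] = smult (C 0 ^ m) (monom 1 m * e)"
proof -
  define e where "e = (\<Prod>j\<in>J - {0}. [:(0 - j) div gcd (0 - j) (int N), int N div gcd (0 - j) (int N):])"
  have "0 \<in> J" using N_pos by (simp add: J_def)
  then have J0: "(\<Prod>j\<in>J. g j) = g 0 * (\<Prod>j\<in>J - {0}. g j)" for g :: "int \<Rightarrow> 'b :: comm_monoid_mult"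
    by (rule prod.remove[OF finite_J])
  have "evp e" unfolding e_def
  proof (intro evp_prod evp_linear)
    fix j assume j: "j \<in> J - {0}"
    then have "0 - j \<noteq> 0" "\<bar>0 - j\<bar> < 2 ^ K" by (auto simp: J_def simp flip: int_N)
    note q = gcd_power_2_quotients[OF this]
    show "odd ((0 - j) div gcd (0 - j) (int N))" using q(2) unfolding int_N .
    show "even (int N div gcd (0 - j) (int N))" using q(1) unfolding int_N .
  qed
  moreover have "(\<Prod>j\<in>J. [:0 - j, int N:]) = smult (C 0) (monom 1 1 * e)"
  proof -
    have "(\<Prod>j\<in>J. [:0 - j, int N:]) = [:0 - 0, int N:] * (\<Prod>j\<in>J - {0}. [:0 - j, int N:])" by (rule J0)
    then have "(\<Prod>j\<in>J. [:0 - j, int N:]) = [:0, int N:] * smult (\<Prod>j\<in>J - {0}. gcd (0 - j) (int N)) e"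
      unfolding prod_linear_gcd[of _ "J - {0}"] e_def diff_self .
    moreover have "[:0, int N:] = smult (int N) (monom 1 1)" by (simp add: monom_altdef)
    moreover have "C 0 = int N * (\<Prod>j\<in>J - {0}. gcd (0 - j) (int N))" unfolding C_def J0 by simp
    ultimately show ?thesis by (simp add: mult_ac)
  qed
  ultimately have "pcompose (h L) [:0, int N:] = smult (C 0 ^ m) (monom 1 m * (e ^ m * pcompose (grest L) [:0, int N:]))"
    unfolding pcompose_h by (simp add: smult_power power_mult_distrib monom_power mult.assoc)
  moreover have "evp (e ^ m * pcompose (grest L) [:0, int N:])"
    by (intro evp_mult evp_power evp_grest) fact
  ultimately show ?thesis by blast
qed

lemma C_0_pos: "C 0 > 0"
  unfolding C_def using N_pos by (intro prod_pos) simp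

text \<open>By \<open>C_mult_gcd\<close>, C i is C 0 times N / gcd i N, and this quotient is even
  for 0 < i < N.\<close>

lemma pcompose_h_pos:
  assumes "0 < i" "i < int N"
  shows "\<exists>w. pcompose (h L) [:i, int N:] = smult ((2 * C 0) ^ m) w"
proof -
  define g where "g = gcd i (int N)"
  have g0: "g \<noteq> 0" using assms by (simp add: g_def)
  have "even (int N div g)" unfolding g_def int_N by (rule gcd_power_2_quotients) (use assms in \<open>simp_all flip: int_N\<close>)
  then obtain c where c: "int N div g = 2 * c" by (rule evenE)
  have "g dvd int N" by (simp add: g_def)
  then have Ng: "int N = g * (2 * c)" using c by (metis dvd_mult_div_cancel)
  have "C i * g = C 0 * int N"
    using C_mult_gcd[of i] C_mult_gcd[of 0] assms N_pos by (simp add: g_def)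
  then have "C i * g = (2 * C 0 * c) * g" unfolding Ng by (simp add: mult_ac)
  then have "C i = 2 * C 0 * c" using g0 by simp
  then show ?thesis
    unfolding pcompose_h prod_linear_gcd C_def[symmetric]
    by (intro exI[of _ "smult (c ^ m) _"]) (simp add: smult_power power_mult_distrib)
qed

lemma tay_h_split: "fps_nth (tay (h L) (2 ^ K * t + i)) s = fps_nth (tay (pcompose (h L) [:i, int N:]) t) s / of_nat N ^ s"
  using N_pos by (simp add: tay_pcompose_linear int_N) (simp add: N_def)

text \<open>The factors come from the scaling by 4 of coefficients of order s, the constants 8, the
  division by N ^ s on a residue class together with the averaging over the N classes, the content C
  0, and the mean of the dominant term.\<close>

definition \<Lambda> :: real where
  "\<Lambda> = 4 ^ s * (1 / 8) ^ (m * card J) * real N ^ (s + 1) * abs2_rat (of_int (C 0)) ^ m * (2 * abs2_rat (of_nat (m choose 2)))"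

lemma abs2_rat_N: "abs2_rat (of_nat N) = 1 / real N"
  by (simp add: N_def abs2_rat_power abs2_rat_2 power_one_over)

lemma \<Lambda>_pos: "\<Lambda> > 0"
proof -
  have "abs2_rat (of_nat (m choose 2)) > 0" using m_ge by (intro abs2_rat_pos) simp
  moreover have "abs2_rat (of_int (C 0)) > 0" using C_0_pos by (intro abs2_rat_pos) simp
  ultimately show ?thesis unfolding \<Lambda>_def using N_pos by (intro mult_pos_pos zero_less_power) simp_all
qed

text \<open>Class 0 has size \<open>c ^ m * (2 * b)\<close>, the other classes at most
  \<open>c ^ m * (2 * (1 / 2) ^ m)\<close>. This is strictly smaller, since m choose 2 is below 2 ^
  m and hence not divisible by it; so class 0 alone determines the size.\<close>

lemma abs2_vmean_h:
  assumes M: "M > K"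
  shows "abs2_rat (8 ^ (m * card J) * vmean M (\<lambda>t. fps_nth (tay (h L) t) s)) = \<Lambda> / 4 ^ s"
proof -
  define b where "b = abs2_rat (of_nat (m choose 2))"
  define c where "c = abs2_rat (of_int (C 0))"
  define v where "v i = vmean (M - K) (\<lambda>t. fps_nth (tay (pcompose (h L) [:int i, int N:]) t) s)" for i
  have c0: "c > 0" unfolding c_def using C_0_pos by (intro abs2_rat_pos) simp
  have "vmean M (\<lambda>t. fps_nth (tay (h L) t) s) = (\<Sum>i<2 ^ K. v i / of_nat N ^ s) / 2 ^ K"
    unfolding vmean_split[OF less_imp_le[OF M]] tay_h_split v_def
    using vmean_scale[of "M - K" "1 / of_nat N ^ s"] by simp
  also have "\<dots> = (\<Sum>i<N. v i) / of_nat N ^ (s + 1)" by (simp add: N_def sum_divide_distrib[symmetric] mult.commute)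
  finally have 1: "vmean M (\<lambda>t. fps_nth (tay (h L) t) s) = (\<Sum>i<N. v i) / of_nat N ^ (s + 1)" .
  have v0: "abs2_rat (v 0) = c ^ m * (2 * b)"
  proof -
    obtain e where e: "evp e" "pcompose (h L) [:0, int N:] = smult (C 0 ^ m) (monom 1 m * e)"
      using pcompose_h_0 by blast
    have "v 0 = of_int (C 0 ^ m) * vmean (M - K) (\<lambda>t. fps_nth (tay (monom 1 (s + 2) * e) t) s)"
      unfolding v_def of_nat_0 e(2) by (simp add: tay_smult m_def flip: vmean_scale)
    moreover have "abs2_rat (vmean (M - K) (\<lambda>t. fps_nth (tay (monom 1 (s + 2) * e) t) s)) = 2 * b"
      using abs2_vmean_tay_main[OF e(1), of "M - K" s] M by (simp add: b_def m_def)
    ultimately show ?thesis by (simp add: abs2_rat_mult abs2_rat_power c_def)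
  qed
  have vi: "abs2_rat (v i) \<le> c ^ m * (2 * (1 / 2) ^ m)" if "i \<in> {1..<N}" for i
  proof -
    have "0 < int i" "int i < int N" using that by auto
    from pcompose_h_pos[OF this] obtain w where w: "pcompose (h L) [:int i, int N:] = smult ((2 * C 0) ^ m) w"
      by blast
    have "v i = of_int ((2 * C 0) ^ m) * vmean (M - K) (\<lambda>t. fps_nth (tay w t) s)"
      unfolding v_def w by (simp add: tay_smult flip: vmean_scale)
    then have "abs2_rat (v i) = c ^ m * (1 / 2) ^ m * abs2_rat (vmean (M - K) (\<lambda>t. fps_nth (tay w t) s))"
      by (simp add: abs2_rat_mult abs2_rat_power abs2_rat_2 c_def power_mult_distrib)
    also have "\<dots> \<le> c ^ m * (1 / 2) ^ m * 2" using c0 by (intro mult_left_mono abs2_vmean_tay) simp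
    finally show ?thesis by simp
  qed
  have b: "(1 / 2) ^ m < b"
  proof -
    have "\<not> 2 ^ m dvd int (m choose 2)"
    proof
      assume "2 ^ m dvd int (m choose 2)"
      then have "int (2 ^ m) dvd int (m choose 2)" by simp
      then have "2 ^ m dvd (m choose 2)" by (simp only: int_dvd_int_iff)
      then have "2 ^ m \<le> (m choose 2)" using m_ge by (intro dvd_imp_le) simp_all
      then show False using choose_2_less_power[of m] by simp
    qed
    then have "2 * (1 / 2) ^ m \<le> abs2_rat (of_int (int (m choose 2)))" using m_ge by (intro abs2_rat_not_dvd) simp_all
    moreover have "(1 / 2 :: real) ^ m > 0" by simp
    ultimately show ?thesis unfolding b_def of_int_of_nat_eq by linarith
  qed
  have D: "(\<Sum>i<N. v i) - v 0 = (\<Sum>i\<in>{1..<N}. v i)"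
  proof -
    have "{..<N} = insert 0 {1..<N}" using N_pos by auto
    then show ?thesis by simp
  qed
  have "abs2_rat (\<Sum>i\<in>{1..<N}. v i) \<le> c ^ m * (2 * (1 / 2) ^ m)"
    by (rule abs2_rat_sum_le[OF vi]) (use c0 in simp_all)
  also have "c ^ m * (2 * (1 / 2) ^ m) < c ^ m * (2 * b)" using b c0 by (intro mult_strict_left_mono) simp_all
  finally have "abs2_rat ((\<Sum>i<N. v i) - v 0) < abs2_rat (v 0)" unfolding v0 D .
  then have "abs2_rat (\<Sum>i<N. v i) = c ^ m * (2 * b)" unfolding v0[symmetric] by (rule abs2_rat_eqI)
  moreover have e8: "abs2_rat 8 = 1 / 8"
    using abs2_rat_power[of 2 3] by (simp add: abs2_rat_2 power_one_over)
  ultimately show ?thesis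
    unfolding 1 abs2_rat_mult abs2_rat_divide abs2_rat_power abs2_rat_N e8 \<Lambda>_def b_def[symmetric] c_def[symmetric]
    by (simp add: power_one_over field_simps)
qed

text \<open>Averaging over \<open>2 ^ M\<close> points costs a factor \<open>2 ^ M\<close>, so the polynomial that approximates \<open>F\<close> has to
  depend on \<open>M\<close>.\<close>

lemma abs2_vmean_F:
  assumes M: "M > K"
  shows "abs2_rat (vmean M F) = \<Lambda>"
proof -
  have L4: "\<Lambda> / 4 ^ s > 0" using \<Lambda>_pos by simp
  then obtain L where L: "(1 / 2) ^ L < \<Lambda> / 4 ^ s" using real_arch_pow_inv[of "\<Lambda> / 4 ^ s" "1 / 2"] by auto
  define H where "H = (\<lambda>t. fps_nth (tay (h (L + M)) t) s)"
  have "abs2_rat (vmean M (\<lambda>t. 4 ^ s * F t - 8 ^ (m * card J) * H t)) \<le> (1 / 2) ^ L"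
    unfolding H_def by (rule abs2_vmean_le) (rule F_approx)
  then have "abs2_rat (4 ^ s * vmean M F - 8 ^ (m * card J) * vmean M H) \<le> (1 / 2) ^ L"
    by (simp only: vmean_diff vmean_scale)
  moreover have v: "abs2_rat (8 ^ (m * card J) * vmean M H) = \<Lambda> / 4 ^ s" unfolding H_def by (rule abs2_vmean_h[OF M])
  ultimately have "abs2_rat (4 ^ s * vmean M F) = \<Lambda> / 4 ^ s"
    using L by (subst v[symmetric]) (intro abs2_rat_eqI; linarith)
  moreover have "abs2_rat 4 = 1 / 4"
    using abs2_rat_power[of 2 2] by (simp add: abs2_rat_2 power_one_over)
  ultimately show ?thesis by (simp add: abs2_rat_mult abs2_rat_power power_one_over)
qed

text \<open>The exponent splits as 8 m N = 5 m + 3 m (2 N - 1) + 2 m (N - 1): the constants 8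
  account for the second part, C 0 = 4 ^ (N - 1) / N for the third.\<close>

lemma \<Lambda>_le: "\<Lambda> * 2 ^ (8 * m * N) \<le> 2 * 4 ^ s * real N ^ (s + 1 + m) * 2 ^ (5 * m)"
proof -
  have "C 0 * int N = 4 ^ (N - 1)" using C_mult_gcd[of 0] N_pos by simp
  then have "(of_int (C 0) :: rat) * of_nat N = 4 ^ (N - 1)" by (metis of_int_mult of_int_of_nat_eq of_int_power of_int_numeral)
  then have "abs2_rat (of_int (C 0)) * (1 / real N) = abs2_rat 4 ^ (N - 1)"
    unfolding abs2_rat_N[symmetric] abs2_rat_mult[symmetric] abs2_rat_power[symmetric] by simp
  moreover have "abs2_rat 4 = 1 / 4"
    using abs2_rat_power[of 2 2] by (simp add: abs2_rat_2 power_one_over)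
  ultimately have C: "abs2_rat (of_int (C 0)) = real N * (1 / 4) ^ (N - 1)" using N_pos by (simp add: field_simps)
  have p: "(2::real) ^ (8 * m * N) = 2 ^ (5 * m) * 8 ^ (m * card J) * (4 ^ (N - 1)) ^ m"
  proof -
    have "8 * m * N = 5 * m + 3 * (m * card J) + 2 * ((N - 1) * m)"
    proof -
      obtain n where "N = Suc n" using N_pos by (cases N) auto
      then show ?thesis by (simp add: card_J algebra_simps)
    qed
    moreover have "(8::real) = 2 ^ 3" "(4::real) = 2 ^ 2" by simp_all
    ultimately show ?thesis by (simp only: power_add power_mult)
  qed
  have b: "abs2_rat (of_nat (m choose 2)) \<le> 1" using abs2_rat_of_int[of "int (m choose 2)"] by simp
  have "\<Lambda> * 2 ^ (8 * m * N) = (2 * 4 ^ s * real N ^ (s + 1 + m) * 2 ^ (5 * m)) * abs2_rat (of_nat (m choose 2))"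
    unfolding \<Lambda>_def C p by (simp add: power_mult_distrib power_one_over power_add field_simps)
  also have "\<dots> \<le> (2 * 4 ^ s * real N ^ (s + 1 + m) * 2 ^ (5 * m)) * 1" using b by (intro mult_left_mono) simp_all
  finally show ?thesis by simp
qed

end

section \<open>Conclusion\<close>

text \<open>The product formula for a nonzero element of Z[1/2]: it is a power of 2 times an odd
  integer, and the left-hand side of the product is the absolute value of that integer.\<close>

lemma one_le_abs_mult_abs2:
  assumes W: "W \<noteq> 0" "\<And>p. prime p \<Longrightarrow> p \<noteq> 2 \<Longrightarrow> W \<in> Zloc p"
  shows "1 \<le> real_of_rat \<bar>W\<bar> * abs2_rat W"
proof -
  obtain a b where ab: "W = of_int a / of_int b" "b \<noteq> 0" by (rule rat_frac)
  have a0: "a \<noteq> 0" using W(1) ab by auto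
  obtain a' where a': "a = 2 ^ multiplicity 2 a * a'" "\<not> 2 dvd a'"
    using multiplicity_decompose'[of a 2] a0 by (metis not_prime_unit two_is_prime_nat prime_int_numeral_eq)
  obtain b' where b': "b = 2 ^ multiplicity 2 b * b'" "\<not> 2 dvd b'"
    using multiplicity_decompose'[of b 2] ab(2) by (metis not_prime_unit two_is_prime_nat prime_int_numeral_eq)
  define k where "k = multiplicity 2 a"
  define n where "n = multiplicity 2 b"
  define W' :: rat where "W' = of_int a' / of_int b'"
  have a'0: "a' \<noteq> 0" "b' \<noteq> 0" using a'(2) b'(2) by auto
  have WW: "W = 2 ^ k / 2 ^ n * W'" unfolding W'_def ab(1) k_def n_def by (subst a'(1), subst b'(1)) simp
  have "W' \<in> \<int>"
  proof (rule Ints_if_Zloc)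
    fix p :: nat assume p: "prime p"
    show "W' \<in> Zloc p"
    proof (cases "p = 2")
      case True
      then show ?thesis unfolding W'_def using b'(2) p by (intro Zloc_divide_unit Zloc_of_int) simp_all
    next
      case False
      have "\<not> int p dvd 2 ^ k"
      proof
        assume "int p dvd 2 ^ k"
        then have "int p dvd int (2 ^ k)" by simp
        then have "p dvd 2 ^ k" by (simp only: int_dvd_int_iff)
        then have "p dvd 2" using p prime_dvd_power by blast
        then show False using p False by (simp add: primes_dvd_imp_eq)
      qed
      then have "W * of_int (2 ^ n) / of_int (2 ^ k) \<in> Zloc p"
        by (intro Zloc_divide_unit Zloc_mult Zloc_of_int W(2) p False)
      then show ?thesis unfolding WW by simp
    qed
  qed
  then obtain w where w: "W' = of_int w" by (rule Ints_cases)
  have "w \<noteq> 0" using w a'0 by (auto simp: W'_def)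
  then have "1 \<le> \<bar>w\<bar>" by linarith
  then have w1: "1 \<le> real_of_int \<bar>w\<bar>" by linarith
  have "abs2_rat W' = 1" unfolding W'_def abs2_rat_divide using a'(2) b'(2) by (simp add: abs2_rat_odd)
  then have "abs2_rat W = (1 / 2) ^ k / (1 / 2) ^ n"
    unfolding WW by (simp add: abs2_rat_mult abs2_rat_divide abs2_rat_power abs2_rat_2)
  moreover have "real_of_rat \<bar>W\<bar> = 2 ^ k / 2 ^ n * real_of_int \<bar>w\<bar>"
  proof -
    have "real_of_rat \<bar>of_int w\<bar> = real_of_int \<bar>w\<bar>" by (metis of_int_abs of_rat_of_int_eq)
    moreover have "\<bar>(2::rat) ^ k / 2 ^ n\<bar> = 2 ^ k / 2 ^ n" by simp
    ultimately show ?thesis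
      unfolding WW w abs_mult by (simp only: of_rat_mult of_rat_divide of_rat_power of_rat_numeral_eq)
  qed
  ultimately have "real_of_rat \<bar>W\<bar> * abs2_rat W = real_of_int \<bar>w\<bar>"
    by (simp add: power_one_over)
  then show ?thesis using w1 by simp
qed

lemma multiplicity_2_fact_power_2: "multiplicity 2 (fact (2 ^ e) :: nat) = 2 ^ e - 1"
proof -
  have "multiplicity 2 (fact (2 ^ e) :: nat) = (\<Sum>h=1..e. 2 ^ e div 2 ^ h)"
    by (rule multiplicity_fact) simp_all
  also have "\<dots> = (\<Sum>i<e. 2 ^ i)"
    by (rule sum.reindex_bij_witness[of _ "\<lambda>i. e - i" "\<lambda>h. e - h"]) (auto simp: power_diff)
  also have "\<dots> = 2 ^ e - 1" using sum_power2[of e] by (simp add: lessThan_atLeast0)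
  finally show ?thesis .
qed

lemma abs2_rat_fact_power_2: "abs2_rat (fact (2 ^ e)) = (1 / 2) ^ (2 ^ e - 1)"
proof -
  have "multiplicity 2 (int (fact (2 ^ e))) = 2 ^ e - 1"
    using multiplicity_int_of_nat[OF two_is_prime_nat, of "fact (2 ^ e)"] multiplicity_2_fact_power_2 by simp
  then show ?thesis using abs2_rat_of_int_eq[of "int (fact (2 ^ e))"] by simp
qed

context zeta_construction
begin

lemma fact_4N: "(fact (4 * N) :: 'a :: {semiring_char_0, ring_1}) = of_nat (4 * N) * of_nat (4 * N - 1) * fact T"
proof -
  have "4 * N = Suc (Suc T)" using N_pos by (simp add: T_def)
  then show ?thesis by (simp only: fact_Suc diff_Suc_1 mult.assoc)
qed

definition c0 :: rat where "c0 = fact (2 * N) ^ 2 / fact T"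

lemma D0_eq: "D0 = (of_nat \<Theta> * c0) ^ m"
  by (simp add: D0_def c0_def power_divide power_mult_distrib flip: power_mult)

text \<open>The prime 2 occurs exactly 4 N - 2 times in (2 N)! ^ 2 and 4 N - 1 times in (4 N)!,
  hence at most 4 N - 2 times in T!. So clearing denominators at odd primes does not spoil the
  2-adic smallness.\<close>

lemma abs2_D0: "abs2_rat D0 \<le> 1"
proof -
  have N2: "2 * N = 2 ^ (K + 1)" "4 * N = 2 ^ (K + 2)" by (simp_all add: N_def)
  have f2: "abs2_rat (fact (2 * N)) = (1 / 2) ^ (2 * N - 1)" unfolding N2(1) by (rule abs2_rat_fact_power_2)
  have f4: "abs2_rat (fact (4 * N)) = (1 / 2) ^ (4 * N - 1)" unfolding N2(2) by (rule abs2_rat_fact_power_2)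
  have ft: "abs2_rat (fact T) > 0" by (rule abs2_rat_pos) simp
  have "of_nat (4 * N) * of_nat (4 * N - 1) = (2 * of_int (int (2 * N) * int (4 * N - 1)) :: rat)" by simp
  then have "abs2_rat (of_nat (4 * N) * of_nat (4 * N - 1)) \<le> 1 / 2"
    using abs2_rat_of_int[of "int (2 * N) * int (4 * N - 1)"] by (simp only: abs2_rat_mult[of 2] abs2_rat_2)
  then have "abs2_rat (of_nat (4 * N) * of_nat (4 * N - 1)) * abs2_rat (fact T) \<le> 1 / 2 * abs2_rat (fact T)"
    using ft by (intro mult_right_mono) simp_all
  then have "(1 / 2) ^ (4 * N - 1) \<le> 1 / 2 * abs2_rat (fact T)"
    unfolding f4[symmetric] fact_4N abs2_rat_mult[symmetric] .
  moreover have "4 * N - 1 = Suc ((2 * N - 1) * 2)" using N_pos by simp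
  ultimately have "((1 / 2) ^ (2 * N - 1)) ^ 2 \<le> abs2_rat (fact T)" by (simp add: power_mult)
  then have "abs2_rat c0 \<le> 1" using ft by (simp add: c0_def abs2_rat_divide abs2_rat_power f2)
  moreover have "abs2_rat (of_nat \<Theta>) \<le> 1" using abs2_rat_of_int[of "int \<Theta>"] by simp
  ultimately show ?thesis unfolding D0_eq abs2_rat_power abs2_rat_mult by (intro power_le_one mult_le_one) simp_all
qed

text \<open>c0 is 4 N (4 N - 1) divided by the central binomial coefficient of 4 N. This contributes
  4 to the 12 in the exponent; the other 8 are the 2-adic size.\<close>

lemma c0_le: "real_of_rat c0 * 16 ^ N \<le> 64 * real N ^ 3"
proof -
  define B where "B = real ((2 * (2 * N)) choose (2 * N))"
  have "4 ^ (2 * N) / (2 * real (2 * N)) \<le> B" unfolding B_def by (rule central_binomial_lower_bound) (use N_pos in simp)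
  moreover have "(4::real) ^ (2 * N) = 16 ^ N" unfolding power_mult by simp
  ultimately have "16 ^ N / (2 * real (2 * N)) \<le> B" by (simp only:)
  then have B: "16 ^ N \<le> 4 * real N * B" using N_pos by (simp add: field_simps)
  have r: "real_of_rat c0 = fact (2 * N) ^ 2 / fact T"
  proof -
    have "real_of_rat (fact n) = fact n" for n using of_rat_of_nat_eq[of "fact n", where 'a = real] by simp
    then show ?thesis by (simp only: c0_def of_rat_divide of_rat_power)
  qed
  have "fact (4 * N) = B * fact (2 * N) ^ 2"
  proof -
    have n: "2 * (2 * N) = 4 * N" "4 * N - 2 * N = 2 * N" by simp_all
    have "fact (2 * N) * fact (4 * N - 2 * N) * ((4 * N) choose (2 * N)) = (fact (4 * N) :: nat)"
      by (rule binomial_fact_lemma) simp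
    then have "real (fact (2 * N) * fact (2 * N) * ((4 * N) choose (2 * N))) = real (fact (4 * N))" by (simp only: n)
    then show ?thesis unfolding B_def n by (simp only: of_nat_mult of_nat_fact power2_eq_square mult_ac)
  qed
  then have "B * fact (2 * N) ^ 2 = real (4 * N) * real (4 * N - 1) * fact T" unfolding fact_4N by simp
  then have "B * real_of_rat c0 = real (4 * N) * real (4 * N - 1)" unfolding r by (simp add: field_simps)
  also have "\<dots> \<le> real (4 * N) * real (4 * N)" by (intro mult_left_mono) simp_all
  finally have Bc: "B * real_of_rat c0 \<le> 16 * real N ^ 2" by (simp add: power2_eq_square)
  have "c0 \<ge> 0" by (simp add: c0_def)
  then have "real_of_rat c0 * 16 ^ N \<le> real_of_rat c0 * (4 * real N * B)" using B by (intro mult_left_mono) simp_all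
  also have "\<dots> = 4 * real N * (B * real_of_rat c0)" by simp
  also have "\<dots> \<le> 4 * real N * (16 * real N ^ 2)" using Bc by (intro mult_left_mono) simp_all
  finally show ?thesis by (simp add: power3_eq_cube power2_eq_square)
qed

definition C1 :: "rat \<Rightarrow> rat" where
  "C1 Z = (Z + 8 * of_nat (s + 1)) * (of_nat (2 * m) * 2 ^ (3 * m) * 3 * (4 * (16 * of_nat m) ^ (2 * m)))"

text \<open>\<open>S\<close> is the limit of means that all have size \<open>\<Lambda>\<close> from
  some level on, so it has this size itself and is not 0. Multiplied by \<open>q\<close>,
  \<open>D0\<close> and the power of \<open>d\<close> it is integral at all odd primes, and these
  multipliers have 2-adic size at most 1; the product formula then confronts the 2-adic size with
  the archimedean one.\<close>

lemma main_inequality: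
  fixes q :: nat
  assumes lim: "\<And>i. i \<in> {2..2 * m} \<Longrightarrow> even (i + s) \<Longrightarrow> null2 (\<lambda>M. vmean M (ipow (i + s)) - z i)"
    and Z: "\<And>i. i \<in> {1..2 * m} \<Longrightarrow> \<bar>z i\<bar> \<le> Z" "0 \<le> Z"
    and q: "q > 0" "\<And>i. i \<in> {1..2 * m} \<Longrightarrow> of_nat q * z i \<in> \<int>"
  shows "2 ^ (12 * m * N) \<le> real q * real_of_rat (C1 Z) * 64 ^ m * (2 * 4 ^ s * 2 ^ (5 * m)) *
    real N ^ (6 * m + s + 4) * real \<Theta> ^ m * real d ^ (3 * m - 1)"
proof -
  define S where "S = (\<Sum>i=1..2 * m. rho i * z i) + rho0"
  have nul: "null2 (\<lambda>M. vmean M F - S)" unfolding S_def by (rule vmean_F_null2[OF lim])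
  obtain M0 where M0: "\<And>M. M \<ge> M0 \<Longrightarrow> abs2_rat (vmean M F - S) < \<Lambda>" using null2D[OF nul \<Lambda>_pos] by blast
  define M where "M = max M0 (Suc K)"
  have v: "abs2_rat (vmean M F) = \<Lambda>" by (rule abs2_vmean_F) (simp add: M_def)
  have "abs2_rat (S - vmean M F) < abs2_rat (vmean M F)"
    unfolding v abs2_rat_diff_commute[of S] by (rule M0) (simp add: M_def)
  then have SL: "abs2_rat S = \<Lambda>" unfolding v[symmetric] by (rule abs2_rat_eqI)
  then have S0: "S \<noteq> 0" using \<Lambda>_pos by auto
  define W where "W = of_nat q * (D0 * of_nat d ^ (3 * m - 1) * S)"
  have c00: "c0 > 0" by (simp add: c0_def)
  have D00: "D0 > 0" unfolding D0_eq using c00 \<Theta>_pos by (intro zero_less_power mult_pos_pos) simp_all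
  have "W \<noteq> 0" unfolding W_def using S0 D00 d_pos q by simp
  moreover have "W \<in> Zloc p" if p: "prime p" "p \<noteq> 2" for p
  proof -
    have "W = (\<Sum>i=1..2 * m. (D0 * of_nat d ^ (3 * m - 1) * rho i) * (of_nat q * z i)) +
        of_nat q * (D0 * of_nat d ^ (3 * m - 1) * rho0)"
      unfolding W_def S_def by (simp add: distrib_left sum_distrib_left mult_ac)
    moreover have t: "(D0 * of_nat d ^ (3 * m - 1) * rho i) * (of_nat q * z i) \<in> Zloc p" if "i \<in> {1..2 * m}" for i
    proof -
      have "of_nat q * z i \<in> Zloc p"
        using q(2)[OF that] by (auto elim!: Ints_cases simp: Zloc_of_int[OF p(1)])
      then show ?thesis by (rule Zloc_mult[OF p(1) Zloc_rho[OF p that]])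
    qed
    ultimately show ?thesis
      by (simp only:) (rule Zloc_add[OF p(1) Zloc_sum[OF p(1) t] Zloc_mult[OF p(1) Zloc_of_nat[OF p(1)] Zloc_rho0[OF p]]])
  qed
  ultimately have 1: "1 \<le> real_of_rat \<bar>W\<bar> * abs2_rat W" by (rule one_le_abs_mult_abs2)
  have i1: "abs2_rat (of_nat k) \<le> 1" for k using abs2_rat_of_int[of "int k"] by simp
  have W2: "abs2_rat W \<le> \<Lambda>"
  proof -
    have "abs2_rat (of_nat q) * (abs2_rat D0 * abs2_rat (of_nat d) ^ (3 * m - 1)) \<le> 1"
      using i1 abs2_D0 by (intro mult_le_one power_le_one) simp_all
    then have "abs2_rat (of_nat q) * (abs2_rat D0 * abs2_rat (of_nat d) ^ (3 * m - 1)) * \<Lambda> \<le> 1 * \<Lambda>"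
      using \<Lambda>_pos by (intro mult_right_mono) simp_all
    then show ?thesis by (simp add: W_def abs2_rat_mult abs2_rat_power SL mult.assoc)
  qed
  have Sle: "real_of_rat \<bar>S\<bar> \<le> real_of_rat (C1 Z) * real N ^ (2 * m + 3)"
  proof -
    have "\<bar>S\<bar> \<le> C1 Z * of_nat N ^ (2 * m + 3)" unfolding S_def C1_def by (rule abs_combination_le[OF Z])
    then have "real_of_rat \<bar>S\<bar> \<le> real_of_rat (C1 Z * of_nat N ^ (2 * m + 3))" by (simp only: of_rat_less_eq)
    then show ?thesis by (simp add: of_rat_mult of_rat_power)
  qed
  have C1: "real_of_rat (C1 Z) \<ge> 0" using Z(2) by (simp add: C1_def)
  have WR: "real_of_rat \<bar>W\<bar> = real q * (real_of_rat D0 * real d ^ (3 * m - 1)) * real_of_rat \<bar>S\<bar>"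
  proof -
    have "\<bar>W\<bar> = of_nat q * (D0 * of_nat d ^ (3 * m - 1)) * \<bar>S\<bar>"
      unfolding W_def using D00 by (simp add: abs_mult)
    then show ?thesis by (simp add: of_rat_mult of_rat_power)
  qed
  have D0r: "real_of_rat D0 * 2 ^ (4 * m * N) \<le> (64 * real N ^ 3) ^ m * real \<Theta> ^ m"
  proof -
    have "(2::real) ^ (4 * m * N) = (16 ^ N) ^ m"
    proof -
      have "(16::real) = 2 ^ 4" by simp
      then show ?thesis by (simp only: power_mult[symmetric] mult_ac)
    qed
    then have "real_of_rat D0 * 2 ^ (4 * m * N) = (real_of_rat c0 * 16 ^ N) ^ m * real \<Theta> ^ m"
      unfolding D0_eq by (simp add: of_rat_mult of_rat_power power_mult_distrib)
    also have "\<dots> \<le> (64 * real N ^ 3) ^ m * real \<Theta> ^ m"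
      using c0_le c00 by (intro mult_right_mono power_mono) simp_all
    finally show ?thesis .
  qed
  have "1 \<le> real_of_rat \<bar>W\<bar> * \<Lambda>" using 1 W2 by (meson mult_left_mono order_trans zero_le_of_rat_iff abs_ge_zero)
  then have "2 ^ (4 * m * N) * 2 ^ (8 * m * N) * 1 \<le> 2 ^ (4 * m * N) * 2 ^ (8 * m * N) * (real_of_rat \<bar>W\<bar> * \<Lambda>)"
    by (intro mult_left_mono) simp_all
  then have "2 ^ (12 * m * N) \<le> (real_of_rat D0 * 2 ^ (4 * m * N)) * (\<Lambda> * 2 ^ (8 * m * N)) * (real q * real d ^ (3 * m - 1) * real_of_rat \<bar>S\<bar>)"
    unfolding WR by (simp add: mult_ac flip: power_add)
  also have "\<dots> \<le> ((64 * real N ^ 3) ^ m * real \<Theta> ^ m) * (2 * 4 ^ s * real N ^ (s + 1 + m) * 2 ^ (5 * m)) *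
      (real q * real d ^ (3 * m - 1) * (real_of_rat (C1 Z) * real N ^ (2 * m + 3)))"
  proof (rule mult_mono)
    show "(real_of_rat D0 * 2 ^ (4 * m * N)) * (\<Lambda> * 2 ^ (8 * m * N)) \<le>
        ((64 * real N ^ 3) ^ m * real \<Theta> ^ m) * (2 * 4 ^ s * real N ^ (s + 1 + m) * 2 ^ (5 * m))"
      by (rule mult_mono[OF D0r \<Lambda>_le]) (use \<Lambda>_pos in simp_all)
    show "real q * real d ^ (3 * m - 1) * real_of_rat \<bar>S\<bar> \<le>
        real q * real d ^ (3 * m - 1) * (real_of_rat (C1 Z) * real N ^ (2 * m + 3))"
      by (rule mult_left_mono[OF Sle]) simp
  qed simp_all
  also have "\<dots> = real q * real_of_rat (C1 Z) * 64 ^ m * (2 * 4 ^ s * 2 ^ (5 * m)) *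
    (real N ^ (3 * m) * real N ^ (s + 1 + m) * real N ^ (2 * m + 3)) * real \<Theta> ^ m * real d ^ (3 * m - 1)"
  proof -
    have "(64 * real N ^ 3) ^ m = 64 ^ m * real N ^ (3 * m)" by (simp only: power_mult_distrib power_mult)
    then show ?thesis by (simp only: mult_ac)
  qed
  also have "real N ^ (3 * m) * real N ^ (s + 1 + m) * real N ^ (2 * m + 3) = real N ^ (6 * m + s + 4)"
    by (simp only: power_add[symmetric]) (rule arg_cong[of _ _ "\<lambda>n. real N ^ n"], simp)
  finally show ?thesis .
qed

text \<open>The primes in \<open>\<Theta>\<close> are distinct, divide lcm(1, ..., 4 N), and are too
  large to divide lcm(1, ..., 2 N).\<close>

lemma \<Theta>_lcmn_dvd: "\<Theta> * lcmn (2 * N) dvd lcmn (4 * N)"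
proof -
  have "(\<Prod>p\<in>A. p) * lcmn (2 * N) dvd lcmn (4 * N)" if "finite A" "A \<subseteq> {p. prime p \<and> 2 * N < p \<and> p \<le> 4 * N}" for A
    using that
  proof (induction A rule: finite_induct)
    case empty
    then show ?case using lcmn_dvd_mono[of "2 * N" "4 * N"] by simp
  next
    case (insert p A)
    have p: "prime p" "2 * N < p" "p \<le> 4 * N" using insert.prems by auto
    have "\<not> p dvd (\<Prod>p\<in>A. p) * lcmn (2 * N)"
    proof
      assume "p dvd (\<Prod>p\<in>A. p) * lcmn (2 * N)"
      then consider "p dvd (\<Prod>p\<in>A. p)" | "p dvd lcmn (2 * N)" using p(1) by (auto simp: prime_dvd_mult_iff)
      then show False
      proof cases
        case 1
        then obtain q' where q': "q' \<in> A" "p dvd q'" using p(1) insert.hyps by (auto simp: prime_dvd_prod_iff)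
        then have "prime q'" using insert.prems by auto
        then show False using q' insert.hyps p(1) by (metis primes_dvd_imp_eq)
      next
        case 2
        then show False using prime_power_dvd_lcmn_iff[OF p(1), of 1 "2 * N"] p by simp
      qed
    qed
    then have cop: "coprime p ((\<Prod>p\<in>A. p) * lcmn (2 * N))" using p(1) prime_imp_coprime by blast
    have "p dvd lcmn (4 * N)" using p prime_ge_1_nat[OF p(1)] by (intro dvd_lcmn) simp_all
    moreover have "(\<Prod>p\<in>A. p) * lcmn (2 * N) dvd lcmn (4 * N)" using insert by simp
    ultimately have "p * ((\<Prod>p\<in>A. p) * lcmn (2 * N)) dvd lcmn (4 * N)" using cop by (rule divides_mult)
    then show ?case using insert.hyps by (simp add: mult.assoc)
  qed
  from this[OF finite_primes order_refl] show ?thesis by (simp add: \<Theta>_def)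
qed

lemma ln_\<Theta>: "ln (real \<Theta>) \<le> psi (4 * N) - psi (2 * N)"
proof -
  have "\<Theta> * lcmn (2 * N) \<le> lcmn (4 * N)" using \<Theta>_lcmn_dvd lcmn_pos by (rule dvd_imp_le)
  then have "real \<Theta> * real (lcmn (2 * N)) \<le> real (lcmn (4 * N))" by (simp only: of_nat_mult[symmetric] of_nat_le_iff)
  then have "ln (real \<Theta> * real (lcmn (2 * N))) \<le> psi (4 * N)"
    unfolding psi_def using \<Theta>_pos lcmn_pos by (intro ln_mono) simp_all
  then show ?thesis using \<Theta>_pos lcmn_pos[of "2 * N"] by (simp add: psi_def ln_mult)
qed

lemma ln_d: "ln (real d) \<le> psi (2 * N) + real r * real (K div 2 + 2)"
proof -
  have r0: "real r > 0" by (simp add: r_def)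
  have "ln (fact r) \<le> ln (real r ^ r)"
    using fact_le_power[of r, where 'a = real] by (intro ln_mono) simp_all
  also have "\<dots> = real r * ln (real r)" using r0 by (simp add: ln_realpow)
  also have "ln (real r) = real (K div 2 + 2) * ln 2"
  proof -
    define k where "k = K div 2 + 2"
    have "real r = 2 ^ k" by (simp add: r_def k_def)
    then show ?thesis unfolding k_def[symmetric] by (simp add: ln_realpow)
  qed
  also have "real r * (real (K div 2 + 2) * ln 2) \<le> real r * (real (K div 2 + 2) * 1)"
    using ln_prime_bounds(1) by (intro mult_left_mono) simp_all
  finally have "ln (fact r) \<le> real r * real (K div 2 + 2)" by simp
  moreover have "ln (real d) = psi (2 * N) + ln (fact r)"
    using lcmn_pos[of "2 * N"] by (simp add: d_def psi_def ln_mult)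
  ultimately show ?thesis by simp
qed

text \<open>\<open>\<Theta>\<close> contributes m (\<psi>(4 N) - \<psi>(2 N)) and \<open>d\<close>
  at most 3 m \<psi>(2 N), which is how \<psi>(4 N) + 2 \<psi>(2 N) arises.\<close>

lemma log_inequality:
  assumes E: "E > 0" and le: "2 ^ (12 * m * N) \<le> E * real N ^ e * real \<Theta> ^ m * real d ^ (3 * m - 1)"
  shows "12 * m * N * ln 2 \<le> ln E + e * (K * ln 2) + m * (psi (4 * N) + 2 * psi (2 * N)) + 3 * m * (real r * real (K div 2 + 2))"
proof -
  have N0: "real N > 0" and lnN: "ln (real N) = K * ln 2" by (simp_all add: N_def ln_realpow)
  have r3: "real (3 * m - 1) = 3 * real m - 1" using m_ge by (simp add: of_nat_diff)
  have "12 * m * N * ln 2 = ln (2 ^ (12 * m * N))" by (simp add: ln_realpow)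
  also have "\<dots> \<le> ln (E * real N ^ e * real \<Theta> ^ m * real d ^ (3 * m - 1))" using le by (intro ln_mono) simp_all
  also have "\<dots> = ln E + e * ln N + m * ln \<Theta> + (3 * m - 1) * ln d"
  proof -
    have "real (3 * m - 1) = 3 * real m - 1" using m_ge by (simp add: of_nat_diff)
    then show ?thesis using E N0 \<Theta>_pos d_pos by (simp add: ln_mult ln_realpow)
  qed
  also have "\<dots> \<le> ln E + e * ln N + m * (psi (4 * N) - psi (2 * N)) + (3 * m - 1) * (psi (2 * N) + real r * real (K div 2 + 2))"
    using ln_\<Theta> ln_d m_ge by (intro add_mono mult_left_mono) simp_all
  also have "\<dots> = ln E + e * ln N + m * (psi (4 * N) + 2 * psi (2 * N)) + 3 * m * (real r * real (K div 2 + 2))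
      - (psi (2 * N) + real r * real (K div 2 + 2))"
    unfolding r3 by (simp add: algebra_simps)
  also have "\<dots> \<le> ln E + e * ln N + m * (psi (4 * N) + 2 * psi (2 * N)) + 3 * m * (real r * real (K div 2 + 2))"
  proof -
    have "0 \<le> real r * real (K div 2 + 2)" by simp
    then show ?thesis using psi_nonneg[of "2 * N"] by linarith
  qed
  finally show ?thesis unfolding lnN .
qed

end

lemma linear_forms_contradiction:
  fixes s :: nat and z :: "nat \<Rightarrow> rat"
  assumes lim: "\<And>i. i \<in> {2..2 * (s + 2)} \<Longrightarrow> even (i + s) \<Longrightarrow> null2 (\<lambda>M. vmean M (ipow (i + s)) - z i)"
  shows False
proof -
  define m where "m = s + 2"
  have mm: "zeta_construction.m s = m" by (simp add: zeta_construction.m_def m_def)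
  \<comment> \<open>A common denominator of the \<open>z i\<close>. Like \<open>Z\<close> and
    \<open>E\<close> below it does not depend on \<open>N\<close>, so its logarithm is a constant in
    the final comparison.\<close>
  define q where "q = (\<Prod>i=1..2 * m. nat (snd (quotient_of (z i))))"
  have den: "snd (quotient_of x) > 0" for x by (rule quotient_of_denom_pos')
  have q0: "q > 0" unfolding q_def using den by (intro prod_pos) simp
  have qz: "of_nat q * z i \<in> \<int>" if i: "i \<in> {1..2 * m}" for i
  proof -
    obtain a b where ab: "quotient_of (z i) = (a, b)" by (cases "quotient_of (z i)")
    then have b: "b > 0" using den[of "z i"] by simp
    define R where "R = (\<Prod>i\<in>{1..2 * m} - {i}. nat (snd (quotient_of (z i))))"
    have "q = nat (snd (quotient_of (z i))) * R"
      unfolding q_def R_def using i by (intro prod.remove) simp_all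
    then have "q = nat b * R" by (simp add: ab)
    then have "of_nat q * z i = of_nat R * (of_nat (nat b) * z i)" by (simp only: of_nat_mult mult_ac)
    also have "of_nat (nat b) * z i = of_int a" unfolding quotient_of_div[OF ab] using b by simp
    finally show ?thesis by simp
  qed
  define Z where "Z = (\<Sum>i=1..2 * m. \<bar>z i\<bar>)"
  have Z: "\<bar>z i\<bar> \<le> Z" if "i \<in> {1..2 * m}" for i
    unfolding Z_def using member_le_sum[of i "{1..2 * m}" "\<lambda>i. \<bar>z i\<bar>"] that by simp
  have Z0: "0 \<le> Z" by (simp add: Z_def sum_nonneg)
  define E where "E = real q * real_of_rat (zeta_construction.C1 s Z) * 64 ^ m * (2 * 4 ^ s * 2 ^ (5 * m))"
  have C1: "zeta_construction.C1 s Z > 0"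
  proof -
    have "Z + 8 * of_nat (s + 1) > 0" using Z0 by (simp add: add_nonneg_pos)
    then show ?thesis unfolding zeta_construction.C1_def mm by (intro mult_pos_pos zero_less_power) (simp_all add: m_def)
  qed
  have E0: "E > 0" unfolding E_def using q0 C1 by (intro mult_pos_pos zero_less_power) simp_all
  define e where "e = 6 * m + s + 4"
  obtain C where C: "\<And>x. x \<ge> 1800 \<Longrightarrow> psi x + 2 * psi (x div 2) \<le> 20792 / 10000 * x + C * (ln x + 1)"
    using psi_bound by blast
  define B where "B = \<bar>ln E\<bar> + 4 * e + 4 * m * \<bar>C\<bar> + 24 * m"
  \<comment> \<open>9 / 10000 is a lower bound for 12 * 0.693147 - 4 * 2.0792, the margin of the
    main terms per m N. \<open>j\<close> makes it outweigh everything else, which is bounded by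
    \<open>B\<close> times sqrt N times j + 1.\<close>
  obtain j :: nat where j: "real j > max 10 (B / (9 / 10000 * m))" using reals_Archimedean2 by blast
  \<comment> \<open>With a multiple of 4 both sqrt N = X = 2 ^ (2 j) and r = 4 X are exact, and X
    \<ge> (j + 1) ^ 2.\<close>
  define K where "K = 4 * j"
  define X where "X = (2::real) ^ (2 * j)"
  have j10: "j \<ge> 10" using j by simp
  interpret L: zeta_construction s K .
  have m2: "real m \<ge> 2" by (simp add: m_def)
  have main: "12 * m * L.N * ln 2 \<le> ln E + e * (K * ln 2) + m * (psi (4 * L.N) + 2 * psi (2 * L.N)) + 3 * m * (real L.r * real (K div 2 + 2))"
    using L.log_inequality[OF E0, of e] L.main_inequality[of z Z q] lim Z Z0 q0 qz unfolding mm E_def e_def m_def[symmetric]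
    by simp
  have Nr: "real L.N = X * X" unfolding L.N_def unfolding X_def K_def by (simp flip: power_add)
  have rr: "real L.r = 4 * X" unfolding L.r_def unfolding X_def K_def by (simp add: power_add)
  have X1: "real j + 1 \<le> X / (real j + 1)"
  proof -
    have "j + 1 \<le> 2 ^ j" using less_exp[of j] by linarith
    then have "real (j + 1) \<le> real (2 ^ j)" by (simp only: of_nat_le_iff)
    then have "real j + 1 \<le> 2 ^ j" by simp
    then have "(real j + 1) * (real j + 1) \<le> 2 ^ j * 2 ^ j" by (intro mult_mono) simp_all
    also have "2 ^ j * 2 ^ j = X" by (simp only: X_def mult_2 power_add)
    finally show ?thesis by (simp add: pos_le_divide_eq)
  qed
  have Xg: "X \<ge> 1" unfolding X_def by simp
  have "(2::nat) ^ 10 \<le> 2 ^ K" unfolding K_def using j10 by (intro power_increasing) simp_all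
  then have "4 * L.N \<ge> 1800" by (simp add: L.N_def)
  from C[OF this] have psi: "psi (4 * L.N) + 2 * psi (2 * L.N) \<le> 20792 / 10000 * (4 * real L.N) + C * (ln (4 * real L.N) + 1)"
    by simp
  have ln4: "ln (4 * real L.N) = (K + 2) * ln 2"
  proof -
    have "4 * real L.N = 2 ^ (K + 2)" by (simp add: L.N_def)
    then show ?thesis by (simp only: ln_realpow)
  qed
  have ln2: "693147 / 1000000 \<le> ln (2::real)" "ln (2::real) \<le> 1" using ln_prime_bounds(1) by auto
  have "C * (ln (4 * real L.N) + 1) \<le> \<bar>C\<bar> * (4 * (real j + 1))"
  proof -
    have "ln (4 * real L.N) \<le> real (K + 2) * 1" unfolding ln4 using ln2 by (intro mult_left_mono) simp_all
    then have "ln (4 * real L.N) + 1 \<le> 4 * (real j + 1)" by (simp add: K_def)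
    moreover have "0 \<le> ln (4 * real L.N) + 1" unfolding ln4 using ln2 by simp
    ultimately show ?thesis by (intro mult_mono) simp_all
  qed
  then have "m * (psi (4 * L.N) + 2 * psi (2 * L.N)) \<le> m * (20792 / 10000 * (4 * real L.N) + \<bar>C\<bar> * (4 * (real j + 1)))"
    using psi by (intro mult_left_mono) simp_all
  moreover have "e * (K * ln 2) \<le> e * (4 * (real j + 1))"
  proof -
    have "K * ln 2 \<le> real K * 1" using ln2 by (intro mult_left_mono) simp_all
    then show ?thesis by (intro mult_left_mono) (simp_all add: K_def)
  qed
  moreover have "3 * m * (real L.r * real (K div 2 + 2)) = 24 * m * X * (real j + 1)"
    unfolding rr by (simp add: K_def algebra_simps)
  moreover have "12 * m * L.N * (693147 / 1000000) \<le> 12 * m * L.N * ln 2" using ln2 by (intro mult_left_mono) simp_all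
  ultimately have "9 / 10000 * m * (X * X) \<le> \<bar>ln E\<bar> + e * (4 * (real j + 1)) + m * (\<bar>C\<bar> * (4 * (real j + 1))) + 24 * m * X * (real j + 1)"
  proof -
    have "12 * m * L.N * (693147 / 1000000) - m * (20792 / 10000 * (4 * real L.N)) \<ge> 9 / 10000 * m * (X * X)"
    proof -
      have "12 * m * L.N * (693147 / 1000000) - m * (20792 / 10000 * (4 * real L.N)) = (12 * (693147 / 1000000) - 20792 / 10000 * 4) * (m * (X * X))"
        by (simp add: Nr algebra_simps)
      also have "\<dots> \<ge> 9 / 10000 * (m * (X * X))" by (intro mult_right_mono) simp_all
      finally show ?thesis by simp
    qed
    then show ?thesis
      using main \<open>m * (psi (4 * L.N) + 2 * psi (2 * L.N)) \<le> _\<close> \<open>e * (K * ln 2) \<le> _\<close> \<open>3 * m * (real L.r * real (K div 2 + 2)) = _\<close>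
        \<open>12 * m * L.N * (693147 / 1000000) \<le> _\<close> abs_ge_self[of "ln E"]
      unfolding distrib_left[of "real m" "20792 / 10000 * (4 * real L.N)"] by linarith
  qed
  also have "\<dots> \<le> B * (X * (real j + 1))"
  proof -
    have a: "1 * 1 \<le> X * (real j + 1)" using Xg by (intro mult_mono) simp_all
    have b: "1 * (real j + 1) \<le> X * (real j + 1)" using Xg by (intro mult_right_mono) simp_all
    have "\<bar>ln E\<bar> * 1 \<le> \<bar>ln E\<bar> * (X * (real j + 1))" using a by (intro mult_left_mono) simp_all
    moreover have "4 * e * (real j + 1) \<le> 4 * e * (X * (real j + 1))" using b by (intro mult_left_mono) simp_all
    moreover have "4 * m * \<bar>C\<bar> * (real j + 1) \<le> 4 * m * \<bar>C\<bar> * (X * (real j + 1))" using b by (intro mult_left_mono) simp_all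
    ultimately show ?thesis unfolding B_def by (simp add: algebra_simps)
  qed
  finally have "X * (9 / 10000 * m * X) \<le> X * (B * (real j + 1))" by (simp add: mult_ac)
  then have "9 / 10000 * m * X \<le> B * (real j + 1)" by (rule mult_left_le_imp_le) (use Xg in linarith)
  then have "9 / 10000 * m * X / (real j + 1) \<le> B" by (subst pos_divide_le_eq) simp_all
  then have "9 / 10000 * m * (X / (real j + 1)) \<le> B" by (simp only: times_divide_eq_right)
  moreover have "9 / 10000 * m * (real j + 1) \<le> 9 / 10000 * m * (X / (real j + 1))" using X1 by (intro mult_left_mono) simp_all
  moreover have "B < 9 / 10000 * m * (real j + 1)"
  proof -
    have "B / (9 / 10000 * m) < real j + 1" using j by linarith
    then show ?thesis using m2 by (simp add: field_simps)
  qed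
  ultimately show False by linarith
qed

theorem theorem1p1:
  shows "(\<forall>s::nat. \<exists>z \<in> {zeta2 j | j::int. j \<in> {int s + 3 .. 3 * int s + 5} \<and> odd j}. z \<notin> \<rat>) \<and>
    (\<exists>z \<in> {zeta2 7, zeta2 9, zeta2 11, zeta2 13}. z \<notin> \<rat>)"
proof
  show 1: "\<forall>s::nat. \<exists>z \<in> {zeta2 j | j::int. j \<in> {int s + 3 .. 3 * int s + 5} \<and> odd j}. z \<notin> \<rat>"
  proof (rule allI, rule ccontr)
    fix s :: nat
    assume "\<not> (\<exists>z \<in> {zeta2 j | j::int. j \<in> {int s + 3 .. 3 * int s + 5} \<and> odd j}. z \<notin> \<rat>)"
    then have rat: "zeta2 j \<in> \<rat>" if "j \<in> {int s + 3 .. 3 * int s + 5}" "odd j" for j using that by blast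
    \<comment> \<open>The integral of (4 t + 1) ^ (- q) with q = i + s belongs to the zeta value at
      i + s + 1; for i from 2 to 2 (s + 2) this runs from s + 3 to 3 s + 5.\<close>
    have "\<exists>z. i \<in> {2..2 * (s + 2)} \<and> even (i + s) \<longrightarrow> null2 (\<lambda>M. vmean M (ipow (i + s)) - z)" for i
    proof (cases "i \<in> {2..2 * (s + 2)} \<and> even (i + s)")
      case True
      then have "zeta2 (int (Suc (i + s))) \<in> \<rat>" by (intro rat) auto
      then obtain z where "zeta2 (int (Suc (i + s))) = of_rat z" by (rule Rats_cases)
      then have "null2 (\<lambda>M. vmean M (ipow (i + s)) - 2 * of_nat (i + s) * z)" using True by (intro zeta2_null2) auto
      then show ?thesis by blast
    next
      case False
      then show ?thesis by blast
    qed
    then obtain z where "\<And>i. i \<in> {2..2 * (s + 2)} \<and> even (i + s) \<longrightarrow> null2 (\<lambda>M. vmean M (ipow (i + s)) - z i)" by metis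
    then show False using linear_forms_contradiction[of s z] by blast
  qed
  \<comment> \<open>For s = 3 the interval is [6, 14].\<close>
  obtain j :: int where j: "zeta2 j \<notin> \<rat>" "6 \<le> j" "j \<le> 14" "odd j" using 1[rule_format, of 3] by auto
  then have "j = 7 \<or> j = 9 \<or> j = 11 \<or> j = 13" by presburger
  then show "\<exists>z \<in> {zeta2 7, zeta2 9, zeta2 11, zeta2 13}. z \<notin> \<rat>" using j(1) by auto
qed

end
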